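(* Let $(\nu_n)_n$ denote the sequence of the normalized zero counting measures associated with the polynomials $\tilde B_n$, and let $(\mu_n)_n$ be the sequence of the normalized zero counting measures associated with the Apéry polynomials $B_n$. Then: (i) The sequence $(\nu_n)_n$ converges in the weak-star sense to a unit measure $\nu$ supported on $[-1,1]$. This limit measure $\nu$ is the unique solution of the weighted equilibrium problem on $[-1,1]$ with respect to the weight function $$w(x)=\left|\sqrt{x+1}+2\sqrt{x-1}+2\sqrt{x-1+\sqrt{x-1}\sqrt{x+1}}\right|^{-2},$$ and its logarithmic potential is given by $$\mathcal{U}^{\nu}(z)=\log(1+\sqrt2)^4-2\log\left|\sqrt{z+1}+2\sqrt{z-1}+2\sqrt{z-1+\sqrt{z-1}\sqrt{z+1}}\right|,\qquad z\in\mathbb{C}.$$ Moreover, $\nu$ is absolutely continuous with respect to the Lebesgue measure on $[-1,1]$ and its Radon-Nikodym derivative is given explicitly by $$d\nu=\frac{1}{\pi\sqrt{1+x}\,(1-x)^{3/4}\left(\sqrt2+\sqrt{1-x}\right)^{1/2}}\,dx .$$ (ii) The sequence $(\mu_n)_n$ converges in the weak-star sense to a unit measure $\mu$ supported on $(-\infty,0]$ possessing the logarithmic potential $$\mathcal{U}^{\mu}(z)=4\log2-2\log\left|1+2\left(\sqrt z+\sqrt{z+\sqrt z}\right)\right|,\qquad z\in\mathbb{C}.$$ Moreover, $\mu$ is absolutely continuous with respect to the Lebesgue measure (on $(-\infty,0]$) and its Radon-Nikodym derivative is given explicitly by $$d\mu=\frac{1}{\sqrt2\,\pi\,|x|^{3/4}(1+|x|)^{1/2}\left(\sqrt{|x|}+\sqrt{1+|x|}\right)^{1/2}}\,dx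 .$$
   Context: The Apéry polynomials are $B_n(z)=\sum_{k=0}^n\binom{n}{k}^2\binom{n+k}{k}^2z^k$, and $$\tilde B_n(z)=(z+1)^nB_n\left(\frac{z-1}{z+1}\right)=\sum_{k=0}^n\binom{n}{k}^2\binom{n+k}{k}^2(z-1)^k(z+1)^{n-k},\qquad n\ge1 .$$ Both $B_n$ and $\tilde B_n$ have degree $n$. The normalized zero counting measure of a polynomial of degree $n\ge 1$ is $\frac1n\sum_{\zeta}\delta_\zeta$, the sum running over its zeros counted with multiplicity. All roots are defined by $\sqrt z=\exp\left(\frac12(\log|z|+i\arg(z))\right)$ with $\arg(z)\in(-\pi,\pi]$ (and $\sqrt0=0$). A unit measure is a positive Borel measure of total mass $1$. Weak-star convergence $\sigma_n\to\sigma$ means $\int g\,d\sigma_n\to\int g\,d\sigma$ for every continuous compactly supported function $g$. The logarithmic potential of a measure $\sigma$ is $\mathcal{U}^\sigma(z)=\int\log|z-t|^{-1}\,d\sigma(t)$. The weighted equilibrium problem on $[-1,1]$ with respect to a weight $w$ is (as in Saff and Totik) the problem of minimizing the weighted energy $$I_w(\sigma)=\iint\log\frac{1}{|s-t|\,w(s)\,w(t)}\,d\sigma(s)\,d\sigma(t)$$ over all unit Borel measures $\sigma$ supported on $[-1,1]$. *)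

theory Defs
  imports "HOL-Probability.Probability" "HOL-Computational_Algebra.Polynomial"
begin

definition apery_poly :: "nat \<Rightarrow> complex poly" where
  "apery_poly n =
     (\<Sum>k\<le>n. monom (of_nat ((n choose k)\<^sup>2 * ((n + k) choose k)\<^sup>2)) k)"

definition apery_tilde_poly :: "nat \<Rightarrow> complex poly" where
  "apery_tilde_poly n =
     (\<Sum>k\<le>n. smult (of_nat ((n choose k)\<^sup>2 * ((n + k) choose k)\<^sup>2))
        ([:-1, 1:] ^ k * [:1, 1:] ^ (n - k)))"

lemma poly_apery_tilde_poly:
  assumes "z \<noteq> -1"
  shows "poly (apery_tilde_poly n) z = (z + 1) ^ n * poly (apery_poly n) ((z - 1) / (z + 1))"
proof -
  have nz: "z + 1 \<noteq> 0"
    using assms by (simp add: add_eq_0_iff2)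
  have eq: "(z - 1) ^ k * (1 + z) ^ (n - k) = (z + 1) ^ n * ((z - 1) / (z + 1)) ^ k"
    if "k \<le> n" for k
    using nz that by (simp add: power_diff power_divide field_simps)
  show ?thesis
    unfolding apery_tilde_poly_def apery_poly_def
    by (auto simp: poly_sum poly_monom sum_distrib_left eq mult.left_commute intro!: sum.cong)
qed

text \<open>The square root with argument in the interval from minus pi (excluded) to pi is
  the library's principal branch.\<close>

lemma csqrt_principal_branch:
  assumes "z \<noteq> 0"
  shows "csqrt z = exp (1 / 2 * (complex_of_real (ln (cmod z)) + \<i> * complex_of_real (Arg z)))"
  using assms by (simp add: csqrt_exp_Ln Ln_Arg)

definition zero_counting_measure :: "complex poly \<Rightarrow> complex measure" where
  "zero_counting_measure p =
     distr (point_measure {\<zeta>. poly p \<zeta> = 0} (\<lambda>\<zeta>. ennreal (real (order \<zeta> p) / real (degree p))))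
       borel (\<lambda>\<zeta>. \<zeta>)"

lemma emeasure_zero_counting_measure:
  assumes "p \<noteq> 0" "A \<in> sets borel"
  shows "emeasure (zero_counting_measure p) A =
    ennreal ((\<Sum>\<zeta> | \<zeta> \<in> A \<and> poly p \<zeta> = 0. real (order \<zeta> p)) / real (degree p))"
proof -
  let ?Z = "{\<zeta>. poly p \<zeta> = 0}"
  have fin: "finite ?Z"
    using assms(1) by (rule poly_roots_finite)
  have "emeasure (zero_counting_measure p) A =
      emeasure (point_measure ?Z (\<lambda>\<zeta>. ennreal (real (order \<zeta> p) / real (degree p)))) (A \<inter> ?Z)"
    unfolding zero_counting_measure_def
    by (subst emeasure_distr) (use assms in \<open>auto simp: space_point_measure measurable_def\<close>)
  also have "\<dots> = (\<Sum>\<zeta>\<in>A \<inter> ?Z. ennreal (real (order \<zeta> p) / real (degree p)))"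
    by (rule emeasure_point_measure_finite2) (use fin in auto)
  also have "\<dots> = ennreal (\<Sum>\<zeta>\<in>A \<inter> ?Z. real (order \<zeta> p) / real (degree p))"
    by (rule sum_ennreal) auto
  finally show ?thesis
    by (simp add: sum_divide_distrib Int_def)
qed

text \<open>All measures live on the complex plane; subsets of the real line are embedded.
  The sets \<^term>\<open>K\<close> below are meant to be closed (in particular Borel).\<close>

definition unit_measures_on :: "complex set \<Rightarrow> complex measure set" where
  "unit_measures_on K =
     {\<sigma>. sets \<sigma> = sets borel \<and> prob_space \<sigma> \<and> emeasure \<sigma> (- K) = 0}"

definition weak_star_converges ::
    "(nat \<Rightarrow> complex measure) \<Rightarrow> complex measure \<Rightarrow> bool" where
  "weak_star_converges \<sigma>s \<sigma> \<longleftrightarrow>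
     (\<forall>g :: complex \<Rightarrow> real. continuous_on UNIV g \<and> compact (closure {z. g z \<noteq> 0}) \<longrightarrow>
        (\<lambda>n. \<integral>z. g z \<partial>\<sigma>s n) \<longlonglongrightarrow> (\<integral>z. g z \<partial>\<sigma>))"

text \<open>Integral of an extended real function as positive part minus negative part. It is
  meaningful when one of the parts is finite; since \<^term>\<open>\<infinity> - \<infinity> = (\<infinity> :: ereal)\<close>, a finite
  value means that both parts are.\<close>

definition ereal_integral :: "'a measure \<Rightarrow> ('a \<Rightarrow> ereal) \<Rightarrow> ereal" where
  "ereal_integral M f =
     enn2ereal (\<integral>\<^sup>+x. e2ennreal (f x) \<partial>M) - enn2ereal (\<integral>\<^sup>+x. e2ennreal (- f x) \<partial>M)"

text \<open>The logarithm of the reciprocal of a nonnegative real, infinite at zero (the library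
  sets \<^term>\<open>ln 0 = (0 :: real)\<close>, which would ignore the self-energy of point masses).\<close>

definition log_recip :: "real \<Rightarrow> ereal" where
  "log_recip r = (if r = 0 then \<infinity> else ereal (ln (1 / r)))"

definition log_potential :: "complex measure \<Rightarrow> complex \<Rightarrow> ereal" where
  "log_potential \<sigma> z = ereal_integral \<sigma> (\<lambda>t. log_recip (cmod (z - t)))"

definition weighted_energy :: "(complex \<Rightarrow> real) \<Rightarrow> complex measure \<Rightarrow> ereal" where
  "weighted_energy w \<sigma> =
     ereal_integral (\<sigma> \<Otimes>\<^sub>M \<sigma>) (\<lambda>(s, t). log_recip (cmod (s - t) * w s * w t))"

definition solves_weighted_equilibrium ::
    "complex set \<Rightarrow> (complex \<Rightarrow> real) \<Rightarrow> complex measure \<Rightarrow> bool" where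
  "solves_weighted_equilibrium K w \<sigma> \<longleftrightarrow>
     \<sigma> \<in> unit_measures_on K \<and>
     (\<forall>\<tau>\<in>unit_measures_on K. weighted_energy w \<sigma> \<le> weighted_energy w \<tau>)"

definition lebesgue_on_reals :: "real set \<Rightarrow> complex measure" where
  "lebesgue_on_reals A = distr (restrict_space lborel A) borel complex_of_real"

definition apery_weight :: "complex \<Rightarrow> real" where
  "apery_weight x =
     cmod (csqrt (x + 1) + 2 * csqrt (x - 1)
       + 2 * csqrt (x - 1 + csqrt (x - 1) * csqrt (x + 1))) powi (-2)"

end

theory Submission
  imports Defs "HOL-Computational_Algebra.Fundamental_Theorem_Algebra" "HOL-Real_Asymp.Real_Asymp"
begin

text \<open>
  Write \<open>B\<^sub>n\<close> for the Apery polynomials and transport everything by the Moebius map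
  \<open>t \<mapsto> (t - 1) / (t + 1)\<close>, which carries the zeros of the transformed polynomials to those of
  \<open>B\<^sub>n\<close>. Three elementary facts determine the limit distributions.

  The zeros of \<open>B\<^sub>n\<close> are negative real numbers (\<open>apery_poly_roots\<close>). The polynomial
  with coefficients \<open>(n choose k)^2\<close> is the coefficient of \<open>t^n\<close> in \<open>(t + z)^n (t + 1)^n\<close>, that
  is, up to a constant an \<open>n\<close>-th derivative at \<open>0\<close>; if \<open>z\<close> is off the half-line \<open>(-\<infinity>, 0]\<close> then
  \<open>-z\<close> and \<open>-1\<close> lie in an open half-plane with \<open>0\<close> on its boundary line, and Gauss-Lucas keeps
  this derivative away from \<open>0\<close>. The factors \<open>((n + k) choose k)^2\<close> come from the operators
  \<open>z d/dz + j\<close>, which preserve the property of having all zeros in \<open>(-\<infinity>, 0]\<close>.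

  The size of \<open>B\<^sub>n\<close> at positive points is known up to a factor polynomial in \<open>n\<close>
  (\<open>apery_sum_bounds\<close>): \<open>B\<^sub>n(s^2)\<close> is the sum of the squares of the terms of a Legendre sum, and
  that Legendre sum is in turn the sum of the squares of the terms in the binomial expansion of
  \<open>(sqrt s + sqrt (1 + s))^n\<close>. Hence the mean of \<open>log (x - t)\<close> over the transformed zeros
  converges for every real \<open>x > 1\<close>. Expanding the logarithm at \<open>x = \<infinity>\<close> shows that all moments
  converge, and the Weierstrass approximation theorem turns this into weak-star convergence
  (\<open>mean_sequence.converges_of_logs\<close>), once a measure with the limiting logarithmic means is known.

  That measure is explicit. Let \<open>C = cos^2 (\<pi>x/2)\<close> with \<open>x\<close> uniform in \<open>(0, 1)\<close>, so that \<open>C\<close> has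
  the arcsine law on \<open>[0, 1]\<close>. The measure \<open>\<nu>\<close> is the law of \<open>1 - 2((1 - C)/(1 + C))^2\<close> and \<open>\<mu>\<close>
  the law of \<open>-(1 - C)^2/(4C)\<close>. The difference of \<open>z\<close> and such a point is, up to simple factors, a
  monic quadratic polynomial in \<open>C\<close> whose roots are reciprocal to each other (only for \<open>\<nu>\<close> and
  \<open>z = -1\<close> it is a multiple of \<open>C\<close> instead). The mean of the logarithm of a linear factor is the
  classical potential of the arcsine law, which follows from \<open>integral_circle_log\<close>. This gives both
  potentials in the whole plane, including the supports (\<open>nu_log_mean\<close>, \<open>mu_log_mean\<close>); the
  densities are a change of variables.

  Finally, the potential of \<open>\<nu>\<close> plus the external field \<open>- log w\<close> is constant on \<open>[-1, 1]\<close>. Therefore the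
  weighted energy of a competitor \<open>\<tau>\<close> exceeds that of \<open>\<nu>\<close> by the logarithmic energy of
  \<open>\<tau> - \<nu>\<close>. Expanding the kernel in Chebyshev polynomials shows that this energy dominates
  \<open>2/k\<close> times the square of the difference of the \<open>k\<close>-th Chebyshev moments
  (\<open>energy_distance_ge\<close>), so it is nonnegative and vanishes only for \<open>\<tau> = \<nu>\<close>.
\<close>

section \<open>Zeros of the Apery polynomials\<close>

lemma pderiv_prod_linear:
  fixes z :: complex
  assumes "z \<notin># A"
  shows "poly (pderiv (\<Prod>a\<in>#A. [:-a, 1:])) z
    = poly (\<Prod>a\<in>#A. [:-a, 1:]) z * (\<Sum>a\<in>#A. 1 / (z - a))"
  using assms
proof (induction A)
  case (add x A)
  have "z \<noteq> x" using add.prems by auto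
  have IH: "poly (pderiv (\<Prod>a\<in>#A. [:-a, 1:])) z
    = poly (\<Prod>a\<in>#A. [:-a, 1:]) z * (\<Sum>a\<in>#A. 1 / (z - a))" using add by auto
  have "poly (pderiv ([:-x, 1:] * (\<Prod>a\<in>#A. [:-a, 1:]))) z
     = poly (\<Prod>a\<in>#A. [:-a, 1:]) z + (z - x) * poly (pderiv (\<Prod>a\<in>#A. [:-a, 1:])) z"
    by (subst pderiv_mult) (simp add: pderiv_pCons algebra_simps)
  then have "poly (pderiv ([:-x, 1:] * (\<Prod>a\<in>#A. [:-a, 1:]))) z
     = (z - x) * poly (\<Prod>a\<in>#A. [:-a, 1:]) z * (1 / (z - x) + (\<Sum>a\<in>#A. 1 / (z - a)))"
    using \<open>z \<noteq> x\<close> by (simp add: IH distrib_left del: mult_pCons_left)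
  then show ?case by (simp del: mult_pCons_left)
qed auto

text \<open>
  All localizations of zeros below read off the sign of a linear functional on this logarithmic
  derivative.
\<close>

lemma log_derivative:
  fixes p :: "complex poly"
  assumes "poly p z \<noteq> 0"
  shows "poly (pderiv p) z = poly p z * (\<Sum>a\<in>#proots p. 1 / (z - a))"
proof -
  have p0: "p \<noteq> 0" using assms by auto
  have z: "z \<notin># proots p" using assms p0 by auto
  define q where "q = (\<Prod>a\<in>#proots p. [:-a, 1:])"
  have p: "p = smult (lead_coeff p) q"
    unfolding q_def by (rule complex_poly_decompose_multiset [symmetric])
  have "poly (pderiv q) z = poly q z * (\<Sum>a\<in>#proots p. 1 / (z - a))"
    unfolding q_def by (rule pderiv_prod_linear [OF z])
  then show ?thesis
    by (subst p, subst (2) p) (simp add: pderiv_smult)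
qed

lemma Re_sum_mset: "Re (\<Sum>a\<in>#A. f a) = (\<Sum>a\<in>#A. Re (f a))"
  by (induction A) auto

lemma sum_mset_pos:
  fixes f :: "'a \<Rightarrow> real"
  assumes "\<And>a. a \<in># A \<Longrightarrow> f a > 0" "A \<noteq> {#}"
  shows "(\<Sum>a\<in>#A. f a) > 0"
  using assms
proof (induction A)
  case (add x A)
  then show ?case by (cases "A = {#}") (auto intro: add_pos_pos)
qed auto

text \<open>
  Gauss-Lucas for an open half-plane: at a point \<open>t\<close> outside, every \<open>t - a\<close> with \<open>a\<close> a zero has
  \<open>Re (c (t - a)) > 0\<close>. Conjugation and division by the squared modulus preserve this, so the
  rotated logarithmic derivative is a sum of terms with positive real part.
\<close>

lemma pderiv_roots_half_plane:
  fixes p :: "complex poly"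
  assumes roots: "\<And>t. poly p t = 0 \<Longrightarrow> Re (c * t) < 0"
    and deg: "degree p > 0" and d: "poly (pderiv p) t = 0"
  shows "Re (c * t) < 0"
proof (rule ccontr)
  assume t: "\<not> ?thesis"
  then have pt: "poly p t \<noteq> 0" using roots by blast
  have p0: "p \<noteq> 0" using deg by auto
  have pos: "Re (cnj c * (1 / (t - a))) > 0" if "a \<in># proots p" for a
  proof -
    have a: "Re (c * a) < 0" using roots that p0 by auto
    then have ne: "t \<noteq> a" using t by auto
    have "cnj c * (1 / (t - a)) = cnj (c * (t - a)) / of_real ((cmod (t - a))\<^sup>2)"
      unfolding complex_norm_square using ne by (simp del: complex_cnj_diff)
    then have "Re (cnj c * (1 / (t - a))) = Re (c * (t - a)) / (cmod (t - a))\<^sup>2"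
      by (simp only: Re_divide_of_real complex_cnj(1) cnj.sel)
    also have "\<dots> > 0" using a t ne by (intro divide_pos_pos) (auto simp: algebra_simps)
    finally show ?thesis .
  qed
  have "size (proots p) > 0" using deg by (simp add: size_proots_complex)
  then have "proots p \<noteq> {#}" by auto
  then have "Re (\<Sum>a\<in>#proots p. cnj c * (1 / (t - a))) > 0"
    unfolding Re_sum_mset using pos by (intro sum_mset_pos) auto
  moreover have "(\<Sum>a\<in>#proots p. 1 / (t - a)) = 0"
    using log_derivative [OF pt] d pt by simp
  moreover have "(\<Sum>a\<in>#proots p. cnj c * (1 / (t - a))) = cnj c * (\<Sum>a\<in>#proots p. 1 / (t - a))"
    by (rule sum_mset_distrib_left [symmetric])
  ultimately show False by simp
qed

lemma higher_pderiv_roots_half_plane: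
  fixes p :: "complex poly"
  assumes roots: "\<And>t. poly p t = 0 \<Longrightarrow> Re (c * t) < 0" and "m \<le> degree p" "p \<noteq> 0"
    and "poly ((pderiv ^^ m) p) t = 0"
  shows "Re (c * t) < 0"
  using assms
proof (induction m arbitrary: p)
  case (Suc m)
  have "poly ((pderiv ^^ m) (pderiv p)) t = 0"
    using Suc.prems by (simp add: funpow_swap1)
  moreover have "degree (pderiv p) = degree p - 1" by (rule degree_pderiv)
  moreover have "pderiv p \<noteq> 0" using Suc.prems by (simp add: pderiv_eq_0_iff)
  ultimately show ?case
    using Suc.prems pderiv_roots_half_plane [OF Suc.prems(1)]
    by (intro Suc.IH [of "pderiv p"]) auto
qed auto

text \<open>
  Let \<open>q\<close> be the principal root of \<open>z\<close>. Multiplication by the conjugate of \<open>q\<close> puts \<open>1\<close>, \<open>z\<close> and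
  all \<open>z / (z + r)\<close> with \<open>r \<ge> 0\<close> into the open right half-plane; this is the common half-plane
  needed in both zero localizations, and it exists exactly because \<open>Re q > 0\<close>.
\<close>

lemma Re_csqrt_pos:
  assumes "z \<notin> complex_of_real ` {..0}"
  shows "Re (csqrt z) > 0"
proof (rule ccontr)
  assume "\<not> ?thesis"
  then have r: "Re (csqrt z) = 0" using Re_csqrt [of z] by linarith
  have "csqrt z * csqrt z = complex_of_real (- (Im (csqrt z) * Im (csqrt z)))"
    using r by (simp add: complex_eq_iff)
  then have "z = complex_of_real (- (Im (csqrt z) * Im (csqrt z)))"
    by (metis power2_csqrt power2_eq_square)
  moreover have "- (Im (csqrt z) * Im (csqrt z)) \<le> 0" by simp
  ultimately show False using assms by (metis atMost_iff image_eqI)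
qed

definition squared_binomial_poly :: "nat \<Rightarrow> complex poly" where
  "squared_binomial_poly n = (\<Sum>k\<le>n. monom (of_nat ((n choose k)\<^sup>2)) k)"

lemma coeff_squared_binomial_poly:
  "coeff (squared_binomial_poly n) k = of_nat ((n choose k)\<^sup>2)"
  by (cases "k \<le> n") (auto simp: squared_binomial_poly_def coeff_sum binomial_eq_0)

lemma coeff_linear_binomial:
  fixes z :: complex
  assumes "i \<le> n"
  shows "coeff ([:z, 1:] ^ n) i = of_nat (n choose i) * z ^ (n - i)"
  using assms by (simp add: coeff_linear_poly_power)

text \<open>
  The value at \<open>z\<close> is the coefficient of \<open>t^n\<close> in \<open>(t + z)^n (t + 1)^n\<close>, hence a multiple of the
  \<open>n\<close>-th derivative at \<open>t = 0\<close>. If \<open>z\<close> avoids the slit, the zeros \<open>-z\<close> and \<open>-1\<close> lie in an open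
  half-plane that does not contain \<open>0\<close>, and by Gauss-Lucas neither does the zero set of that
  derivative.
\<close>

lemma squared_binomial_poly_roots:
  assumes "poly (squared_binomial_poly n) z = 0"
  shows "z \<in> complex_of_real ` {..0}"
proof (rule ccontr)
  assume z: "z \<notin> complex_of_real ` {..0}"
  \<comment> \<open>This rotation makes both \<open>c z\<close> and \<open>c\<close> positive in real part.\<close>
  define c where "c = cnj (csqrt z)"
  have q: "Re (csqrt z) > 0" by (rule Re_csqrt_pos [OF z])
  have z0: "csqrt z \<noteq> 0" using q by auto
  define p where "p = [:z, 1:] ^ n * [:1, 1::complex:] ^ n"
  have deg: "degree p = 2 * n"
    by (simp add: p_def degree_mult_eq degree_power_eq)
  have p0: "p \<noteq> 0" by (simp add: p_def)
  have roots: "Re (c * t) < 0" if "poly p t = 0" for t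
  proof -
    have "t = -z \<or> t = -1" using that by (auto simp: p_def add_eq_0_iff)
    moreover have "c * z = of_real ((cmod (csqrt z))\<^sup>2) * csqrt z"
    proof -
      have "c * (csqrt z)\<^sup>2 = (csqrt z * cnj (csqrt z)) * csqrt z"
        unfolding c_def by (simp add: power2_eq_square del: power2_csqrt)
      then show ?thesis by (simp only: complex_norm_square power2_csqrt)
    qed
    then have "Re (c * z) = (cmod (csqrt z))\<^sup>2 * Re (csqrt z)"
      by (simp add: del: of_real_power)
    then have "Re (c * z) > 0" using q z0 by simp
    ultimately show ?thesis using q by (auto simp: c_def)
  qed
  have "poly ((pderiv ^^ n) p) 0 = pochhammer 1 n * coeff p n"
    using coeff_higher_pderiv [of n p 0] by (simp add: poly_0_coeff_0)
  also have "coeff p n = (\<Sum>i\<le>n. coeff ([:z, 1:] ^ n) i * coeff ([:1, 1:] ^ n) (n - i))"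
    by (simp add: p_def coeff_mult)
  also have "\<dots> = (\<Sum>i\<le>n. of_nat (n choose i) * z ^ (n - i) * of_nat (n choose (n - i)))"
    by (intro sum.cong refl) (simp add: coeff_linear_binomial)
  also have "\<dots> = (\<Sum>i\<le>n. of_nat ((n choose i)\<^sup>2) * z ^ i)"
    by (subst sum.atLeastAtMost_rev [of _ 0 n, simplified atLeast0AtMost])
      (auto intro!: sum.cong simp: binomial_symmetric [symmetric] power2_eq_square)
  also have "\<dots> = 0"
    using assms by (simp add: squared_binomial_poly_def poly_sum poly_monom)
  finally show False
    using higher_pderiv_roots_half_plane [where p = p and m = n and t = 0 and c = c] roots deg p0 by auto
qed

text \<open>
  The operator \<open>z d/dz + j\<close>.
\<close>

definition euler_shift :: "nat \<Rightarrow> complex poly \<Rightarrow> complex poly" where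
  "euler_shift j p = pCons 0 (pderiv p) + smult (of_nat j) p"

lemma coeff_euler_shift: "coeff (euler_shift j p) k = of_nat (k + j) * coeff p k"
  by (cases k) (simp_all add: euler_shift_def coeff_pderiv algebra_simps)

text \<open>
  Relative to \<open>p\<close> itself the operator is \<open>j + (\<Sum>a. z / (z - a))\<close>. With \<open>a = -r \<le> 0\<close> and \<open>z = q^2\<close>
  each summand becomes positive in real part after multiplication by the conjugate of \<open>q\<close>, and so
  does \<open>j\<close>.
\<close>

lemma euler_shift_roots:
  assumes roots: "\<And>t. poly p t = 0 \<Longrightarrow> t \<in> complex_of_real ` {..0}"
    and j: "j > 0" and z: "poly (euler_shift j p) z = 0"
  shows "z \<in> complex_of_real ` {..0}"
proof (rule ccontr)
  assume nz: "z \<notin> complex_of_real ` {..0}"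
  then have pz: "poly p z \<noteq> 0" using roots by blast
  then have p0: "p \<noteq> 0" by auto
  define q where "q = csqrt z"
  have q: "Re q > 0" unfolding q_def by (rule Re_csqrt_pos [OF nz])
  have z_q: "z = q\<^sup>2" by (simp add: q_def)
  have pos: "Re (cnj q * (z * (1 / (z - a)))) > 0" if pa: "a \<in># proots p" for a
  proof -
    obtain r where a: "a = - complex_of_real r" and r: "r \<ge> 0"
    proof -
      have "poly p a = 0" using pa p0 by simp
      then obtain r0 where "a = complex_of_real r0" "r0 \<le> 0" using roots [of a] by auto
      then show thesis using that [of "- r0"] by simp
    qed
    have ne: "z \<noteq> a" using pz pa p0 by auto
    have "cnj q * (z * (1 / (z - a))) = cnj q * z * cnj (z - a) / of_real ((cmod (z - a))\<^sup>2)"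
      unfolding complex_norm_square using ne by (simp del: complex_cnj_diff)
    also have "cnj q * z * cnj (z - a) =
        of_real (((cmod q)\<^sup>2)\<^sup>2) * cnj q + of_real (r * (cmod q)\<^sup>2) * q"
      unfolding a z_q of_real_mult of_real_power complex_norm_square [unfolded of_real_power]
      by (simp add: power2_eq_square algebra_simps)
    finally have "Re (cnj q * (z * (1 / (z - a))))
        = (((cmod q)\<^sup>2)\<^sup>2 * Re q + r * (cmod q)\<^sup>2 * Re q) / (cmod (z - a))\<^sup>2"
      by (simp add: Re_divide_of_real del: of_real_power of_real_mult)
    also have "\<dots> > 0"
    proof -
      have "q \<noteq> 0" using q by auto
      then show ?thesis using q r ne by (intro divide_pos_pos add_pos_nonneg mult_pos_pos) auto
    qed
    finally show ?thesis .
  qed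
  have "0 \<le> Re (\<Sum>a\<in>#proots p. cnj q * (z * (1 / (z - a))))"
    unfolding Re_sum_mset using pos
    by (cases "proots p = {#}") (auto intro!: less_imp_le [OF sum_mset_pos])
  moreover have "Re (cnj q * of_nat j) > 0" using q j by simp
  ultimately have "Re (cnj q * (z * (\<Sum>a\<in>#proots p. 1 / (z - a)) + of_nat j)) > 0"
    by (simp add: sum_mset_distrib_left distrib_left)
  moreover have "poly (euler_shift j p) z = poly p z * (z * (\<Sum>a\<in>#proots p. 1 / (z - a)) + of_nat j)"
    using log_derivative [OF pz] by (simp add: euler_shift_def algebra_simps)
  ultimately show False using z pz by (metis mult_eq_0_iff mult_zero_right order_less_irrefl zero_complex.sel(1))
qed

primrec euler_shifts :: "nat \<Rightarrow> complex poly \<Rightarrow> complex poly" where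
  "euler_shifts 0 p = p"
| "euler_shifts (Suc n) p = euler_shift (Suc n) (euler_shifts n p)"

lemma coeff_euler_shifts:
  "coeff (euler_shifts n p) k = of_nat (fact n * ((n + k) choose k)) * coeff p k"
proof (induction n)
  case (Suc n)
  define X where "X = (n + k) choose k"
  define Y where "Y = (Suc n + k) choose k"
  have "X = (n + k) choose n" unfolding X_def using binomial_symmetric [of k "n + k"] by simp
  moreover have "Y = (Suc n + k) choose Suc n"
    unfolding Y_def using binomial_symmetric [of k "Suc n + k"] by simp
  ultimately have XY: "Suc (n + k) * X = Suc n * Y"
    using Suc_times_binomial [of n "n + k"] by (simp only: add_Suc)
  have "(k + Suc n) * (fact n * X) = fact n * (Suc (n + k) * X)"
    by (simp add: algebra_simps)
  also have "\<dots> = fact (Suc n) * Y"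
    unfolding XY by (simp add: algebra_simps)
  finally have eq: "(k + Suc n) * (fact n * X) = fact (Suc n) * Y" .
  have "coeff (euler_shifts (Suc n) p) k = of_nat ((k + Suc n) * (fact n * X)) * coeff p k"
    unfolding euler_shifts.simps coeff_euler_shift Suc.IH X_def [symmetric]
      of_nat_mult mult.assoc ..
  then show ?case unfolding eq Y_def .
qed simp

lemma euler_shifts_roots:
  assumes "\<And>t. poly p t = 0 \<Longrightarrow> t \<in> complex_of_real ` {..0}"
    and "poly (euler_shifts n p) z = 0"
  shows "z \<in> complex_of_real ` {..0}"
  using assms
  by (induction n arbitrary: z) (auto intro: euler_shift_roots simp del: image_iff)

lemma coeff_apery_poly:
  "coeff (apery_poly n) k = of_nat ((n choose k)\<^sup>2 * ((n + k) choose k)\<^sup>2)"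
  by (cases "k \<le> n") (auto simp: apery_poly_def coeff_sum binomial_eq_0)

text \<open>
  The operators with \<open>j = 1, ..., n\<close> together multiply the \<open>k\<close>-th coefficient by
  \<open>n! ((n + k) choose k)\<close>; two rounds of them turn the polynomial with coefficients
  \<open>(n choose k)^2\<close> into a multiple of the Apery polynomial. Its constant term \<open>1\<close> excludes the
  zero \<open>0\<close>.
\<close>

lemma apery_poly_roots:
  assumes "poly (apery_poly n) z = 0"
  shows "z \<in> complex_of_real ` {..<0}"
proof -
  define q where "q = euler_shifts n (euler_shifts n (squared_binomial_poly n))"
  have "q = smult (fact n ^ 2) (apery_poly n)"
  proof (rule poly_eqI)
    fix k
    have eq: "F * b * (F * b * a\<^sup>2) = F\<^sup>2 * (a\<^sup>2 * b\<^sup>2)" for F a b :: nat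
      by (simp only: power2_eq_square ac_simps)
    have "coeff q k = of_nat (fact n * ((n + k) choose k)) *
        (of_nat (fact n * ((n + k) choose k)) * of_nat ((n choose k)\<^sup>2))"
      unfolding q_def coeff_euler_shifts coeff_squared_binomial_poly ..
    also have "\<dots> = of_nat ((fact n)\<^sup>2 * ((n choose k)\<^sup>2 * ((n + k) choose k)\<^sup>2))"
      by (simp only: of_nat_mult [symmetric] eq)
    also have "\<dots> = coeff (smult (fact n ^ 2) (apery_poly n)) k"
      by (simp only: coeff_smult coeff_apery_poly of_nat_mult [of "(fact n)\<^sup>2"] of_nat_power [of "fact n"] of_nat_fact)
    finally show "coeff q k = coeff (smult (fact n ^ 2) (apery_poly n)) k" .
  qed
  then have "poly q z = 0"
    using assms by (simp only: poly_smult mult_zero_right)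
  moreover have "t \<in> complex_of_real ` {..0}" if "poly q t = 0" for t
    using euler_shifts_roots [OF euler_shifts_roots [OF squared_binomial_poly_roots]] that
    unfolding q_def by iprover
  ultimately have "z \<in> complex_of_real ` {..0}" by iprover
  then obtain r where r: "z = complex_of_real r" "r \<le> 0" by (elim imageE) simp
  have "poly (apery_poly n) 0 = 1"
    by (simp only: poly_0_coeff_0 coeff_apery_poly) simp
  with assms r(1) have "r \<noteq> 0" by (metis of_real_0 zero_neq_one)
  with r(2) have "r \<in> {..<0}" by simp
  then show ?thesis unfolding r(1) by (rule imageI)
qed

section \<open>Growth on the positive half-line\<close>

definition apery_sum :: "nat \<Rightarrow> real \<Rightarrow> real" where
  "apery_sum n x = (\<Sum>k\<le>n. real ((n choose k)\<^sup>2 * ((n + k) choose k)\<^sup>2) * x ^ k)"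

lemma poly_apery_poly_of_real:
  "poly (apery_poly n) (complex_of_real x) = complex_of_real (apery_sum n x)"
  by (simp add: apery_poly_def apery_sum_def poly_sum poly_monom)

text \<open>
  A sum of squares and the square of a sum differ at most by the number of terms, a factor that
  is lost when \<open>n\<close>-th roots are taken.
\<close>

lemma sum_squares_bounds:
  fixes a :: "nat \<Rightarrow> real"
  assumes "\<And>k. a k \<ge> 0"
  shows "(\<Sum>k\<le>n. (a k)\<^sup>2) \<le> (\<Sum>k\<le>n. a k)\<^sup>2" "(\<Sum>k\<le>n. a k)\<^sup>2 \<le> (real n + 1) * (\<Sum>k\<le>n. (a k)\<^sup>2)"
proof -
  show "(\<Sum>k\<le>n. (a k)\<^sup>2) \<le> (\<Sum>k\<le>n. a k)\<^sup>2"
  proof -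
    have "(\<Sum>k\<le>n. (a k)\<^sup>2) \<le> (\<Sum>k\<le>n. a k * (\<Sum>j\<le>n. a j))"
      unfolding power2_eq_square
      by (intro sum_mono mult_left_mono member_le_sum) (auto simp: assms)
    then show ?thesis by (simp add: sum_distrib_right power2_eq_square)
  qed
  show "(\<Sum>k\<le>n. a k)\<^sup>2 \<le> (real n + 1) * (\<Sum>k\<le>n. (a k)\<^sup>2)"
    using Cauchy_Schwarz_ineq_sum [of a "\<lambda>_. 1" "{..n}"] by (simp add: algebra_simps)
qed

text \<open>
  Both sides are the Legendre polynomial at \<open>1 + 2s\<close>. Expanding \<open>(1 + s)^(n - k)\<close> on the right, the
  coefficient of \<open>s^m\<close> is \<open>(n choose m) (\<Sum>k. (n choose k) (m choose k))\<close>, and the inner sum is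
  Vandermonde's.
\<close>

lemma legendre_sum_identity:
  fixes s :: real
  shows "(\<Sum>k\<le>n. real ((n choose k) * ((n + k) choose k)) * s ^ k)
    = (\<Sum>k\<le>n. (real (n choose k))\<^sup>2 * s ^ k * (1 + s) ^ (n - k))"
proof -
  have vander: "(\<Sum>k\<le>m. (n choose k) * (m choose k)) = (n + m) choose m" for m
  proof -
    have "(\<Sum>k\<le>m. (n choose k) * (m choose k)) = (\<Sum>k\<le>m. (n choose k) * (m choose (m - k)))"
      by (intro sum.cong refl) (auto simp: binomial_symmetric [symmetric])
    then show ?thesis using vandermonde [of n m m] by simp
  qed
  have "(\<Sum>k\<le>n. (real (n choose k))\<^sup>2 * s ^ k * (1 + s) ^ (n - k))
      = (\<Sum>k\<le>n. \<Sum>m\<in>{k..n}. (real (n choose k))\<^sup>2 * real ((n - k) choose (m - k)) * s ^ m)"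
  proof (intro sum.cong refl)
    fix k assume k: "k \<in> {..n}"
    have "(1 + s) ^ (n - k) = (\<Sum>j\<le>n - k. real ((n - k) choose j) * s ^ j)"
      using binomial_ring [of s 1 "n - k"] by (simp add: add.commute)
    also have "s ^ k * \<dots> = (\<Sum>j\<le>n - k. real ((n - k) choose j) * s ^ (j + k))"
      by (simp add: sum_distrib_left power_add mult_ac)
    also have "\<dots> = (\<Sum>m\<in>{k..n}. real ((n - k) choose (m - k)) * s ^ m)"
      using k by (intro sum.reindex_bij_witness [of _ "\<lambda>m. m - k" "\<lambda>j. j + k"]) auto
    finally show "(real (n choose k))\<^sup>2 * s ^ k * (1 + s) ^ (n - k) =
        (\<Sum>m\<in>{k..n}. (real (n choose k))\<^sup>2 * real ((n - k) choose (m - k)) * s ^ m)"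
      by (simp add: sum_distrib_left mult.assoc)
  qed
  also have "\<dots> = (\<Sum>m\<le>n. \<Sum>k\<le>m. (real (n choose k))\<^sup>2 * real ((n - k) choose (m - k)) * s ^ m)"
    by (subst sum.Sigma, simp, simp, subst sum.Sigma, simp, simp)
      (intro sum.reindex_bij_witness [of _ "\<lambda>(a, b). (b, a)" "\<lambda>(a, b). (b, a)"], auto)
  also have "\<dots> = (\<Sum>m\<le>n. real ((n choose m) * ((n + m) choose m)) * s ^ m)"
  proof (intro sum.cong refl)
    fix m assume m: "m \<in> {..n}"
    have "(\<Sum>k\<le>m. (real (n choose k))\<^sup>2 * real ((n - k) choose (m - k)) * s ^ m)
        = (\<Sum>k\<le>m. real ((n choose k) * ((n choose k) * ((n - k) choose (m - k))))) * s ^ m"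
      by (simp add: sum_distrib_left sum_distrib_right power2_eq_square mult_ac)
    also have "(\<Sum>k\<le>m. real ((n choose k) * ((n choose k) * ((n - k) choose (m - k)))))
        = (\<Sum>k\<le>m. real ((n choose k) * ((n choose m) * (m choose k))))"
      using m by (intro sum.cong refl) (simp add: choose_mult)
    also have "\<dots> = real ((n choose m) * (\<Sum>k\<le>m. (n choose k) * (m choose k)))"
      by (simp add: sum_distrib_left mult_ac)
    finally show "(\<Sum>k\<le>m. (real (n choose k))\<^sup>2 * real ((n - k) choose (m - k)) * s ^ m)
        = real ((n choose m) * ((n + m) choose m)) * s ^ m"
      unfolding vander .
  qed
  finally show ?thesis by simp
qed

text \<open>
  The bounds for sums of squares are used twice: from the Apery sum at \<open>s^2\<close> to the Legendre sum,
  and, after rewriting the latter by the previous identity, from there to the binomial expansion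
  of \<open>\<rho>^n\<close>.
\<close>

lemma apery_sum_bounds:
  fixes s :: real
  assumes "s \<ge> 0"
  defines "\<rho> \<equiv> sqrt s + sqrt (1 + s)"
  shows "apery_sum n (s\<^sup>2) \<le> \<rho> ^ (4 * n)" "\<rho> ^ (4 * n) \<le> (real n + 1) ^ 3 * apery_sum n (s\<^sup>2)"
proof -
  define L where "L = (\<Sum>k\<le>n. real ((n choose k) * ((n + k) choose k)) * s ^ k)"
  define b where "b = (\<lambda>k. real (n choose k) * sqrt s ^ k * sqrt (1 + s) ^ (n - k))"
  have A: "apery_sum n (s\<^sup>2) = (\<Sum>k\<le>n. (real ((n choose k) * ((n + k) choose k)) * s ^ k)\<^sup>2)"
    by (simp add: apery_sum_def power_mult_distrib power_mult [symmetric] mult.commute)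
  have b2: "(b k)\<^sup>2 = (real (n choose k))\<^sup>2 * s ^ k * (1 + s) ^ (n - k)" for k
  proof -
    have "(sqrt s ^ k)\<^sup>2 = s ^ k" "(sqrt (1 + s) ^ (n - k))\<^sup>2 = (1 + s) ^ (n - k)"
      using assms(1) by (metis power_mult mult.commute real_sqrt_pow2 add_nonneg_nonneg zero_le_one)+
    then show ?thesis by (simp add: b_def power_mult_distrib)
  qed
  have L: "L = (\<Sum>k\<le>n. (b k)\<^sup>2)"
    unfolding L_def legendre_sum_identity b2 ..
  have b: "(\<Sum>k\<le>n. b k) = \<rho> ^ n"
    unfolding b_def \<rho>_def binomial_ring ..
  have b0: "b k \<ge> 0" for k using assms(1) by (simp add: b_def)
  have rho: "\<rho> \<ge> 0" using assms(1) by (simp add: \<rho>_def)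
  have L1: "L \<le> (\<rho> ^ n)\<^sup>2" and L2: "(\<rho> ^ n)\<^sup>2 \<le> (real n + 1) * L"
    using sum_squares_bounds [of b n] b0 by (auto simp: L b)
  have L0: "L \<ge> 0" by (simp add: L sum_nonneg)
  have a0: "real ((n choose k) * ((n + k) choose k)) * s ^ k \<ge> 0" for k using assms(1) by simp
  have A1: "apery_sum n (s\<^sup>2) \<le> L\<^sup>2" and A2: "L\<^sup>2 \<le> (real n + 1) * apery_sum n (s\<^sup>2)"
    unfolding A L_def using sum_squares_bounds [OF a0] by auto
  have p4: "((\<rho> ^ n)\<^sup>2)\<^sup>2 = \<rho> ^ (4 * n)" by (simp add: power_mult [symmetric] mult.commute)
  show "apery_sum n (s\<^sup>2) \<le> \<rho> ^ (4 * n)"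
    using A1 power_mono [OF L1 L0, of 2] p4 by linarith
  have "\<rho> ^ (4 * n) \<le> ((real n + 1) * L)\<^sup>2"
    unfolding p4 [symmetric] by (intro power_mono L2) auto
  also have "\<dots> = (real n + 1)\<^sup>2 * L\<^sup>2" by (simp add: power_mult_distrib add.commute)
  also have "\<dots> \<le> (real n + 1)\<^sup>2 * ((real n + 1) * apery_sum n (s\<^sup>2))"
    by (intro mult_left_mono A2) auto
  also have "\<dots> = (real n + 1) ^ 3 * apery_sum n (s\<^sup>2)"
    by (simp add: power2_eq_square power3_eq_cube add.commute)
  finally show "\<rho> ^ (4 * n) \<le> (real n + 1) ^ 3 * apery_sum n (s\<^sup>2)" .
qed

lemma apery_sum_growth:
  assumes "x \<ge> 0"
  shows "(\<lambda>n. ln (apery_sum n x) / n) \<longlonglongrightarrow> 4 * ln (sqrt (sqrt x) + sqrt (1 + sqrt x))"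
proof -
  define s where "s = sqrt x"
  define \<rho> where "\<rho> = sqrt s + sqrt (1 + s)"
  have s: "s \<ge> 0" "s\<^sup>2 = x" using assms by (auto simp: s_def)
  have "sqrt (1 + s) \<ge> 1" using s by simp
  then have rho: "\<rho> > 0" using real_sqrt_ge_zero [OF s(1)] unfolding \<rho>_def by linarith
  have upper: "apery_sum n x \<le> \<rho> ^ (4 * n)"
    and lower: "\<rho> ^ (4 * n) \<le> (real n + 1) ^ 3 * apery_sum n x" for n
    using apery_sum_bounds [OF s(1)] unfolding s(2) \<rho>_def by auto
  have pos: "apery_sum n x > 0" for n
  proof -
    have "0 < (real n + 1) ^ 3 * apery_sum n x" using lower [of n] rho by (meson less_le_trans zero_less_power)
    then show ?thesis by (simp add: zero_less_mult_iff)
  qed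
  have ln_rho: "ln (\<rho> ^ (4 * n)) = real n * (4 * ln \<rho>)" for n
    using rho by (simp add: ln_realpow)
  have "(\<lambda>n. 4 * ln \<rho> - 3 * (ln (real n + 1) / real n)) \<longlonglongrightarrow> 4 * ln \<rho> - 3 * 0"
    by (intro tendsto_intros) real_asymp
  then have lim: "(\<lambda>n. 4 * ln \<rho> - 3 * (ln (real n + 1) / real n)) \<longlonglongrightarrow> 4 * ln \<rho>" by simp
  have "(\<lambda>n. ln (apery_sum n x) / n) \<longlonglongrightarrow> 4 * ln \<rho>"
  proof (rule tendsto_sandwich [OF _ _ lim tendsto_const])
    show "\<forall>\<^sub>F n in sequentially. 4 * ln \<rho> - 3 * (ln (real n + 1) / real n) \<le> ln (apery_sum n x) / n"
      using eventually_gt_at_top [of 0]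
    proof eventually_elim
      fix n :: nat assume n: "0 < n"
      have "real n * (4 * ln \<rho>) \<le> ln ((real n + 1) ^ 3 * apery_sum n x)"
        unfolding ln_rho [symmetric] using lower [of n] rho pos [of n] by (subst ln_le_cancel_iff) auto
      also have "\<dots> = 3 * ln (real n + 1) + ln (apery_sum n x)"
        using pos [of n] by (subst ln_mult) (auto simp: ln_realpow)
      finally show "4 * ln \<rho> - 3 * (ln (real n + 1) / real n) \<le> ln (apery_sum n x) / n"
        using n by (simp add: pos_le_divide_eq left_diff_distrib) (simp add: mult.commute)
    qed
    show "\<forall>\<^sub>F n in sequentially. ln (apery_sum n x) / n \<le> 4 * ln \<rho>"
      using eventually_gt_at_top [of 0]
    proof eventually_elim
      fix n :: nat assume n: "0 < n"
      have "ln (apery_sum n x) \<le> real n * (4 * ln \<rho>)"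
        unfolding ln_rho [symmetric] using upper [of n] rho pos [of n] by (subst ln_le_cancel_iff) auto
      then show "ln (apery_sum n x) / n \<le> 4 * ln \<rho>"
        using n by (simp add: field_simps)
    qed
  qed
  then show ?thesis by (simp add: \<rho>_def s_def)
qed

section \<open>Convergence of means on an interval\<close>

lemma ln_one_minus_taylor_bound:
  fixes u :: real
  assumes "\<bar>u\<bar> \<le> 1 / 2"
  shows "\<bar>ln (1 - u) + (\<Sum>j<Suc k. u ^ j / real j)\<bar> \<le> 2 * \<bar>u\<bar> ^ Suc k"
proof -
  have "(\<lambda>n. - (u ^ n) / real n) sums ln (1 - u)"
    using ln_series' [of "-u"] assms by simp
  then have "(\<lambda>n. - (u ^ (n + Suc k)) / real (n + Suc k)) sums
      (ln (1 - u) - (\<Sum>j<Suc k. - (u ^ j) / real j))"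
    by (rule sums_split_initial_segment)
  then have tail: "(\<lambda>n. - (u ^ (n + Suc k)) / real (n + Suc k)) sums
      (ln (1 - u) + (\<Sum>j<Suc k. u ^ j / real j))"
    by (simp only: sum_negf minus_divide_left [symmetric] diff_minus_eq_add)
  have "(\<lambda>n. \<bar>u\<bar> ^ Suc k * \<bar>u\<bar> ^ n) sums (\<bar>u\<bar> ^ Suc k * (1 / (1 - \<bar>u\<bar>)))"
    using assms by (intro sums_mult geometric_sums) auto
  moreover have "norm (- (u ^ (n + Suc k)) / real (n + Suc k)) \<le> \<bar>u\<bar> ^ Suc k * \<bar>u\<bar> ^ n" for n
  proof -
    have "norm (- (u ^ (n + Suc k)) / real (n + Suc k)) = \<bar>u\<bar> ^ (n + Suc k) / real (n + Suc k)"
      by (simp add: power_abs abs_mult)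
    also have "\<dots> \<le> \<bar>u\<bar> ^ (n + Suc k) / 1"
      by (intro divide_left_mono) auto
    finally show ?thesis by (simp add: power_add mult_ac)
  qed
  ultimately have "norm (ln (1 - u) + (\<Sum>j<Suc k. u ^ j / real j)) \<le> \<bar>u\<bar> ^ Suc k * (1 / (1 - \<bar>u\<bar>))"
    by (intro norm_sums_le [OF tail])
  also have "\<dots> \<le> \<bar>u\<bar> ^ Suc k * 2"
    using assms by (intro mult_left_mono) (auto simp: field_simps)
  finally show ?thesis by simp
qed

text \<open>
  The properties of \<open>f \<mapsto> \<integral>f d\<sigma>\<close> for a unit measure \<open>\<sigma>\<close> on \<open>[-1, 1]\<close> that the convergence
  arguments use. Averages over zeros and expectations of random variables are both of this kind,
  so no common measure space has to be fixed.
\<close>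

definition mean_on_interval :: "((real \<Rightarrow> real) \<Rightarrow> real) \<Rightarrow> bool" where
  "mean_on_interval \<Lambda> \<longleftrightarrow>
     (\<forall>f g. continuous_on {-1..1} f \<longrightarrow> continuous_on {-1..1} g \<longrightarrow>
        \<Lambda> (\<lambda>t. f t + g t) = \<Lambda> f + \<Lambda> g) \<and>
     (\<forall>c f. continuous_on {-1..1} f \<longrightarrow> \<Lambda> (\<lambda>t. c * f t) = c * \<Lambda> f) \<and>
     \<Lambda> (\<lambda>_. 1) = 1 \<and>
     (\<forall>f e. continuous_on {-1..1} f \<longrightarrow> (\<forall>t\<in>{-1..1}. \<bar>f t\<bar> \<le> e) \<longrightarrow> \<bar>\<Lambda> f\<bar> \<le> e)"

lemma mean_on_interval_diff_le:
  assumes L: "mean_on_interval L"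
    and f: "continuous_on {-1..1} f" and h: "continuous_on {-1..1} h"
    and close: "\<forall>t\<in>{-1..1}. \<bar>f t - h t\<bar> \<le> e"
  shows "\<bar>L f - L h\<bar> \<le> e"
proof -
  have add: "L (\<lambda>t. f t + g t) = L f + L g" if "continuous_on {-1..1} g" for g
    using L f that by (simp add: mean_on_interval_def)
  have mult: "L (\<lambda>t. (-1) * h t) = (-1) * L h"
    using L h unfolding mean_on_interval_def by (elim conjE allE [of _ "-1"]) blast
  have bound: "\<bar>L g\<bar> \<le> e" if "continuous_on {-1..1} g" "\<forall>t\<in>{-1..1}. \<bar>g t\<bar> \<le> e" for g
    using L that unfolding mean_on_interval_def by blast
  have "L (\<lambda>t. f t + (-1) * h t) = L f - L h"
    using add [of "\<lambda>t. (-1) * h t"] mult h by (simp add: continuous_on_minus)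
  moreover have "\<bar>L (\<lambda>t. f t + (-1) * h t)\<bar> \<le> e"
    using f h close by (intro bound continuous_intros) auto
  ultimately show ?thesis by simp
qed

text \<open>
  The means are required only eventually, because a polynomial of degree \<open>0\<close> has no zeros to
  average over.
\<close>

locale mean_sequence =
  fixes \<Lambda>s :: "nat \<Rightarrow> (real \<Rightarrow> real) \<Rightarrow> real" and \<Lambda> :: "(real \<Rightarrow> real) \<Rightarrow> real"
  assumes means: "\<forall>\<^sub>F n in sequentially. mean_on_interval (\<Lambda>s n)" and mean: "mean_on_interval \<Lambda>"
begin

definition converges :: "(real \<Rightarrow> real) \<Rightarrow> bool" where
  "converges f \<longleftrightarrow> continuous_on {-1..1} f \<and> (\<lambda>n. \<Lambda>s n f) \<longlonglongrightarrow> \<Lambda> f"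

lemma converges_add:
  assumes "converges f" "converges g"
  shows "converges (\<lambda>t. f t + g t)"
proof -
  have c: "continuous_on {-1..1} f" "continuous_on {-1..1} g"
    using assms by (auto simp: converges_def)
  have "(\<lambda>n. \<Lambda>s n f + \<Lambda>s n g) \<longlonglongrightarrow> \<Lambda> f + \<Lambda> g"
    using assms by (intro tendsto_add) (auto simp: converges_def)
  moreover have "\<forall>\<^sub>F n in sequentially. \<Lambda>s n f + \<Lambda>s n g = \<Lambda>s n (\<lambda>t. f t + g t)"
    using means by eventually_elim (use c in \<open>simp add: mean_on_interval_def\<close>)
  ultimately have "(\<lambda>n. \<Lambda>s n (\<lambda>t. f t + g t)) \<longlonglongrightarrow> \<Lambda> f + \<Lambda> g"
    by (rule Lim_transform_eventually)
  then show ?thesis using mean c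
    by (auto simp: converges_def mean_on_interval_def intro!: continuous_intros)
qed

lemma converges_cmult:
  assumes "converges f"
  shows "converges (\<lambda>t. c * f t)"
proof -
  have c: "continuous_on {-1..1} f"
    using assms by (auto simp: converges_def)
  have "(\<lambda>n. c * \<Lambda>s n f) \<longlonglongrightarrow> c * \<Lambda> f"
    using assms by (intro tendsto_mult_left) (auto simp: converges_def)
  moreover have "\<forall>\<^sub>F n in sequentially. c * \<Lambda>s n f = \<Lambda>s n (\<lambda>t. c * f t)"
    using means by eventually_elim (use c in \<open>simp add: mean_on_interval_def\<close>)
  ultimately have "(\<lambda>n. \<Lambda>s n (\<lambda>t. c * f t)) \<longlonglongrightarrow> c * \<Lambda> f"
    by (rule Lim_transform_eventually)
  then show ?thesis using mean c
    by (auto simp: converges_def mean_on_interval_def intro!: continuous_intros)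
qed

lemma converges_const: "converges (\<lambda>_. c)"
proof -
  have "\<forall>\<^sub>F n in sequentially. \<Lambda> (\<lambda>_. 1) = \<Lambda>s n (\<lambda>_. 1)"
    using means by eventually_elim (use mean in \<open>simp add: mean_on_interval_def\<close>)
  then have "(\<lambda>n. \<Lambda>s n (\<lambda>_. 1)) \<longlonglongrightarrow> \<Lambda> (\<lambda>_. 1)"
    by (rule Lim_transform_eventually [OF tendsto_const])
  then have "converges (\<lambda>_. 1)" by (simp add: converges_def)
  from converges_cmult [OF this, of c] show ?thesis by simp
qed

lemma converges_diff:
  assumes "converges f" "converges g"
  shows "converges (\<lambda>t. f t - g t)"
  using converges_add [OF assms(1) converges_cmult [OF assms(2), of "-1"]] by simp

lemma converges_sum:
  assumes "\<And>j. j \<in> J \<Longrightarrow> converges (f j)"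
  shows "converges (\<lambda>t. \<Sum>j\<in>J. f j t)"
  using assms
  by (induction J rule: infinite_finite_induct) (auto intro: converges_const converges_add)

text \<open>
  Means are contractions for the supremum norm, uniformly in the index.
\<close>

lemma converges_uniform_limit:
  assumes f: "continuous_on {-1..1} f"
    and approx: "\<And>e. e > 0 \<Longrightarrow> \<exists>h. converges h \<and> (\<forall>t\<in>{-1..1}. \<bar>f t - h t\<bar> \<le> e)"
  shows "converges f"
  unfolding converges_def
proof (intro conjI f LIMSEQ_I)
  fix r :: real assume r: "0 < r"
  obtain h where h: "converges h" and close: "\<forall>t\<in>{-1..1}. \<bar>f t - h t\<bar> \<le> r / 4"
    using approx [of "r / 4"] r by auto
  have hc: "continuous_on {-1..1} h" using h by (simp add: converges_def)
  have split: "\<bar>L f - L h\<bar> \<le> r / 4" if "mean_on_interval L" for L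
    by (rule mean_on_interval_diff_le [OF that f hc close])
  have "\<forall>\<^sub>F n in sequentially. \<bar>\<Lambda>s n h - \<Lambda> h\<bar> < r / 4"
    using h r unfolding converges_def by (auto dest!: tendstoD [of _ _ _ "r/4"] simp: dist_real_def)
  with means have "\<forall>\<^sub>F n in sequentially. norm (\<Lambda>s n f - \<Lambda> f) < r"
  proof eventually_elim
    case (elim n)
    show ?case using split [OF elim(1)] split [OF mean] elim(2) r unfolding real_norm_def by linarith
  qed
  then show "\<exists>no. \<forall>n\<ge>no. norm (\<Lambda>s n f - \<Lambda> f) < r"
    by (simp add: eventually_sequentially)
qed

lemma converges_of_moments:
  assumes moments: "\<And>k. converges (\<lambda>t. t ^ k)" and f: "continuous_on {-1..1} f"
  shows "converges f"
proof (rule converges_uniform_limit [OF f])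
  fix e :: real assume "e > 0"
  then obtain g where g: "real_polynomial_function g" "\<And>t. t \<in> {-1..1} \<Longrightarrow> \<bar>f t - g t\<bar> < e"
    using Stone_Weierstrass_real_polynomial_function [OF _ f] by (metis compact_Icc)
  obtain a n where "g = (\<lambda>t. \<Sum>i\<le>n. a i * t ^ i)"
    using g(1) unfolding real_polynomial_function_iff_sum by blast
  then have "converges g"
    by (auto intro!: converges_sum converges_cmult moments)
  then show "\<exists>h. converges h \<and> (\<forall>t\<in>{-1..1}. \<bar>f t - h t\<bar> \<le> e)"
    using g(2) by (meson less_imp_le)
qed

text \<open>
  By Taylor expansion \<open>t^k\<close> is the uniform limit, as \<open>x \<rightarrow> \<infinity>\<close>, of
  \<open>k x^k (ln x - ln (x - t) - (\<Sum>j = 1..k - 1. t^j / (j x^j)))\<close>. Convergence for \<open>t^k\<close> therefore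
  follows from convergence for the logarithms and for the lower powers.
\<close>

lemma converges_of_logs:
  assumes logs: "\<And>x. x > 1 \<Longrightarrow> converges (\<lambda>t. ln (x - t))"
    and f: "continuous_on {-1..1} f"
  shows "converges f"
proof (rule converges_of_moments [OF _ f])
  fix k
  show "converges (\<lambda>t. t ^ k)"
  proof (induction k rule: less_induct)
    case (less k)
    show ?case
    proof (cases "k = 0")
      case True
      then show ?thesis by (simp add: converges_const)
    next
      case False
      show ?thesis
      proof (rule converges_uniform_limit)
        fix e :: real assume e: "e > 0"
        \<comment> \<open>Then \<open>\<bar>t / x\<bar> \<le> 1/2\<close>, and the Taylor error \<open>2k/x\<close> is at most \<open>e\<close>.\<close>
        define x where "x = max 2 (2 * real k / e)"
        have x: "x \<ge> 2" "2 * real k / x \<le> e"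
          using e by (auto simp: x_def field_simps max_def)
        define h where "h = (\<lambda>t. real k * x ^ k *
          (ln x - ln (x - t) - (\<Sum>j<k. 1 / (real j * x ^ j) * t ^ j)))"
        have "converges h"
          unfolding h_def using x
          by (intro converges_cmult converges_diff converges_const converges_sum logs less) auto
        moreover have "\<bar>t ^ k - h t\<bar> \<le> e" if t: "t \<in> {-1..1}" for t
        proof -
          define u where "u = t / x"
          have u: "\<bar>u\<bar> \<le> 1 / 2" using t x by (auto simp: u_def field_simps)
          have ux: "\<bar>u\<bar> \<le> 1 / x" using t x by (auto simp: u_def field_simps)
          have "ln (x - t) = ln (x * (1 - u))"
            using x by (simp add: u_def algebra_simps)
          then have l: "ln x - ln (x - t) = - ln (1 - u)"
            using x u by (simp add: ln_mult)
          \<comment> \<open>The summand for \<open>j = 0\<close> is zero on both sides, since division by zero yields zero.\<close>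
          have s: "(\<Sum>j<k. 1 / (real j * x ^ j) * t ^ j) = (\<Sum>j<k. u ^ j / real j)"
            by (intro sum.cong refl) (simp add: u_def power_divide)
          have tk: "t ^ k = real k * x ^ k * (u ^ k / real k)"
            using False x by (simp add: u_def power_divide)
          have "t ^ k - h t = real k * x ^ k * (ln (1 - u) + (\<Sum>j<Suc k. u ^ j / real j))"
            unfolding h_def l s by (subst tk) (simp add: algebra_simps)
          then have "\<bar>t ^ k - h t\<bar> = real k * x ^ k * \<bar>ln (1 - u) + (\<Sum>j<Suc k. u ^ j / real j)\<bar>"
            using x by (simp add: abs_mult)
          also have "\<dots> \<le> real k * x ^ k * (2 * \<bar>u\<bar> ^ Suc k)"
            using x by (intro mult_left_mono ln_one_minus_taylor_bound u) auto
          also have "\<dots> \<le> real k * x ^ k * (2 * (1 / x) ^ Suc k)"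
            using x ux by (intro mult_left_mono power_mono) auto
          also have "\<dots> = 2 * real k / x"
            using x by (simp add: power_divide)
          finally show ?thesis using x by simp
        qed
        ultimately show "\<exists>h. converges h \<and> (\<forall>t\<in>{-1..1}. \<bar>t ^ k - h t\<bar> \<le> e)" by blast
      qed (intro continuous_intros)
    qed
  qed
qed

end

section \<open>Means over the zeros\<close>

lemma sum_mset_eq_sum_count:
  fixes g :: "'a \<Rightarrow> real"
  shows "(\<Sum>x\<in>#A. g x) = (\<Sum>x\<in>set_mset A. real (count A x) * g x)"
proof (induction A)
  case (add y A)
  have "(\<Sum>x\<in>set_mset (add_mset y A). real (count (add_mset y A) x) * g x)
      = (\<Sum>x\<in>insert y (set_mset A). real (count A x) * g x + (if x = y then g x else 0))"
    by (auto intro!: sum.cong simp: algebra_simps)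
  also have "\<dots> = (\<Sum>x\<in>insert y (set_mset A). real (count A x) * g x) + g y"
    by (simp add: sum.distrib)
  also have "(\<Sum>x\<in>insert y (set_mset A). real (count A x) * g x) = (\<Sum>x\<in>set_mset A. real (count A x) * g x)"
    by (intro sum.mono_neutral_right) (auto simp: not_in_iff)
  finally show ?case using add by simp
qed simp

lemma integral_zero_counting_measure:
  fixes g :: "complex \<Rightarrow> real"
  assumes p: "p \<noteq> 0" and g: "g \<in> borel_measurable borel"
  shows "(\<integral>z. g z \<partial>zero_counting_measure p) = (\<Sum>z\<in>#proots p. g z) / real (degree p)"
proof -
  let ?Z = "{\<zeta>. poly p \<zeta> = 0}"
  have fin: "finite ?Z" using p by (rule poly_roots_finite)
  let ?P = "point_measure ?Z (\<lambda>\<zeta>. ennreal (real (order \<zeta> p) / real (degree p)))"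
  have "(\<integral>z. g z \<partial>zero_counting_measure p) = (\<integral>z. g z \<partial>?P)"
    unfolding zero_counting_measure_def
    by (rule integral_distr) (use g in \<open>auto simp: measurable_def space_point_measure\<close>)
  also have "\<dots> = (\<Sum>z\<in>?Z. real (order z p) / real (degree p) * g z)"
    using fin by (subst lebesgue_integral_point_measure_finite) auto
  also have "\<dots> = (\<Sum>z\<in>#proots p. g z) / real (degree p)"
    using p by (simp add: sum_mset_eq_sum_count sum_divide_distrib)
  finally show ?thesis .
qed

lemma degree_apery_poly: "degree (apery_poly n) = n"
proof (rule antisym)
  show "degree (apery_poly n) \<le> n"
    by (rule degree_le) (simp add: coeff_apery_poly binomial_eq_0)
  show "n \<le> degree (apery_poly n)"
    by (rule le_degree) (simp add: coeff_apery_poly)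
qed

lemma apery_poly_nonzero: "apery_poly n \<noteq> 0"
proof
  assume "apery_poly n = 0"
  then have "coeff (apery_poly n) 0 = 0" by simp
  then show False by (simp add: coeff_apery_poly)
qed

definition apery_zeros :: "nat \<Rightarrow> real multiset" where
  "apery_zeros n = image_mset Re (proots (apery_poly n))"

lemma proots_apery_poly: "proots (apery_poly n) = image_mset complex_of_real (apery_zeros n)"
proof -
  have "image_mset (\<lambda>z. complex_of_real (Re z)) (proots (apery_poly n)) = image_mset (\<lambda>z. z) (proots (apery_poly n))"
    using apery_poly_roots apery_poly_nonzero by (intro image_mset_cong) fastforce
  then show ?thesis by (simp add: apery_zeros_def multiset.map_comp comp_def)
qed

lemma apery_zeros_negative: "r \<in># apery_zeros n \<Longrightarrow> r < 0"
  using apery_poly_roots apery_poly_nonzero by (fastforce simp: apery_zeros_def)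

lemma size_apery_zeros: "size (apery_zeros n) = n"
  by (simp add: apery_zeros_def size_proots_complex degree_apery_poly)

lemma apery_sum_factorization:
  obtains c where "c > 0" "\<And>x. apery_sum n x = c * (\<Prod>r\<in>#apery_zeros n. x - r)"
proof
  define c where "c = real (((n + n) choose n)\<^sup>2)"
  show "c > 0" by (simp add: c_def)
  fix x
  have lc: "lead_coeff (apery_poly n) = complex_of_real c"
    by (simp add: degree_apery_poly coeff_apery_poly c_def)
  have eval: "poly (\<Prod>a\<in>#image_mset complex_of_real A. [:-a, 1:]) (complex_of_real x)
      = complex_of_real (\<Prod>r\<in>#A. x - r)" for A
    by (induction A) (simp_all add: algebra_simps)
  have "complex_of_real (apery_sum n x)
      = poly (smult (lead_coeff (apery_poly n)) (\<Prod>a\<in>#proots (apery_poly n). [:-a, 1:])) (complex_of_real x)"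
    unfolding complex_poly_decompose_multiset poly_apery_poly_of_real ..
  also have "\<dots> = complex_of_real (c * (\<Prod>r\<in>#apery_zeros n. x - r))"
    unfolding lc proots_apery_poly poly_smult eval by simp
  finally show "apery_sum n x = c * (\<Prod>r\<in>#apery_zeros n. x - r)"
    by (simp only: of_real_eq_iff)
qed

text \<open>
  The inverse of the Moebius map \<open>t \<mapsto> (t - 1) / (t + 1)\<close>.
\<close>

definition to_unit_interval :: "real \<Rightarrow> real" where
  "to_unit_interval r = (1 + r) / (1 - r)"

lemma to_unit_interval_bounds:
  assumes "r < 0"
  shows "-1 < to_unit_interval r" "to_unit_interval r < 1"
  using assms by (auto simp: to_unit_interval_def field_simps)

lemma to_unit_interval_inverse:
  assumes "r < 0"
  shows "(to_unit_interval r - 1) / (to_unit_interval r + 1) = r"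
  using assms by (simp add: to_unit_interval_def field_simps)

lemma proots_prod_linear:
  fixes f :: "'a \<Rightarrow> complex"
  shows "proots (\<Prod>x\<in>#A. [:- f x, 1:]) = image_mset f A"
proof (induction A)
  case (add x A)
  have "(\<Prod>x\<in>#A. [:- f x, 1:]) \<noteq> 0" by (auto simp: prod_mset_zero_iff)
  then show ?case using add by (simp add: proots_mult del: mult_pCons_left)
qed simp

text \<open>
  Each linear factor transforms by
  \<open>(z + 1) ((z - 1)/(z + 1) - r) = (1 - r) (z - (1 + r)/(1 - r))\<close>. This compares the two
  polynomials at all \<open>z \<noteq> -1\<close>, which is enough because these are infinitely many points.
\<close>

lemma proots_apery_tilde_poly:
  shows "proots (apery_tilde_poly n) = image_mset (\<lambda>r. complex_of_real (to_unit_interval r)) (apery_zeros n)"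
    and "apery_tilde_poly n \<noteq> 0"
proof -
  define Z where "Z = apery_zeros n"
  define q where "q = (\<Prod>r\<in>#Z. [:- complex_of_real (to_unit_interval r), 1:])"
  define c where "c = lead_coeff (apery_poly n) * (\<Prod>r\<in>#Z. complex_of_real (1 - r))"
  have c0: "c \<noteq> 0"
    using apery_poly_nonzero apery_zeros_negative by (fastforce simp: c_def Z_def)
  have eval: "(z + 1) ^ size A * poly (\<Prod>a\<in>#image_mset complex_of_real A. [:-a, 1:]) ((z - 1) / (z + 1))
      = (\<Prod>r\<in>#A. complex_of_real (1 - r)) * poly (\<Prod>r\<in>#A. [:- complex_of_real (to_unit_interval r), 1:]) z"
    if z: "z \<noteq> -1" and neg: "\<And>r. r \<in># A \<Longrightarrow> r < 0" for z A
    using neg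
  proof (induction A)
    case (add r A)
    have z1: "z + 1 \<noteq> 0" using z by (simp add: add_eq_0_iff2)
    have r: "complex_of_real (1 - r) \<noteq> 0" using add.prems [of r] by (simp del: of_real_diff)
    have "(z + 1) * ((z - 1) / (z + 1) - complex_of_real r) = z - 1 - complex_of_real r * (z + 1)"
      using z1 by (simp add: right_diff_distrib mult.commute)
    also have "\<dots> = complex_of_real (1 - r) * (z - complex_of_real (to_unit_interval r))"
    proof -
      have "complex_of_real (1 - r) * complex_of_real (to_unit_interval r) = complex_of_real (1 + r)"
        using r by (simp add: to_unit_interval_def)
      then show ?thesis by (simp add: algebra_simps)
    qed
    finally have lin: "(z + 1) * ((z - 1) / (z + 1) - complex_of_real r)
        = complex_of_real (1 - r) * (z - complex_of_real (to_unit_interval r))" .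
    have IH: "(z + 1) ^ size A * poly (\<Prod>a\<in>#image_mset complex_of_real A. [:-a, 1:]) ((z - 1) / (z + 1))
      = (\<Prod>r\<in>#A. complex_of_real (1 - r)) * poly (\<Prod>r\<in>#A. [:- complex_of_real (to_unit_interval r), 1:]) z"
      using add by auto
    have "(z + 1) ^ size (add_mset r A) *
          poly (\<Prod>a\<in>#image_mset complex_of_real (add_mset r A). [:-a, 1:]) ((z - 1) / (z + 1))
        = ((z + 1) * ((z - 1) / (z + 1) - complex_of_real r)) *
          ((z + 1) ^ size A * poly (\<Prod>a\<in>#image_mset complex_of_real A. [:-a, 1:]) ((z - 1) / (z + 1)))"
      by (simp add: algebra_simps)
    also have "\<dots> = (\<Prod>r\<in>#add_mset r A. complex_of_real (1 - r)) *
        poly (\<Prod>r\<in>#add_mset r A. [:- complex_of_real (to_unit_interval r), 1:]) z"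
      unfolding lin IH by (simp add: algebra_simps)
    finally show ?case .
  qed simp
  have "poly (apery_tilde_poly n - smult c q) z = 0" if "z \<noteq> -1" for z
  proof -
    have "poly (apery_tilde_poly n) z = (z + 1) ^ n *
        poly (smult (lead_coeff (apery_poly n)) (\<Prod>a\<in>#proots (apery_poly n). [:-a, 1:])) ((z - 1) / (z + 1))"
      unfolding complex_poly_decompose_multiset by (rule poly_apery_tilde_poly [OF that])
    also have "\<dots> = lead_coeff (apery_poly n) * ((z + 1) ^ size Z *
        poly (\<Prod>a\<in>#image_mset complex_of_real Z. [:-a, 1:]) ((z - 1) / (z + 1)))"
      unfolding proots_apery_poly poly_smult Z_def size_apery_zeros by simp
    also have "\<dots> = poly (smult c q) z"
      unfolding c_def q_def using eval [OF that, of Z] apery_zeros_negative by (simp add: Z_def)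
    finally show ?thesis by simp
  qed
  then have "{z. poly (apery_tilde_poly n - smult c q) z = 0} \<supseteq> - {-1}" by auto
  moreover have "infinite (- {-1 :: complex})"
    by (simp add: Compl_eq_Diff_UNIV infinite_UNIV_char_0)
  ultimately have "infinite {z. poly (apery_tilde_poly n - smult c q) z = 0}"
    by (rule infinite_super)
  then have eq: "apery_tilde_poly n = smult c q"
    by (metis poly_roots_finite eq_iff_diff_eq_0)
  show "proots (apery_tilde_poly n) = image_mset (\<lambda>r. complex_of_real (to_unit_interval r)) (apery_zeros n)"
    unfolding eq q_def using c0 by (simp add: proots_prod_linear Z_def)
  show "apery_tilde_poly n \<noteq> 0"
    unfolding eq q_def using c0 by (auto simp: prod_mset_zero_iff)
qed

lemma degree_apery_tilde_poly: "degree (apery_tilde_poly n) = n"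
  using size_proots_complex [of "apery_tilde_poly n"]
  by (simp add: proots_apery_tilde_poly size_apery_zeros)

text \<open>
  The zeros of both families are expressed through one multiset, so that a single limit theorem
  serves both of them.
\<close>

definition zero_mean :: "nat \<Rightarrow> (real \<Rightarrow> real) \<Rightarrow> real" where
  "zero_mean n f = (\<Sum>r\<in>#apery_zeros n. f (to_unit_interval r)) / n"

lemma integral_zeros_apery_tilde_poly:
  fixes g :: "complex \<Rightarrow> real"
  assumes "g \<in> borel_measurable borel"
  shows "(\<integral>z. g z \<partial>zero_counting_measure (apery_tilde_poly n)) = zero_mean n (\<lambda>t. g (complex_of_real t))"
  using assms
  by (simp add: integral_zero_counting_measure proots_apery_tilde_poly degree_apery_tilde_poly
      zero_mean_def multiset.map_comp comp_def)

lemma integral_zeros_apery_poly: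
  fixes g :: "complex \<Rightarrow> real"
  assumes "g \<in> borel_measurable borel"
  shows "(\<integral>z. g z \<partial>zero_counting_measure (apery_poly n))
    = zero_mean n (\<lambda>t. g (complex_of_real ((t - 1) / (t + 1))))"
proof -
  have "image_mset (\<lambda>r. g (complex_of_real ((to_unit_interval r - 1) / (to_unit_interval r + 1)))) (apery_zeros n)
     = image_mset (\<lambda>r. g (complex_of_real r)) (apery_zeros n)"
    by (intro image_mset_cong) (metis apery_zeros_negative to_unit_interval_inverse)
  then show ?thesis
    using assms
    by (simp add: integral_zero_counting_measure apery_poly_nonzero proots_apery_poly degree_apery_poly
      zero_mean_def multiset.map_comp comp_def)
qed

lemma mean_on_interval_zero_mean:
  assumes "n > 0"
  shows "mean_on_interval (zero_mean n)"
  unfolding mean_on_interval_def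
proof (intro conjI allI impI)
  fix f g :: "real \<Rightarrow> real" and c e :: real
  show "zero_mean n (\<lambda>t. f t + g t) = zero_mean n f + zero_mean n g"
    by (simp add: zero_mean_def sum_mset.distrib add_divide_distrib)
  show "zero_mean n (\<lambda>t. c * f t) = c * zero_mean n f"
    by (simp add: zero_mean_def sum_mset_distrib_left)
  show "zero_mean n (\<lambda>_. 1) = 1"
    using assms by (simp add: zero_mean_def size_apery_zeros)
  assume b: "\<forall>t\<in>{-1..1}. \<bar>f t\<bar> \<le> e"
  have "\<bar>\<Sum>r\<in>#A. f (to_unit_interval r)\<bar> \<le> size A * e" if "\<And>r. r \<in># A \<Longrightarrow> r < 0" for A
    using that
  proof (induction A)
    case (add r A)
    have "\<bar>f (to_unit_interval r)\<bar> \<le> e"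
      using to_unit_interval_bounds [of r] add.prems by (intro b [rule_format]) auto
    moreover have "\<bar>\<Sum>r\<in>#A. f (to_unit_interval r)\<bar> \<le> size A * e" using add by auto
    ultimately show ?case by (simp add: algebra_simps)
  qed simp
  from this [of "apery_zeros n"] show "\<bar>zero_mean n f\<bar> \<le> e"
    using assms apery_zeros_negative by (simp add: zero_mean_def size_apery_zeros field_simps)
qed

text \<open>
  With \<open>w = (x - 1)/(x + 1)\<close> a transformed zero satisfies \<open>x - t = (x + 1) (w - r) / (1 - r)\<close>.
  The product over all zeros is \<open>(x + 1)^n B\<^sub>n(w) / B\<^sub>n(1)\<close>; the leading coefficients cancel.
\<close>

lemma zero_mean_ln:
  assumes x: "x > 1" and n: "n > 0"
  shows "zero_mean n (\<lambda>t. ln (x - t))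
    = ln (x + 1) + ln (apery_sum n ((x - 1) / (x + 1))) / n - ln (apery_sum n 1) / n"
proof -
  define w where "w = (x - 1) / (x + 1)"
  have w: "w > 0" using x by (simp add: w_def)
  obtain c where c: "c > 0" "\<And>x. apery_sum n x = c * (\<Prod>r\<in>#apery_zeros n. x - r)"
    using apery_sum_factorization [of n] by blast
  have ln_prod: "ln (\<Prod>r\<in>#A. y - r) = (\<Sum>r\<in>#A. ln (y - r)) \<and> (\<Prod>r\<in>#A. y - r) > 0"
    if "\<And>r. r \<in># A \<Longrightarrow> r < 0" "y > 0" for y :: real and A
    using that
  proof (induction A)
    case (add r A)
    then have "y - r > 0" by (metis diff_gt_0_iff_gt less_trans union_single_eq_member)
    moreover have IH: "ln (\<Prod>r\<in>#A. y - r) = (\<Sum>r\<in>#A. ln (y - r))" "(\<Prod>r\<in>#A. y - r) > 0"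
      using add by auto
    have "ln ((y - r) * (\<Prod>r\<in>#A. y - r)) = ln (y - r) + ln (\<Prod>r\<in>#A. y - r)"
      using calculation IH(2) by (intro ln_mult_pos)
    ultimately show ?case using IH by simp
  qed simp
  have ln_apery: "ln (apery_sum n y) = ln c + (\<Sum>r\<in>#apery_zeros n. ln (y - r))" if "y > 0" for y
  proof -
    have "ln (\<Prod>r\<in>#apery_zeros n. y - r) = (\<Sum>r\<in>#apery_zeros n. ln (y - r)) \<and>
        (\<Prod>r\<in>#apery_zeros n. y - r) > 0"
      using apery_zeros_negative that by (rule ln_prod)
    then show ?thesis unfolding c(2) [of y] using c(1) by (metis ln_mult_pos)
  qed
  have "(\<Sum>r\<in>#A. ln (x - to_unit_interval r))
     = size A * ln (x + 1) + (\<Sum>r\<in>#A. ln (w - r)) - (\<Sum>r\<in>#A. ln (1 - r))"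
    if "\<And>r. r \<in># A \<Longrightarrow> r < 0" for A
    using that
  proof (induction A)
    case (add r A)
    then have r: "r < 0" by auto
    have "x - to_unit_interval r = (x + 1) * (w - r) / (1 - r)"
    proof -
      have "(x + 1) * (w - r) = x - 1 - r * (x + 1)"
        using x by (simp add: w_def right_diff_distrib mult.commute)
      also have "\<dots> = (x - to_unit_interval r) * (1 - r)"
        using r by (simp add: to_unit_interval_def left_diff_distrib) (simp add: algebra_simps)
      finally show ?thesis using r by simp
    qed
    then have "ln (x - to_unit_interval r) = ln (x + 1) + ln (w - r) - ln (1 - r)"
      using x r w by (simp add: ln_mult ln_div)
    then show ?case using add by (simp add: algebra_simps)
  qed simp
  from this [of "apery_zeros n", OF apery_zeros_negative]
  have "zero_mean n (\<lambda>t. ln (x - t))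
     = (n * ln (x + 1) + ln (apery_sum n w) - ln (apery_sum n 1)) / n"
    using ln_apery [OF w] ln_apery [of 1] by (simp add: zero_mean_def size_apery_zeros)
  then show ?thesis using n by (simp add: add_divide_distrib diff_divide_distrib w_def)
qed

text \<open>
  The subtracted constant is the growth rate of \<open>B\<^sub>n(1)\<close>, the leading coefficients of the
  transformed polynomials.
\<close>

lemma zero_mean_ln_limit:
  assumes x: "x > 1"
  defines "s \<equiv> sqrt ((x - 1) / (x + 1))"
  shows "(\<lambda>n. zero_mean n (\<lambda>t. ln (x - t))) \<longlonglongrightarrow>
    ln (x + 1) + 4 * ln (sqrt s + sqrt (1 + s)) - 4 * ln (1 + sqrt 2)"
proof -
  have "(x - 1) / (x + 1) \<ge> 0" using x by simp
  then have "(\<lambda>n. ln (x + 1) + ln (apery_sum n ((x - 1) / (x + 1))) / n - ln (apery_sum n 1) / n) \<longlonglongrightarrow>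
    ln (x + 1) + 4 * ln (sqrt s + sqrt (1 + s)) - 4 * ln (sqrt (sqrt 1) + sqrt (1 + sqrt 1))"
    unfolding s_def by (intro tendsto_intros apery_sum_growth) auto
  then have "(\<lambda>n. ln (x + 1) + ln (apery_sum n ((x - 1) / (x + 1))) / n - ln (apery_sum n 1) / n) \<longlonglongrightarrow>
    ln (x + 1) + 4 * ln (sqrt s + sqrt (1 + s)) - 4 * ln (1 + sqrt 2)" by simp
  then show ?thesis
    by (rule Lim_transform_eventually)
      (use eventually_gt_at_top [of 0] in eventually_elim, simp add: zero_mean_ln [OF x])
qed

section \<open>The tent map and a majorant for logarithmic singularities\<close>

text \<open>
  The interval is open so that \<open>cos (\<pi>x)\<close> stays strictly between \<open>-1\<close> and \<open>1\<close> on the whole space.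
\<close>

definition unit_lebesgue :: "real measure" where
  "unit_lebesgue = restrict_space lborel {0<..<1}"

lemma space_unit_lebesgue [simp]: "space unit_lebesgue = {0<..<1}"
  by (simp add: unit_lebesgue_def space_restrict_space)

lemma measurable_unit_lebesgue [measurable (raw)]:
  "f \<in> borel_measurable borel \<Longrightarrow> f \<in> borel_measurable unit_lebesgue"
  unfolding unit_lebesgue_def by (intro measurable_restrict_space1) simp

lemma nn_integral_unit_lebesgue:
  "(\<integral>\<^sup>+x. f x \<partial>unit_lebesgue) = (\<integral>\<^sup>+x. f x * indicator {0<..<1} x \<partial>lborel)"
  unfolding unit_lebesgue_def by (rule nn_integral_restrict_space) simp

lemma prob_space_unit_lebesgue: "prob_space unit_lebesgue"
proof
  have "emeasure unit_lebesgue (space unit_lebesgue) = (\<integral>\<^sup>+x. 1 \<partial>unit_lebesgue)"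
    by simp
  also have "\<dots> = 1"
    unfolding nn_integral_unit_lebesgue by simp
  finally show "emeasure unit_lebesgue (space unit_lebesgue) = 1" .
qed

interpretation unit_lebesgue: prob_space unit_lebesgue
  by (rule prob_space_unit_lebesgue)

lemma AE_unit_lebesgue_neq: "AE x in unit_lebesgue. x \<noteq> c"
  unfolding unit_lebesgue_def
  by (subst AE_restrict_space_iff) (use AE_lborel_singleton [of c] in auto)

lemma measure_preserving_integral:
  fixes h :: "real \<Rightarrow> real"
  assumes f [measurable]: "f \<in> borel_measurable borel"
    and preserve: "\<And>h :: real \<Rightarrow> ennreal. h \<in> borel_measurable borel \<Longrightarrow>
      (\<integral>\<^sup>+x. h (f x) \<partial>unit_lebesgue) = (\<integral>\<^sup>+x. h x \<partial>unit_lebesgue)"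
    and h [measurable]: "h \<in> borel_measurable borel"
  shows "(\<integral>x. h (f x) \<partial>unit_lebesgue) = (\<integral>x. h x \<partial>unit_lebesgue)"
proof -
  have "distr unit_lebesgue borel f = distr unit_lebesgue borel (\<lambda>x. x)"
  proof (rule measure_eqI)
    fix A assume "A \<in> sets (distr unit_lebesgue borel f)"
    then have A [measurable]: "A \<in> sets borel" by simp
    have "emeasure (distr unit_lebesgue borel g) A = (\<integral>\<^sup>+x. indicator A (g x) \<partial>unit_lebesgue)"
      if [measurable]: "g \<in> borel_measurable borel" for g
      by (subst nn_integral_indicator [symmetric], simp, subst nn_integral_distr) auto
    from this [of f] this [of "\<lambda>x. x"]
    show "emeasure (distr unit_lebesgue borel f) A = emeasure (distr unit_lebesgue borel (\<lambda>x. x)) A"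
      using preserve [of "indicator A"] by simp
  qed simp
  then have "integral\<^sup>L (distr unit_lebesgue borel f) h = integral\<^sup>L (distr unit_lebesgue borel (\<lambda>x. x)) h"
    by simp
  then show ?thesis
    by (simp add: integral_distr)
qed

lemma reflection_preserves:
  assumes [measurable]: "h \<in> borel_measurable borel"
  shows "(\<integral>\<^sup>+x. h (1 - x) \<partial>unit_lebesgue) = (\<integral>\<^sup>+x. h x \<partial>unit_lebesgue)"
proof -
  have "(\<integral>\<^sup>+x. h x \<partial>unit_lebesgue) = (\<integral>\<^sup>+x. h (1 + (-1) * x) * indicator {0<..<1} (1 + (-1) * x) \<partial>lborel)"
    unfolding nn_integral_unit_lebesgue
    by (subst nn_integral_real_affine [where c = "-1" and t = 1]) auto
  also have "\<dots> = (\<integral>\<^sup>+x. h (1 - x) \<partial>unit_lebesgue)"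
    unfolding nn_integral_unit_lebesgue
    by (intro nn_integral_cong) (auto simp: indicator_def)
  finally show ?thesis by simp
qed

text \<open>
  The tent map is angle doubling in disguise: \<open>cos (\<pi> tent x) = cos (2\<pi>x)\<close> for \<open>x\<close> in \<open>[0, 1]\<close>.
\<close>

definition tent :: "real \<Rightarrow> real" where
  "tent x = 1 - \<bar>1 - 2 * x\<bar>"

text \<open>
  Both branches of the tent map stretch by the factor \<open>2\<close>, and each covers the interval once.
\<close>

lemma tent_preserves:
  assumes [measurable]: "h \<in> borel_measurable borel"
  shows "(\<integral>\<^sup>+x. h (tent x) \<partial>unit_lebesgue) = (\<integral>\<^sup>+x. h x \<partial>unit_lebesgue)"
proof -
  have [measurable]: "tent \<in> borel_measurable borel" unfolding tent_def by measurable
  define F where "F = (\<lambda>y. h y * indicator {0<..<1} y)"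
  have [measurable]: "F \<in> borel_measurable borel" unfolding F_def by measurable
  have p: "(\<integral>\<^sup>+y. F y \<partial>lborel) = 2 * (\<integral>\<^sup>+x. F (2 * x) \<partial>lborel)"
    by (subst nn_integral_real_affine [where c = 2 and t = 0]) auto
  have q: "(\<integral>\<^sup>+y. F y \<partial>lborel) = 2 * (\<integral>\<^sup>+x. F (2 - 2 * x) \<partial>lborel)"
    by (subst nn_integral_real_affine [where c = "-2" and t = 2]) auto
  have "(\<integral>\<^sup>+x. h (tent x) \<partial>unit_lebesgue) = (\<integral>\<^sup>+x. F (2 * x) + F (2 - 2 * x) \<partial>lborel)"
    unfolding nn_integral_unit_lebesgue
  proof (rule nn_integral_cong_AE)
    show "AE x in lborel. h (tent x) * indicator {0<..<1} x = F (2 * x) + F (2 - 2 * x)"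
      using AE_lborel_singleton [of "1/2"]
      by eventually_elim (auto simp: F_def tent_def indicator_def)
  qed
  also have "\<dots> = (\<integral>\<^sup>+x. F (2 * x) \<partial>lborel) + (\<integral>\<^sup>+x. F (2 - 2 * x) \<partial>lborel)"
    by (rule nn_integral_add) auto
  also have "\<dots> = (\<integral>\<^sup>+y. F y \<partial>lborel)"
  proof -
    have "2 * (\<integral>\<^sup>+x. F (2 * x) \<partial>lborel) = 2 * (\<integral>\<^sup>+x. F (2 - 2 * x) \<partial>lborel)"
      using p q by simp
    then have "(\<integral>\<^sup>+x. F (2 * x) \<partial>lborel) = (\<integral>\<^sup>+x. F (2 - 2 * x) \<partial>lborel)"
      unfolding ennreal_mult_cancel_left by simp
    then show ?thesis unfolding p by (simp only: mult_2)
  qed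
  finally show ?thesis by (simp add: nn_integral_unit_lebesgue F_def)
qed

lemma sin_ge_chord:
  assumes "0 \<le> u" "u \<le> 1"
  shows "sin (u * (pi / 2)) \<ge> u"
proof -
  have "convex_on {0..pi/2} (\<lambda>x. - sin x)"
    by (rule f''_ge0_imp_convex [where f' = "\<lambda>x. - cos x" and f'' = sin])
      (auto intro!: derivative_eq_intros sin_ge_zero)
  from convex_onD [OF this, of u 0 "pi / 2"] show ?thesis using assms by simp
qed

lemma abs_sin_pi_ge:
  assumes "\<bar>y - of_int b\<bar> \<le> 1 / 2"
  shows "\<bar>sin (pi * y)\<bar> \<ge> \<bar>y - of_int b\<bar>"
proof -
  define \<delta> where "\<delta> = y - of_int b"
  have "sin (pi * y) = sin (pi * \<delta> + of_int b * pi)"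
    by (simp add: \<delta>_def algebra_simps)
  also have "\<dots> = sin (pi * \<delta>) * cos (of_int b * pi)"
    by (simp add: sin_add sin_int_times_real mult.commute)
  finally have "\<bar>sin (pi * y)\<bar> = \<bar>sin (pi * \<delta>)\<bar>"
    by (simp add: abs_mult cos_int_times_real mult.commute abs_power_minus)
  moreover have "\<bar>sin (pi * \<delta>)\<bar> = \<bar>sin (pi * \<bar>\<delta>\<bar>)\<bar>"
    by (cases "\<delta> \<ge> 0") auto
  moreover have "sin (2 * \<bar>\<delta>\<bar> * (pi / 2)) \<ge> 2 * \<bar>\<delta>\<bar>"
    using assms by (intro sin_ge_chord) (auto simp: \<delta>_def)
  then have "sin (pi * \<bar>\<delta>\<bar>) \<ge> 2 * \<bar>\<delta>\<bar>" by (simp add: mult.commute)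
  ultimately show ?thesis unfolding \<delta>_def [symmetric] by linarith
qed

text \<open>
  Inverse square root singularities at the integers that \<open>y = x \<plusminus> a\<close> can be closest to when
  \<open>0 < x < 1\<close> and \<open>\<bar>a\<bar> \<le> 1\<close>.
\<close>

definition log_majorant :: "real \<Rightarrow> real" where
  "log_majorant y = ln 2 + (\<Sum>b\<in>{-1..2::int}. 2 * \<bar>y - of_int b\<bar> powr (-1/2))"

text \<open>
  The distance from \<open>1\<close> to the line spanned by \<open>cis (\<pi>y)\<close> is \<open>\<bar>sin (\<pi>y)\<bar>\<close>, which by concavity of
  the sine is at least the distance \<open>\<delta>\<close> of \<open>y\<close> to the nearest integer; and
  \<open>- ln \<delta> \<le> 2 \<delta>^(-1/2)\<close>.
\<close>

lemma abs_ln_one_minus_cis_le: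
  assumes y: "-1 < y" "y < 2" "\<And>b :: int. y \<noteq> of_int b" and r: "0 \<le> r" "r \<le> 1"
  shows "\<bar>ln (cmod (1 - of_real r * cis (pi * y)))\<bar> \<le> log_majorant y"
proof -
  define d where "d = cmod (1 - of_real r * cis (pi * y))"
  define b where "b = round y"
  have near: "\<bar>y - of_int b\<bar> \<le> 1 / 2"
    unfolding b_def by (metis abs_minus_commute of_int_round_abs_le)
  have b: "b \<in> {-1..2}"
  proof -
    have "real_of_int b > -2" "real_of_int b < 3"
      using near y(1,2) unfolding abs_le_iff by linarith+
    then show ?thesis by auto
  qed
  define \<delta> where "\<delta> = \<bar>y - of_int b\<bar>"
  have \<delta>: "\<delta> > 0" "\<delta> \<le> 1/2" using y(3) [of b] near by (auto simp: \<delta>_def)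
  have alg: "(1 - r * c)\<^sup>2 + (r * s)\<^sup>2 = (r - c)\<^sup>2 + s\<^sup>2" if "s\<^sup>2 + c\<^sup>2 = 1" for c s
    using that by algebra
  have "d\<^sup>2 = (1 - r * cos (pi * y))\<^sup>2 + (r * sin (pi * y))\<^sup>2"
    unfolding d_def cmod_power2 by simp
  also have "\<dots> = (r - cos (pi * y))\<^sup>2 + (sin (pi * y))\<^sup>2"
    using alg [OF sin_cos_squared_add] .
  finally have "\<bar>sin (pi * y)\<bar>\<^sup>2 \<le> d\<^sup>2" by simp
  moreover have "d \<ge> 0" by (simp add: d_def)
  ultimately have "\<bar>sin (pi * y)\<bar> \<le> d" by (rule power2_le_imp_le)
  then have "\<delta> \<le> d" using abs_sin_pi_ge [OF near] by (simp add: \<delta>_def)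
  then have "- ln d \<le> - ln \<delta>" using \<delta> by simp
  also have "\<dots> = 2 * ln (\<delta> powr (-1/2))" using \<delta> by (simp add: ln_powr)
  also have "\<dots> \<le> 2 * \<delta> powr (-1/2)"
    using ln_le_minus_one [of "\<delta> powr (-1/2)"] \<delta> by simp
  also have "\<dots> \<le> (\<Sum>b\<in>{-1..2::int}. 2 * \<bar>y - of_int b\<bar> powr (-1/2))"
    unfolding \<delta>_def using b
    by (intro member_le_sum [where f = "\<lambda>b. 2 * \<bar>y - of_int b\<bar> powr (-1/2)"]) auto
  finally have lower: "- ln d \<le> log_majorant y - ln 2" by (simp add: log_majorant_def)
  have "d \<le> 1 + cmod (of_real r * cis (pi * y))"
    unfolding d_def by (metis norm_one norm_triangle_ineq4)
  then have "d \<le> 2" using r by (simp add: norm_mult)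
  then have "ln d \<le> ln 2" using \<open>\<delta> \<le> d\<close> \<delta> by simp
  moreover have "ln 2 \<le> log_majorant y" unfolding log_majorant_def by (simp add: sum_nonneg)
  moreover have "ln (2::real) \<ge> 0" by simp
  ultimately show ?thesis using lower unfolding d_def by linarith
qed

text \<open>
  All translates that occur are dominated by the integral of \<open>\<bar>y\<bar>^(-1/2)\<close> over \<open>[-3, 3]\<close>.
\<close>

lemma nn_integral_log_majorant_bounded:
  obtains B where "B < \<infinity>"
    "\<And>c. -1 \<le> c \<Longrightarrow> c \<le> 1 \<Longrightarrow> (\<integral>\<^sup>+x. ennreal (log_majorant (x + c)) \<partial>unit_lebesgue) \<le> B"
proof -
  define K where "K = (\<integral>\<^sup>+y. ennreal (\<bar>y\<bar> powr (-1/2)) * indicator {-3..3} y \<partial>lborel)"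
  define K0 where "K0 = (\<integral>\<^sup>+y. ennreal (y powr (-1/2)) * indicator {0..3} y \<partial>lborel)"
  have "((\<lambda>x::real. x powr (-1/2)) has_integral (3 powr (-1/2+1) / (-1/2+1))) {0..3}"
    by (rule has_integral_powr_from_0) auto
  then have "K0 = ennreal (3 powr (-1/2+1) / (-1/2+1))"
    unfolding K0_def by (intro nn_integral_has_integral_lebesgue') auto
  then have K0: "K0 < \<infinity>" by simp
  have "K \<le> (\<integral>\<^sup>+y. ennreal (y powr (-1/2)) * indicator {0..3} y + ennreal ((-y) powr (-1/2)) * indicator {0..3} (-y) \<partial>lborel)"
    unfolding K_def by (intro nn_integral_mono) (auto simp: indicator_def abs_if)
  also have "\<dots> = K0 + (\<integral>\<^sup>+y. ennreal ((-y) powr (-1/2)) * indicator {0..3} (-y) \<partial>lborel)"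
    unfolding K0_def by (rule nn_integral_add) auto
  also have "(\<integral>\<^sup>+y. ennreal ((-y) powr (-1/2)) * indicator {0..3} (-y) \<partial>lborel) = K0"
    unfolding K0_def by (subst (2) nn_integral_real_affine [where c = "-1" and t = 0]) auto
  finally have "K \<le> K0 + K0" .
  moreover have "K0 + K0 < \<infinity>" using K0 by simp
  ultimately have K: "K < \<infinity>" by (rule le_less_trans)
  have shift: "(\<integral>\<^sup>+x. ennreal (\<bar>x + c\<bar> powr (-1/2)) \<partial>unit_lebesgue) \<le> K" if c: "-3 \<le> c" "c \<le> 2" for c
  proof -
    have "(\<integral>\<^sup>+x. ennreal (\<bar>x + c\<bar> powr (-1/2)) \<partial>unit_lebesgue)
        \<le> (\<integral>\<^sup>+x. ennreal (\<bar>c + 1 * x\<bar> powr (-1/2)) * indicator {-3..3} (c + 1 * x) \<partial>lborel)"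
      unfolding nn_integral_unit_lebesgue
      using c by (intro nn_integral_mono) (auto simp: indicator_def add.commute)
    also have "\<dots> = K"
      unfolding K_def by (subst (2) nn_integral_real_affine [where c = 1 and t = c]) auto
    finally show ?thesis .
  qed
  show thesis
  proof (rule that)
    show "ennreal (ln 2) + (\<Sum>b\<in>{-1..2::int}. 2 * K) < \<infinity>"
      using K by (simp add: ennreal_mult_less_top)
    fix c :: real assume c: "-1 \<le> c" "c \<le> 1"
    have "(\<integral>\<^sup>+x. ennreal (log_majorant (x + c)) \<partial>unit_lebesgue)
        = (\<integral>\<^sup>+x. ennreal (ln 2) + (\<Sum>b\<in>{-1..2::int}. 2 * ennreal (\<bar>x + (c - of_int b)\<bar> powr (-1/2))) \<partial>unit_lebesgue)"
      unfolding log_majorant_def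
      by (intro nn_integral_cong)
        (subst ennreal_plus, simp, simp add: sum_nonneg,
          simp add: sum_ennreal [symmetric] ennreal_mult add_diff_eq del: sum_ennreal)
    also have "\<dots> = ennreal (ln 2) + (\<Sum>b\<in>{-1..2::int}. 2 * (\<integral>\<^sup>+x. ennreal (\<bar>x + (c - of_int b)\<bar> powr (-1/2)) \<partial>unit_lebesgue))"
      by (subst nn_integral_add) (auto simp: nn_integral_sum nn_integral_cmult unit_lebesgue.emeasure_space_1 [simplified])
    also have "\<dots> \<le> ennreal (ln 2) + (\<Sum>b\<in>{-1..2::int}. 2 * K)"
      using c by (intro add_left_mono sum_mono mult_left_mono shift) auto
    finally show "(\<integral>\<^sup>+x. ennreal (log_majorant (x + c)) \<partial>unit_lebesgue)
      \<le> ennreal (ln 2) + (\<Sum>b\<in>{-1..2::int}. 2 * K)" .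
  qed
qed

section \<open>Logarithmic means of the arcsine law\<close>

text \<open>
  This is \<open>ln \<bar>(1 - \<zeta> e^(i\<pi>x)) (1 - \<zeta> e^(-i\<pi>x))\<bar>\<close>.
\<close>

definition circle_log :: "complex \<Rightarrow> real \<Rightarrow> real" where
  "circle_log \<zeta> x = ln (cmod (1 - 2 * \<zeta> * of_real (cos (pi * x)) + \<zeta>\<^sup>2))"

lemma circle_log_measurable [measurable]: "circle_log \<zeta> \<in> borel_measurable borel"
  unfolding circle_log_def by measurable

lemma circle_factorization:
  "1 - 2 * \<zeta> * of_real (cos t) + \<zeta>\<^sup>2 = (1 - \<zeta> * cis t) * (1 - \<zeta> * cis (- t))"
proof -
  have "cis t + cis (-t) = 2 * of_real (cos t)" by (simp add: complex_eq_iff)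
  moreover have "cis t * cis (-t) = 1" by (simp add: cis_mult)
  ultimately show ?thesis by (simp add: algebra_simps power2_eq_square) algebra
qed

lemma circle_log_bound:
  assumes "cmod \<zeta> \<le> 1"
  shows "AE x in unit_lebesgue. \<bar>circle_log \<zeta> x\<bar>
    \<le> log_majorant (x + Arg \<zeta> / pi) + log_majorant (x + (- (Arg \<zeta> / pi)))"
proof -
  define a where "a = Arg \<zeta> / pi"
  have a: "-1 \<le> a" "a \<le> 1"
    using Arg_bounded [of \<zeta>] by (auto simp: a_def field_simps)
  have \<zeta>: "\<zeta> = of_real (cmod \<zeta>) * cis (pi * a)"
    using rcis_cmod_Arg [of \<zeta>] by (simp add: a_def rcis_def)
  have mono: "log_majorant y \<ge> 0" for y
    by (auto simp: log_majorant_def intro!: add_nonneg_nonneg sum_nonneg)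
  have "AE x in unit_lebesgue. \<forall>b::int. x + a \<noteq> of_int b"
    unfolding AE_all_countable
  proof
    fix b :: int
    show "AE x in unit_lebesgue. x + a \<noteq> of_int b"
      using AE_unit_lebesgue_neq [of "of_int b - a"] by eventually_elim auto
  qed
  moreover have "AE x in unit_lebesgue. \<forall>b::int. x + (- a) \<noteq> of_int b"
    unfolding AE_all_countable
  proof
    fix b :: int
    show "AE x in unit_lebesgue. x + (- a) \<noteq> of_int b"
      using AE_unit_lebesgue_neq [of "of_int b + a"] by eventually_elim auto
  qed
  ultimately show ?thesis
    unfolding a_def [symmetric] using AE_space
  proof eventually_elim
    case (elim x)
    have x: "0 < x" "x < 1" using elim by auto
    define p q where "p = cmod (1 - \<zeta> * cis (pi * x))" and "q = cmod (1 - \<zeta> * cis (- (pi * x)))"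
    have p: "p = cmod (1 - of_real (cmod \<zeta>) * cis (pi * (x + a)))"
      unfolding p_def by (subst \<zeta>) (simp add: mult.assoc cis_mult algebra_simps)
    have "q = cmod (cnj (1 - \<zeta> * cis (- (pi * x))))"
      unfolding q_def by (rule complex_mod_cnj [symmetric])
    also have "cnj (1 - \<zeta> * cis (- (pi * x))) = 1 - of_real (cmod \<zeta>) * cis (pi * (x + (- a)))"
      by (subst \<zeta>) (simp add: mult.assoc cis_mult cis_cnj algebra_simps)
    finally have q: "q = cmod (1 - of_real (cmod \<zeta>) * cis (pi * (x + (- a))))" .
    have bp: "\<bar>ln p\<bar> \<le> log_majorant (x + a)"
      unfolding p using elim a x assms by (intro abs_ln_one_minus_cis_le) auto
    have bq: "\<bar>ln q\<bar> \<le> log_majorant (x + (- a))"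
      unfolding q using elim a x assms by (intro abs_ln_one_minus_cis_le) auto
    have "circle_log \<zeta> x = ln (p * q)"
      by (simp only: circle_log_def circle_factorization norm_mult p_def q_def)
    moreover have "\<bar>ln (p * q)\<bar> \<le> \<bar>ln p\<bar> + \<bar>ln q\<bar>"
    proof (cases "p = 0 \<or> q = 0")
      case False
      then have "p > 0" "q > 0" by (auto simp: p_def q_def)
      then show ?thesis by (simp add: ln_mult abs_triangle_ineq)
    qed auto
    ultimately show ?case using bp bq by linarith
  qed
qed

lemma log_majorant_measurable [measurable]: "log_majorant \<in> borel_measurable borel"
  unfolding log_majorant_def by measurable

text \<open>
  Uniformity up to and including \<open>\<bar>\<zeta>\<bar> = 1\<close>, where the integrand is singular, is what lets the
  doubling argument treat the closed disc at once.
\<close>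

lemma circle_log_uniformly_integrable:
  obtains B where "\<And>\<zeta>. cmod \<zeta> \<le> 1 \<Longrightarrow> integrable unit_lebesgue (circle_log \<zeta>)"
    "\<And>\<zeta>. cmod \<zeta> \<le> 1 \<Longrightarrow> \<bar>\<integral>x. circle_log \<zeta> x \<partial>unit_lebesgue\<bar> \<le> B"
proof -
  obtain B where B: "B < \<infinity>"
    "\<And>c. -1 \<le> c \<Longrightarrow> c \<le> 1 \<Longrightarrow> (\<integral>\<^sup>+x. ennreal (log_majorant (x + c)) \<partial>unit_lebesgue) \<le> B"
    using nn_integral_log_majorant_bounded by blast
  have nonneg: "log_majorant y \<ge> 0" for y
    by (auto simp: log_majorant_def intro!: add_nonneg_nonneg sum_nonneg)
  have bound: "(\<integral>\<^sup>+x. ennreal (norm (circle_log \<zeta> x)) \<partial>unit_lebesgue) \<le> B + B" if \<zeta>: "cmod \<zeta> \<le> 1" for \<zeta>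
  proof -
    define a where "a = Arg \<zeta> / pi"
    have a: "-1 \<le> a" "a \<le> 1"
      using Arg_bounded [of \<zeta>] by (auto simp: a_def field_simps)
    have "(\<integral>\<^sup>+x. ennreal (norm (circle_log \<zeta> x)) \<partial>unit_lebesgue)
        \<le> (\<integral>\<^sup>+x. ennreal (log_majorant (x + a)) + ennreal (log_majorant (x + (- a))) \<partial>unit_lebesgue)"
    proof (rule nn_integral_mono_AE)
      show "AE x in unit_lebesgue. ennreal (norm (circle_log \<zeta> x))
          \<le> ennreal (log_majorant (x + a)) + ennreal (log_majorant (x + (- a)))"
        using circle_log_bound [OF \<zeta>] unfolding a_def [symmetric]
        by eventually_elim (simp add: nonneg ennreal_leI flip: ennreal_plus)
    qed
    also have "\<dots> = (\<integral>\<^sup>+x. ennreal (log_majorant (x + a)) \<partial>unit_lebesgue) +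
        (\<integral>\<^sup>+x. ennreal (log_majorant (x + (- a))) \<partial>unit_lebesgue)"
      by (rule nn_integral_add) auto
    also have "\<dots> \<le> B + B" using a by (intro add_mono B) auto
    finally show ?thesis .
  qed
  have fin: "B + B < \<infinity>" using B by simp
  have int: "integrable unit_lebesgue (circle_log \<zeta>)" if "cmod \<zeta> \<le> 1" for \<zeta>
    using le_less_trans [OF bound [OF that] fin]
    by (intro integrableI_bounded) (auto intro: measurable_unit_lebesgue)
  moreover have "\<bar>\<integral>x. circle_log \<zeta> x \<partial>unit_lebesgue\<bar> \<le> enn2real (B + B)" if "cmod \<zeta> \<le> 1" for \<zeta>
  proof -
    have "norm (\<integral>x. circle_log \<zeta> x \<partial>unit_lebesgue) \<le> (\<integral>x. norm (circle_log \<zeta> x) \<partial>unit_lebesgue)"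
      by (rule integral_norm_bound)
    also have "\<dots> = enn2real (\<integral>\<^sup>+x. ennreal (norm (circle_log \<zeta> x)) \<partial>unit_lebesgue)"
      by (intro integral_eq_nn_integral) (auto intro: measurable_unit_lebesgue)
    also have "\<dots> \<le> enn2real (B + B)"
      using bound [OF that] fin by (intro enn2real_mono) auto
    finally show ?thesis by simp
  qed
  ultimately show thesis by (rule that)
qed

text \<open>
  With \<open>c = cos (\<pi>x)\<close> one has \<open>(1 - 2\<zeta>c + \<zeta>^2) (1 + 2\<zeta>c + \<zeta>^2) = 1 - 2\<zeta>^2 (2c^2 - 1) + \<zeta>^4\<close>,
  and \<open>2c^2 - 1\<close> is the cosine at the image under the tent map. The second factor on the left is
  the first one at \<open>1 - x\<close>. Tent map and reflection preserve the measure.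
\<close>

lemma circle_log_doubling:
  assumes \<zeta>: "cmod \<zeta> \<le> 1"
  shows "(\<integral>x. circle_log (\<zeta>\<^sup>2) x \<partial>unit_lebesgue) = 2 * (\<integral>x. circle_log \<zeta> x \<partial>unit_lebesgue)"
proof -
  obtain B where int: "\<And>\<zeta>. cmod \<zeta> \<le> 1 \<Longrightarrow> integrable unit_lebesgue (circle_log \<zeta>)"
    using circle_log_uniformly_integrable by blast
  have [measurable]: "tent \<in> borel_measurable borel" unfolding tent_def by measurable
  have refl: "circle_log \<zeta> (1 - x) = circle_log (- \<zeta>) x" for x
    by (simp add: circle_log_def right_diff_distrib cos_diff)
  have int': "integrable unit_lebesgue (\<lambda>x. circle_log \<zeta> (1 - x))"
    unfolding refl using \<zeta> by (intro int) simp
  have single: "AE x in unit_lebesgue. 1 - 2 * \<eta> * of_real (cos (pi * x)) + \<eta>\<^sup>2 \<noteq> 0" for \<eta> :: complex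
  proof -
    define k where "k = Re ((1 + \<eta>\<^sup>2) / (2 * \<eta>))"
    show ?thesis
      using AE_unit_lebesgue_neq [of "arccos k / pi"] AE_space
    proof eventually_elim
      case (elim x)
      show ?case
      proof
        assume eq: "1 - 2 * \<eta> * of_real (cos (pi * x)) + \<eta>\<^sup>2 = 0"
        then have "\<eta> \<noteq> 0" by auto
        then have "of_real (cos (pi * x)) = (1 + \<eta>\<^sup>2) / (2 * \<eta>)"
          using eq by (simp add: field_simps)
        then have "cos (pi * x) = k" unfolding k_def by (metis Re_complex_of_real)
        moreover have "arccos (cos (pi * x)) = pi * x"
          using elim by (intro arccos_cos) auto
        ultimately show False using elim by auto
      qed
    qed
  qed
  have "(\<integral>x. circle_log (\<zeta>\<^sup>2) x \<partial>unit_lebesgue) = (\<integral>x. circle_log (\<zeta>\<^sup>2) (tent x) \<partial>unit_lebesgue)"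
    by (rule measure_preserving_integral [symmetric]) (auto intro: tent_preserves)
  also have "\<dots> = (\<integral>x. circle_log \<zeta> x + circle_log \<zeta> (1 - x) \<partial>unit_lebesgue)"
  proof (rule integral_cong_AE)
    show "AE x in unit_lebesgue. circle_log (\<zeta>\<^sup>2) (tent x) = circle_log \<zeta> x + circle_log \<zeta> (1 - x)"
      using single [of \<zeta>] single [of "- \<zeta>"]
    proof eventually_elim
      case (elim x)
      have "cos (pi * tent x) = cos (2 * (pi * x))"
      proof (cases "x \<le> 1 / 2")
        case True
        then show ?thesis by (simp add: tent_def mult_ac)
      next
        case False
        then have "pi * tent x = 2 * pi - 2 * (pi * x)" by (simp add: tent_def algebra_simps)
        then show ?thesis by (simp add: cos_diff)
      qed
      then have c: "cos (pi * tent x) = 2 * (cos (pi * x))\<^sup>2 - 1" by (simp add: cos_double_cos)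
      have "1 - 2 * \<zeta>\<^sup>2 * of_real (cos (pi * tent x)) + (\<zeta>\<^sup>2)\<^sup>2
         = (1 - 2 * \<zeta> * of_real (cos (pi * x)) + \<zeta>\<^sup>2) * (1 - 2 * (- \<zeta>) * of_real (cos (pi * x)) + (- \<zeta>)\<^sup>2)"
        unfolding c by (simp add: power2_eq_square algebra_simps)
      then show ?case
        unfolding refl unfolding circle_log_def using elim by (simp add: norm_mult ln_mult)
    qed
  qed auto
  also have "\<dots> = (\<integral>x. circle_log \<zeta> x \<partial>unit_lebesgue) + (\<integral>x. circle_log \<zeta> (1 - x) \<partial>unit_lebesgue)"
    using int [OF \<zeta>] int' by (rule Bochner_Integration.integral_add)
  also have "(\<integral>x. circle_log \<zeta> (1 - x) \<partial>unit_lebesgue) = (\<integral>x. circle_log \<zeta> x \<partial>unit_lebesgue)"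
    by (rule measure_preserving_integral) (auto intro: reflection_preserves)
  finally show ?thesis by simp
qed

text \<open>
  The integral \<open>J\<close> satisfies \<open>J(\<zeta>) = J(\<zeta>^(2^n)) / 2^n\<close> and is bounded on the closed disc.
\<close>

lemma integral_circle_log:
  assumes "cmod \<zeta> \<le> 1"
  shows "integrable unit_lebesgue (circle_log \<zeta>)" "(\<integral>x. circle_log \<zeta> x \<partial>unit_lebesgue) = 0"
proof -
  obtain B where int: "\<And>\<zeta>. cmod \<zeta> \<le> 1 \<Longrightarrow> integrable unit_lebesgue (circle_log \<zeta>)"
    and B: "\<And>\<zeta>. cmod \<zeta> \<le> 1 \<Longrightarrow> \<bar>\<integral>x. circle_log \<zeta> x \<partial>unit_lebesgue\<bar> \<le> B"
    using circle_log_uniformly_integrable by blast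
  show "integrable unit_lebesgue (circle_log \<zeta>)" using int assms .
  define J where "J = (\<lambda>\<zeta>. \<integral>x. circle_log \<zeta> x \<partial>unit_lebesgue)"
  have iter: "J (\<zeta> ^ (2 ^ n)) = 2 ^ n * J \<zeta>" for n
  proof (induction n)
    case (Suc n)
    have "J (\<zeta> ^ (2 ^ Suc n)) = J ((\<zeta> ^ (2 ^ n))\<^sup>2)"
      by (simp add: power_mult [symmetric] mult.commute)
    also have "\<dots> = 2 * J (\<zeta> ^ (2 ^ n))"
      unfolding J_def using assms by (intro circle_log_doubling) (simp add: norm_power power_le_one)
    finally show ?case using Suc by simp
  qed simp
  have "\<bar>J \<zeta>\<bar> \<le> B * (1 / 2) ^ n" for n
  proof -
    have "2 ^ n * \<bar>J \<zeta>\<bar> = \<bar>J (\<zeta> ^ (2 ^ n))\<bar>" by (simp add: iter abs_mult)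
    also have "\<dots> \<le> B"
      unfolding J_def using assms by (intro B) (simp add: norm_power power_le_one)
    finally show ?thesis by (simp add: field_simps)
  qed
  moreover have "(\<lambda>n. B * (1 / 2) ^ n) \<longlonglongrightarrow> B * 0"
    by (intro tendsto_mult_left LIMSEQ_power_zero) simp
  ultimately have "\<bar>J \<zeta>\<bar> \<le> B * 0"
    by (intro LIMSEQ_le_const) auto
  then show "(\<integral>x. circle_log \<zeta> x \<partial>unit_lebesgue) = 0" by (simp add: J_def)
qed

text \<open>
  This is \<open>cos^2 (\<pi>x/2)\<close>; its law is the arcsine law on \<open>[0, 1]\<close>.
\<close>

definition half_cos :: "real \<Rightarrow> real" where
  "half_cos x = (1 + cos (pi * x)) / 2"

lemma half_cos_measurable [measurable]: "half_cos \<in> borel_measurable borel"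
  unfolding half_cos_def by measurable

lemma half_cos_bounds:
  assumes "0 < x" "x < 1"
  shows "0 < half_cos x" "half_cos x < 1"
proof -
  have "pi * x < pi * 1" using assms by (intro mult_strict_left_mono) auto
  then have "cos pi < cos (pi * x)"
    using assms by (intro cos_monotone_0_pi) auto
  moreover have "cos (pi * x) < cos 0"
    using assms \<open>pi * x < pi * 1\<close> by (intro cos_monotone_0_pi) auto
  ultimately show "0 < half_cos x" "half_cos x < 1" by (auto simp: half_cos_def)
qed

text \<open>
  The Joukowski parametrization \<open>4\<alpha> = \<omega> + 2 + 1/\<omega>\<close> turns the linear factor into
  \<open>1 - 2\<omega> cos (\<pi>x) + \<omega>^2\<close> divided by \<open>-4\<omega>\<close>. Taking \<open>\<bar>\<omega>\<bar> = 1\<close> covers the points \<open>\<alpha>\<close> of the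
  support.
\<close>

lemma ln_half_cos_diff:
  assumes \<omega>: "cmod \<omega> \<le> 1" "\<omega> \<noteq> 0" and \<alpha>: "4 * \<alpha> = \<omega> + 2 + 1 / \<omega>"
  shows "AE x in unit_lebesgue. of_real (half_cos x) - \<alpha> \<noteq> 0"
    and "integrable unit_lebesgue (\<lambda>x. ln (cmod (of_real (half_cos x) - \<alpha>)))"
    and "(\<integral>x. ln (cmod (of_real (half_cos x) - \<alpha>)) \<partial>unit_lebesgue) = - ln (4 * cmod \<omega>)"
proof -
  have eq: "1 - 2 * \<omega> * of_real (cos (pi * x)) + \<omega>\<^sup>2 = - 4 * \<omega> * (of_real (half_cos x) - \<alpha>)" for x
  proof -
    have "4 * \<omega> * \<alpha> = \<omega> * (\<omega> + 2 + 1 / \<omega>)"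
      unfolding \<alpha> [symmetric] by simp
    also have "\<dots> = \<omega>\<^sup>2 + 2 * \<omega> + 1"
      using \<omega>(2) by (simp add: distrib_left power2_eq_square)
    finally have "4 * \<omega> * \<alpha> = \<omega>\<^sup>2 + 2 * \<omega> + 1" .
    moreover have "2 * complex_of_real (half_cos x) = 1 + of_real (cos (pi * x))"
      by (simp add: half_cos_def)
    then have "4 * \<omega> * complex_of_real (half_cos x) = 2 * \<omega> * (1 + of_real (cos (pi * x)))"
      by algebra
    ultimately show ?thesis by (simp add: algebra_simps)
  qed
  show ne: "AE x in unit_lebesgue. of_real (half_cos x) - \<alpha> \<noteq> 0"
    using AE_unit_lebesgue_neq [of "arccos (2 * Re \<alpha> - 1) / pi"] AE_space
  proof eventually_elim
    case (elim x)
    show ?case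
    proof
      assume "of_real (half_cos x) - \<alpha> = 0"
      then have "Re \<alpha> = half_cos x" by (metis Re_complex_of_real eq_iff_diff_eq_0)
      then have "2 * Re \<alpha> - 1 = cos (pi * x)" by (simp add: half_cos_def)
      moreover have "arccos (cos (pi * x)) = pi * x"
        using elim by (intro arccos_cos) auto
      ultimately show False using elim by auto
    qed
  qed
  have ln: "AE x in unit_lebesgue. ln (cmod (of_real (half_cos x) - \<alpha>)) = circle_log \<omega> x - ln (4 * cmod \<omega>)"
    using ne
  proof eventually_elim
    case (elim x)
    then show ?case using \<omega>(2) unfolding circle_log_def eq by (simp add: norm_mult ln_mult)
  qed
  note J = integral_circle_log [OF \<omega>(1)]
  have int: "integrable unit_lebesgue (\<lambda>x. circle_log \<omega> x - ln (4 * cmod \<omega>))"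
    using J by simp
  show "integrable unit_lebesgue (\<lambda>x. ln (cmod (of_real (half_cos x) - \<alpha>)))"
    using integrable_cong_AE [THEN iffD2, OF _ _ ln int] by simp
  have "(\<integral>x. ln (cmod (of_real (half_cos x) - \<alpha>)) \<partial>unit_lebesgue)
      = (\<integral>x. circle_log \<omega> x - ln (4 * cmod \<omega>) \<partial>unit_lebesgue)"
    using ln by (intro integral_cong_AE) auto
  also have "\<dots> = - ln (4 * cmod \<omega>)"
    using J by (simp add: unit_lebesgue.prob_space [simplified])
  finally show "(\<integral>x. ln (cmod (of_real (half_cos x) - \<alpha>)) \<partial>unit_lebesgue) = - ln (4 * cmod \<omega>)" .
qed

section \<open>Logarithmic means of quadratic polynomials\<close>

lemma cmod_sum_diff_sq:
  fixes A B :: complex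
  shows "(cmod (A + B) + cmod (A - B))\<^sup>2 = 2 * (cmod A)\<^sup>2 + 2 * (cmod B)\<^sup>2 + 2 * cmod (A\<^sup>2 - B\<^sup>2)"
proof -
  have "(cmod (A + B))\<^sup>2 + (cmod (A - B))\<^sup>2 = 2 * (cmod A)\<^sup>2 + 2 * (cmod B)\<^sup>2"
    unfolding cmod_power2 by (simp add: power2_eq_square algebra_simps)
  moreover have "cmod (A + B) * cmod (A - B) = cmod (A\<^sup>2 - B\<^sup>2)"
    by (simp add: norm_mult [symmetric] power2_eq_square algebra_simps)
  ultimately show ?thesis by (simp add: power2_sum)
qed

text \<open>
  Used to decide which of the two branches \<open>A \<plusminus> B\<close> of a square root has the larger modulus.
\<close>

lemma cmod_diff_le_sum:
  fixes A B :: complex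
  assumes "Re A * Re B + Im A * Im B \<ge> 0"
  shows "cmod (A - B) \<le> cmod (A + B)"
proof -
  have "(cmod (A - B))\<^sup>2 \<le> (cmod (A + B))\<^sup>2"
    using assms unfolding cmod_power2 by (simp add: power2_eq_square algebra_simps)
  then show ?thesis by (rule power2_le_imp_le) simp
qed

lemma le_of_add_inverse_le:
  fixes p r :: real
  assumes "p \<ge> 1" "r > 0" "r + 1 / r \<le> p + 1 / p"
  shows "r \<le> p"
proof (rule ccontr)
  assume "\<not> ?thesis"
  then have rp: "r > p" by simp
  have "r * 1 \<le> r * p" using assms by (intro mult_left_mono) auto
  then have "r * p > 1" using rp assms(1) by linarith
  then have "(r - p) * (1 - 1 / (r * p)) > 0"
    using rp by (intro mult_pos_pos) auto
  moreover have "(r - p) * (1 - 1 / (r * p)) = (r + 1 / r) - (p + 1 / p)"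
    using assms by (simp add: field_simps)
  ultimately show False using assms(3) by simp
qed

text \<open>
  The pairs \<open>P, P' = 1 + 2s \<plusminus> B\<close> and \<open>R, R' = 1 - 2s \<plusminus> B2\<close> consist of reciprocals, and the roots of
  the quadratic polynomial have the Joukowski parameters \<open>1/(PR)\<close> and \<open>R/P\<close>. These lie in the
  closed unit disc because \<open>\<bar>P\<bar> + 1/\<bar>P\<bar> \<ge> \<bar>R\<bar> + 1/\<bar>R\<bar>\<close>, which holds for \<open>Re s \<ge> 0\<close>. In the sum of
  the two logarithmic means the factor \<open>R\<close> cancels.
\<close>

lemma mean_ln_quadratic:
  fixes s B :: complex
  assumes s: "Re s \<ge> 0" and B: "B\<^sup>2 = 4 * (s\<^sup>2 + s)"
    and dom: "cmod (1 + 2 * s - B) \<le> cmod (1 + 2 * s + B)"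
  defines "q \<equiv> \<lambda>x. (complex_of_real (half_cos x))\<^sup>2 + (4 * s\<^sup>2 - 2) * of_real (half_cos x) + 1"
  shows "AE x in unit_lebesgue. q x \<noteq> 0"
    and "integrable unit_lebesgue (\<lambda>x. ln (cmod (q x)))"
    and "(\<integral>x. ln (cmod (q x)) \<partial>unit_lebesgue) = 2 * ln (cmod (1 + 2 * s + B)) - 4 * ln 2"
proof -
  define P where "P = 1 + 2 * s + B"
  define P' where "P' = 1 + 2 * s - B"
  define B2 where "B2 = 2 * csqrt (s\<^sup>2 - s)"
  define R where "R = 1 - 2 * s + B2"
  define R' where "R' = 1 - 2 * s - B2"
  have B2: "B2\<^sup>2 = 4 * (s\<^sup>2 - s)" by (simp add: B2_def power_mult_distrib)
  have PP: "P * P' = 1"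
    using B unfolding P_def P'_def by algebra
  have RR: "R * R' = 1"
    using B2 unfolding R_def R'_def by algebra
  have ne: "P \<noteq> 0" "R \<noteq> 0" using PP RR by auto
  have inv: "P' = 1 / P" "R' = 1 / R" using PP RR ne by (auto simp: field_simps)
  have cinv: "cmod P' = 1 / cmod P" "cmod R' = 1 / cmod R" unfolding inv by (simp_all add: norm_divide)
  have P1: "cmod P \<ge> 1"
  proof -
    have "cmod P * cmod P' = 1" using PP by (metis norm_mult norm_one)
    moreover have "cmod P * cmod P' \<le> cmod P * cmod P"
      using dom unfolding P_def P'_def by (intro mult_left_mono) auto
    ultimately have "1\<^sup>2 \<le> (cmod P)\<^sup>2" by (simp add: power2_eq_square)
    then show ?thesis by (rule power2_le_imp_le) simp
  qed
  have sum_le: "cmod R + cmod R' \<le> cmod P + cmod P'"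
  proof (rule power2_le_imp_le)
    have "(cmod (1 - 2 * s))\<^sup>2 \<le> (cmod (1 + 2 * s))\<^sup>2"
      using s unfolding cmod_power2 by (simp add: power2_eq_square algebra_simps)
    moreover have "(cmod B2)\<^sup>2 \<le> (cmod B)\<^sup>2"
    proof -
      have "cmod (s - 1) \<le> cmod (s + 1)"
        using s by (intro cmod_diff_le_sum) simp
      then have "cmod (4 * s * (s - 1)) \<le> cmod (4 * s * (s + 1))"
        unfolding norm_mult by (intro mult_left_mono) auto
      moreover have "B2\<^sup>2 = 4 * s * (s - 1)" "B\<^sup>2 = 4 * s * (s + 1)"
        using B B2 by (simp_all add: power2_eq_square algebra_simps)
      ultimately show ?thesis by (metis norm_power)
    qed
    moreover have "(cmod R + cmod R')\<^sup>2 = 2 * (cmod (1 - 2 * s))\<^sup>2 + 2 * (cmod B2)\<^sup>2 + 2 * cmod ((1 - 2 * s)\<^sup>2 - B2\<^sup>2)"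
      unfolding R_def R'_def by (rule cmod_sum_diff_sq)
    moreover have "(cmod P + cmod P')\<^sup>2 = 2 * (cmod (1 + 2 * s))\<^sup>2 + 2 * (cmod B)\<^sup>2 + 2 * cmod ((1 + 2 * s)\<^sup>2 - B\<^sup>2)"
      unfolding P_def P'_def by (rule cmod_sum_diff_sq)
    moreover have "cmod ((1 - 2 * s)\<^sup>2 - B2\<^sup>2) = cmod ((1 + 2 * s)\<^sup>2 - B\<^sup>2)"
      unfolding B B2 by (rule arg_cong [where f = cmod]) (simp add: power2_eq_square algebra_simps)
    ultimately show "(cmod R + cmod R')\<^sup>2 \<le> (cmod P + cmod P')\<^sup>2" by linarith
  qed simp
  have sum_le': "cmod R + 1 / cmod R \<le> cmod P + 1 / cmod P"
    using sum_le unfolding cinv .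
  have RP: "cmod R \<le> cmod P"
    using ne by (intro le_of_add_inverse_le [OF P1 _ sum_le']) simp
  have RP': "1 / cmod R \<le> cmod P"
  proof (rule le_of_add_inverse_le [OF P1])
    show "1 / cmod R > 0" using ne by simp
    have "1 / (1 / cmod R) = cmod R" by simp
    then show "1 / cmod R + 1 / (1 / cmod R) \<le> cmod P + 1 / cmod P"
      using sum_le' by linarith
  qed
  define \<omega>1 where "\<omega>1 = P' * R'"
  define \<omega>2 where "\<omega>2 = R * P'"
  define \<alpha>1 where "\<alpha>1 = (\<omega>1 + 2 + P * R) / 4"
  define \<alpha>2 where "\<alpha>2 = (\<omega>2 + 2 + P * R') / 4"
  have w1: "cmod \<omega>1 \<le> 1" "\<omega>1 \<noteq> 0" "4 * \<alpha>1 = \<omega>1 + 2 + 1 / \<omega>1"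
    using ne P1 RP' unfolding \<omega>1_def \<alpha>1_def inv by (auto simp: norm_mult norm_divide field_simps)
  have w2: "cmod \<omega>2 \<le> 1" "\<omega>2 \<noteq> 0" "4 * \<alpha>2 = \<omega>2 + 2 + 1 / \<omega>2"
    using ne P1 RP unfolding \<omega>2_def \<alpha>2_def inv by (auto simp: norm_mult norm_divide field_simps)
  have PA: "P + P' = 2 * (1 + 2 * s)" "R + R' = 2 * (1 - 2 * s)"
    by (simp_all add: P_def P'_def R_def R'_def)
  have sum: "\<alpha>1 + \<alpha>2 = 2 - 4 * s\<^sup>2"
  proof -
    have "4 * \<alpha>1 = P' * R' + 2 + P * R" "4 * \<alpha>2 = R * P' + 2 + P * R'"
      by (simp_all add: \<alpha>1_def \<alpha>2_def \<omega>1_def \<omega>2_def)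
    then have "4 * (\<alpha>1 + \<alpha>2) = 4 + (P + P') * (R + R')"
      by algebra
    also have "\<dots> = 4 * (2 - 4 * s\<^sup>2)"
      unfolding PA by (simp add: power2_eq_square algebra_simps)
    finally show ?thesis by (metis mult_cancel_left zero_neq_numeral)
  qed
  have prod: "\<alpha>1 * \<alpha>2 = 1"
  proof -
    have "16 * (\<alpha>1 * \<alpha>2) = (P' * R' + 2 + P * R) * (R * P' + 2 + P * R')"
      unfolding \<alpha>1_def \<alpha>2_def \<omega>1_def \<omega>2_def by simp
    also have "\<dots> = (P + P' + (R + R'))\<^sup>2"
      using PP RR by algebra
    also have "\<dots> = 16 * 1" unfolding PA by (simp add: power2_eq_square algebra_simps)
    finally show ?thesis by simp
  qed
  have q: "q x = (of_real (half_cos x) - \<alpha>1) * (of_real (half_cos x) - \<alpha>2)" for x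
    using sum prod unfolding q_def by algebra
  note l1 = ln_half_cos_diff [OF w1] and l2 = ln_half_cos_diff [OF w2]
  show "AE x in unit_lebesgue. q x \<noteq> 0"
    using l1(1) l2(1) by eventually_elim (simp add: q)
  have ln: "AE x in unit_lebesgue. ln (cmod (q x)) =
      ln (cmod (of_real (half_cos x) - \<alpha>1)) + ln (cmod (of_real (half_cos x) - \<alpha>2))"
    using l1(1) l2(1) by eventually_elim (simp add: q norm_mult ln_mult)
  have int: "integrable unit_lebesgue (\<lambda>x. ln (cmod (of_real (half_cos x) - \<alpha>1)) + ln (cmod (of_real (half_cos x) - \<alpha>2)))"
    using l1(2) l2(2) by simp
  have [measurable]: "q \<in> borel_measurable borel" unfolding q_def by measurable
  show "integrable unit_lebesgue (\<lambda>x. ln (cmod (q x)))"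
    using integrable_cong_AE [THEN iffD2, OF _ _ ln int] by simp
  have "(\<integral>x. ln (cmod (q x)) \<partial>unit_lebesgue)
      = (\<integral>x. ln (cmod (of_real (half_cos x) - \<alpha>1)) + ln (cmod (of_real (half_cos x) - \<alpha>2)) \<partial>unit_lebesgue)"
    using ln by (intro integral_cong_AE) auto
  also have "\<dots> = - ln (4 * cmod \<omega>1) + - ln (4 * cmod \<omega>2)"
    using l1 l2 by simp
  also have "\<dots> = - ln (16 * (cmod \<omega>1 * cmod \<omega>2))"
    using w1(2) w2(2) ln_realpow [of 4 2] by (simp add: ln_mult)
  also have "cmod \<omega>1 * cmod \<omega>2 = 1 / (cmod P)\<^sup>2"
    using ne unfolding \<omega>1_def \<omega>2_def inv by (simp add: norm_mult norm_divide power2_eq_square)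
  also have "- ln (16 * (1 / (cmod P)\<^sup>2)) = 2 * ln (cmod P) - 4 * ln 2"
  proof -
    have "ln 16 = 4 * ln (2::real)" using ln_realpow [of 2 4] by simp
    moreover have "ln (16 * (1 / (cmod P)\<^sup>2)) = ln 16 - 2 * ln (cmod P)"
      using ne by (simp add: ln_div ln_realpow)
    ultimately show ?thesis by simp
  qed
  finally show "(\<integral>x. ln (cmod (q x)) \<partial>unit_lebesgue) = 2 * ln (cmod (1 + 2 * s + B)) - 4 * ln 2"
    by (simp add: P_def)
qed

lemma Im_csqrt_sign:
  "Im z \<ge> 0 \<Longrightarrow> Im (csqrt z) \<ge> 0" "Im z < 0 \<Longrightarrow> Im (csqrt z) \<le> 0"
  using complex_Re_le_cmod [of z] by (auto simp: mult_nonpos_nonneg)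

text \<open>
  The value \<open>\<alpha> = 0\<close> has the Joukowski parameter \<open>\<omega> = -1\<close>.
\<close>

lemma mean_ln_half_cos:
  "integrable unit_lebesgue (\<lambda>x. ln (half_cos x))"
  "(\<integral>x. ln (half_cos x) \<partial>unit_lebesgue) = - ln 4"
proof -
  have eq: "cmod (of_real (half_cos x) - 0) = half_cos x" if "x \<in> space unit_lebesgue" for x
    using half_cos_bounds [of x] that by simp
  note l = ln_half_cos_diff [of "-1" 0]
  have "integrable unit_lebesgue (\<lambda>x. ln (cmod (of_real (half_cos x) - 0)))"
    by (rule l(2)) auto
  then show "integrable unit_lebesgue (\<lambda>x. ln (half_cos x))"
    by (rule Bochner_Integration.integrable_cong [THEN iffD1, OF refl, rotated]) (simp only: eq)
  have "(\<integral>x. ln (half_cos x) \<partial>unit_lebesgue) = (\<integral>x. ln (cmod (of_real (half_cos x) - 0)) \<partial>unit_lebesgue)"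
    by (intro Bochner_Integration.integral_cong refl) (simp only: eq)
  also have "\<dots> = - ln 4"
    using l(3) by simp
  finally show "(\<integral>x. ln (half_cos x) \<partial>unit_lebesgue) = - ln 4" .
qed

text \<open>
  The value \<open>\<alpha> = -1\<close> has the Joukowski parameter \<open>\<omega> = -(sqrt 2 - 1)^2\<close>.
\<close>

lemma mean_ln_one_plus_half_cos:
  "integrable unit_lebesgue (\<lambda>x. ln (1 + half_cos x))"
  "(\<integral>x. ln (1 + half_cos x) \<partial>unit_lebesgue) = 2 * ln (1 + sqrt 2) - 2 * ln 2"
proof -
  define \<omega> where "\<omega> = complex_of_real (- ((sqrt 2 - 1)\<^sup>2))"
  have sq: "(sqrt 2 - 1) * (sqrt 2 + 1) = 1" by (simp add: algebra_simps)
  have w: "cmod \<omega> = (sqrt 2 - 1)\<^sup>2" by (simp add: \<omega>_def del: of_real_power of_real_diff)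
  have pos: "sqrt 2 - 1 > 0" by simp
  have inv: "1 / (sqrt 2 - 1)\<^sup>2 = (sqrt 2 + 1)\<^sup>2"
  proof -
    have "(sqrt 2 - 1)\<^sup>2 * (sqrt 2 + 1)\<^sup>2 = 1"
      unfolding power_mult_distrib [symmetric] sq by simp
    moreover have "1 / a = b" if "a * b = 1" for a b :: real
    proof -
      have "a \<noteq> 0" using that by auto
      then show ?thesis using that by (simp add: field_simps)
    qed
    ultimately show ?thesis by blast
  qed
  have "\<omega> \<noteq> 0" using w pos by auto
  moreover have "sqrt 2 - 1 \<le> 1" using sqrt2_less_2 by linarith
  then have "cmod \<omega> \<le> 1" unfolding w using pos by (intro power_le_one) auto
  moreover have "\<omega> + 2 + 1 / \<omega> = 4 * (-1)"
  proof -
    have "\<omega> + 2 + 1 / \<omega> = complex_of_real (2 - (sqrt 2 - 1)\<^sup>2 - 1 / (sqrt 2 - 1)\<^sup>2)"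
      by (simp add: \<omega>_def)
    also have "2 - (sqrt 2 - 1)\<^sup>2 - 1 / (sqrt 2 - 1)\<^sup>2 = - 4"
      unfolding inv by (simp add: power2_eq_square algebra_simps)
    finally show ?thesis by simp
  qed
  ultimately have l: "integrable unit_lebesgue (\<lambda>x. ln (cmod (of_real (half_cos x) - (-1))))"
    "(\<integral>x. ln (cmod (of_real (half_cos x) - (-1))) \<partial>unit_lebesgue) = - ln (4 * cmod \<omega>)"
    using ln_half_cos_diff [of \<omega> "-1"] by auto
  have eq: "cmod (of_real (half_cos x) - (-1)) = 1 + half_cos x" if "x \<in> space unit_lebesgue" for x
  proof -
    have "of_real (half_cos x) - (-1) = complex_of_real (1 + half_cos x)" by simp
    then show ?thesis using half_cos_bounds [of x] that by (simp only: norm_of_real) auto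
  qed
  show "integrable unit_lebesgue (\<lambda>x. ln (1 + half_cos x))"
    using l(1)
    by (rule Bochner_Integration.integrable_cong [THEN iffD1, OF refl, rotated]) (simp only: eq)
  have "(\<integral>x. ln (1 + half_cos x) \<partial>unit_lebesgue) = - ln (4 * cmod \<omega>)"
    unfolding l(2) [symmetric]
    by (intro Bochner_Integration.integral_cong refl) (simp only: eq)
  also have "\<dots> = - ln (4 * (sqrt 2 - 1)\<^sup>2)" unfolding w ..
  also have "\<dots> = - (2 * ln 2 + 2 * ln (sqrt 2 - 1))"
    using pos ln_realpow [of 2 2] by (simp add: ln_mult ln_realpow)
  also have "ln (sqrt 2 - 1) = - ln (1 + sqrt 2)"
  proof -
    have "sqrt 2 + 1 > 0" by (simp add: add_nonneg_pos)
    then have "ln (sqrt 2 - 1) + ln (sqrt 2 + 1) = 0"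
      using ln_mult_pos [of "sqrt 2 - 1" "sqrt 2 + 1"] pos unfolding sq by simp
    then show ?thesis by (simp add: add.commute)
  qed
  finally show "(\<integral>x. ln (1 + half_cos x) \<partial>unit_lebesgue) = 2 * ln (1 + sqrt 2) - 2 * ln 2" by simp
qed

section \<open>The limit measures and their potentials\<close>

text \<open>
  Random variables on the unit interval whose laws are the limit measures of the two zero
  distributions.
\<close>

definition nu_point :: "real \<Rightarrow> real" where
  "nu_point x = 1 - 2 * ((1 - half_cos x) / (1 + half_cos x))\<^sup>2"

definition mu_point :: "real \<Rightarrow> real" where
  "mu_point x = - ((1 - half_cos x)\<^sup>2 / (4 * half_cos x))"

definition nu_measure :: "complex measure" where
  "nu_measure = distr unit_lebesgue borel (\<lambda>x. complex_of_real (nu_point x))"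

definition mu_measure :: "complex measure" where
  "mu_measure = distr unit_lebesgue borel (\<lambda>x. complex_of_real (mu_point x))"

lemma point_measurable [measurable]:
  "nu_point \<in> borel_measurable borel" "mu_point \<in> borel_measurable borel"
  unfolding nu_point_def mu_point_def by measurable

lemma nu_point_bounds:
  assumes "0 < x" "x < 1"
  shows "-1 < nu_point x" "nu_point x < 1"
proof -
  define k where "k = (1 - half_cos x) / (1 + half_cos x)"
  have k: "0 < k" "k < 1" using half_cos_bounds [OF assms] by (auto simp: k_def)
  then have "k\<^sup>2 < 1\<^sup>2" by (intro power_strict_mono) auto
  then show "-1 < nu_point x" "nu_point x < 1"
    using k unfolding nu_point_def k_def [symmetric] by auto
qed

lemma mu_point_neg:
  assumes "0 < x" "x < 1"
  shows "mu_point x < 0"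
  using half_cos_bounds [OF assms] by (simp add: mu_point_def)

lemma mu_point_eq:
  assumes "0 < x" "x < 1"
  shows "mu_point x = (nu_point x - 1) / (nu_point x + 1)"
proof -
  define C where "C = half_cos x"
  have C: "0 < C" "C < 1" unfolding C_def using half_cos_bounds [OF assms] by auto
  have "nu_point x - 1 = - 2 * (1 - C)\<^sup>2 / (1 + C)\<^sup>2"
    by (simp add: nu_point_def C_def power_divide)
  moreover have "nu_point x + 1 = 8 * C / (1 + C)\<^sup>2"
  proof -
    have "(nu_point x + 1) * (1 + C)\<^sup>2 = 2 * (1 + C)\<^sup>2 - 2 * (1 - C)\<^sup>2"
      using C by (simp add: nu_point_def C_def [symmetric] power_divide distrib_right left_diff_distrib)
    also have "\<dots> = 8 * C" by (simp add: power2_eq_square algebra_simps)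
    finally show ?thesis using C by (simp add: eq_divide_eq)
  qed
  ultimately show ?thesis using C by (simp add: mu_point_def C_def [symmetric])
qed

lemma ereal_integral_eq_integral:
  assumes "integrable M g" "AE x in M. f x = ereal (g x)" "f \<in> borel_measurable M"
  shows "ereal_integral M f = ereal (\<integral>x. g x \<partial>M)"
proof -
  have a: "(\<integral>\<^sup>+x. e2ennreal (f x) \<partial>M) = (\<integral>\<^sup>+x. ennreal (g x) \<partial>M)"
    using assms(2) by (intro nn_integral_cong_AE) (auto elim!: eventually_mono)
  have b: "(\<integral>\<^sup>+x. e2ennreal (- f x) \<partial>M) = (\<integral>\<^sup>+x. ennreal (- g x) \<partial>M)"
    using assms(2) by (intro nn_integral_cong_AE) (auto elim!: eventually_mono)
  have fin: "(\<integral>\<^sup>+x. ennreal (g x) \<partial>M) \<noteq> \<infinity>" "(\<integral>\<^sup>+x. ennreal (- g x) \<partial>M) \<noteq> \<infinity>"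
    using assms(1) by (auto simp: real_integrable_def)
  have "(\<integral>x. g x \<partial>M) = enn2real (\<integral>\<^sup>+x. ennreal (g x) \<partial>M) - enn2real (\<integral>\<^sup>+x. ennreal (- g x) \<partial>M)"
    by (rule real_lebesgue_integral_def [OF assms(1)])
  moreover have "enn2ereal y = ereal (enn2real y)" if "y \<noteq> \<infinity>" for y
    using that by (cases y) (auto simp: enn2ereal_ennreal)
  ultimately show ?thesis
    unfolding ereal_integral_def a b using fin by simp
qed

lemma log_recip_measurable [measurable]: "log_recip \<in> borel_measurable borel"
  unfolding log_recip_def by measurable

lemma log_potential_distr:
  assumes X [measurable]: "X \<in> borel_measurable borel"
    and nz: "AE x in unit_lebesgue. z - of_real (X x) \<noteq> 0"
    and int: "integrable unit_lebesgue (\<lambda>x. ln (cmod (z - of_real (X x))))"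
  shows "log_potential (distr unit_lebesgue borel (\<lambda>x. complex_of_real (X x))) z
    = ereal (- (\<integral>x. ln (cmod (z - of_real (X x))) \<partial>unit_lebesgue))"
proof -
  have [measurable]: "(\<lambda>x. complex_of_real (X x)) \<in> borel_measurable unit_lebesgue"
    by (intro measurable_unit_lebesgue) measurable
  have "log_potential (distr unit_lebesgue borel (\<lambda>x. complex_of_real (X x))) z
     = ereal_integral unit_lebesgue (\<lambda>x. log_recip (cmod (z - of_real (X x))))"
    unfolding log_potential_def ereal_integral_def by (simp add: nn_integral_distr)
  also have "\<dots> = ereal (\<integral>x. - ln (cmod (z - of_real (X x))) \<partial>unit_lebesgue)"
  proof (rule ereal_integral_eq_integral)
    show "AE x in unit_lebesgue. log_recip (cmod (z - of_real (X x))) = ereal (- ln (cmod (z - of_real (X x))))"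
      using nz by eventually_elim (simp add: log_recip_def ln_div)
  qed (use int in auto)
  finally show ?thesis by simp
qed

text \<open>
  With \<open>C\<close> the arcsine variable, \<open>z\<close> minus the random point is \<open>(C^2 + (4z - 2) C + 1) / (4C)\<close>, and
  \<open>ln (4C)\<close> has mean \<open>0\<close>. The quadratic is the one treated above for \<open>s = csqrt z\<close>; the principal
  root of \<open>z + s\<close> is the dominant branch since its imaginary part has the same sign as that of
  \<open>s\<close>.
\<close>

lemma mu_log_mean:
  fixes z :: complex
  shows "AE x in unit_lebesgue. z - of_real (mu_point x) \<noteq> 0"
    and "integrable unit_lebesgue (\<lambda>x. ln (cmod (z - of_real (mu_point x))))"
    and "(\<integral>x. ln (cmod (z - of_real (mu_point x))) \<partial>unit_lebesgue)
      = 2 * ln (cmod (1 + 2 * (csqrt z + csqrt (z + csqrt z)))) - 4 * ln 2"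
proof -
  define s where "s = csqrt z"
  define B where "B = 2 * csqrt (z + s)"
  define q where "q = (\<lambda>x. (complex_of_real (half_cos x))\<^sup>2 + (4 * s\<^sup>2 - 2) * of_real (half_cos x) + 1)"
  have s2: "s\<^sup>2 = z" by (simp add: s_def)
  have s0: "Re s \<ge> 0" unfolding s_def by (rule Re_csqrt)
  have B: "B\<^sup>2 = 4 * (s\<^sup>2 + s)" by (simp add: B_def power_mult_distrib s2)
  have "0 \<le> Im s * Im B"
  proof (cases "Im s \<ge> 0")
    case True
    have "Im (z + s) = Im s * (2 * Re s + 1)"
      unfolding s2 [symmetric] by (simp add: power2_eq_square algebra_simps)
    then have "Im (z + s) \<ge> 0" using True s0 by simp
    then show ?thesis using True Im_csqrt_sign(1) [of "z + s"] unfolding B_def by (intro mult_nonneg_nonneg) auto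
  next
    case False
    have "Im (z + s) = Im s * (2 * Re s + 1)"
      unfolding s2 [symmetric] by (simp add: power2_eq_square algebra_simps)
    then have "Im (z + s) < 0" using False s0 by (simp add: mult_neg_pos)
    then show ?thesis using False Im_csqrt_sign(2) [of "z + s"] unfolding B_def by (intro mult_nonpos_nonpos) auto
  qed
  moreover have "0 \<le> Re B" using Re_csqrt [of "z + s"] by (simp add: B_def)
  ultimately have "Re (1 + 2 * s) * Re B + Im (1 + 2 * s) * Im B \<ge> 0"
    using s0 by (auto intro!: add_nonneg_nonneg simp: mult.commute)
  then have dom: "cmod (1 + 2 * s - B) \<le> cmod (1 + 2 * s + B)" by (rule cmod_diff_le_sum)
  have Q: "AE x in unit_lebesgue. q x \<noteq> 0" "integrable unit_lebesgue (\<lambda>x. ln (cmod (q x)))"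
    "(\<integral>x. ln (cmod (q x)) \<partial>unit_lebesgue) = 2 * ln (cmod (1 + 2 * s + B)) - 4 * ln 2"
    unfolding q_def by (rule mean_ln_quadratic [OF s0 B dom])+
  have eq: "z - of_real (mu_point x) = q x / of_real (4 * half_cos x)" if "x \<in> space unit_lebesgue" for x
  proof -
    define C where "C = complex_of_real (half_cos x)"
    have C: "C \<noteq> 0" using half_cos_bounds [of x] that by (auto simp: C_def)
    have "complex_of_real (mu_point x) = - ((1 - C)\<^sup>2 / (4 * C))" by (simp add: mu_point_def C_def)
    moreover have "z + (1 - C)\<^sup>2 / (4 * C) = (C\<^sup>2 + (4 * z - 2) * C + 1) / (4 * C)"
    proof -
      have "(z + (1 - C)\<^sup>2 / (4 * C)) * (4 * C) = z * (4 * C) + (1 - C)\<^sup>2"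
        using C by (simp add: distrib_right)
      also have "\<dots> = C\<^sup>2 + (4 * z - 2) * C + 1" by (simp add: power2_eq_square algebra_simps)
      finally show ?thesis using C by (simp add: eq_divide_eq)
    qed
    ultimately show ?thesis by (simp add: q_def s2 C_def)
  qed
  show nz: "AE x in unit_lebesgue. z - of_real (mu_point x) \<noteq> 0"
    using Q(1) AE_space
  proof eventually_elim
    case (elim x)
    then show ?case unfolding eq [OF elim(2)] using half_cos_bounds [of x] by auto
  qed
  have ln: "AE x in unit_lebesgue. ln (cmod (z - of_real (mu_point x))) = ln (cmod (q x)) - (ln 4 + ln (half_cos x))"
    using Q(1) AE_space
  proof eventually_elim
    case (elim x)
    have "ln (cmod (q x / of_real (4 * half_cos x))) = ln (cmod (q x)) - ln (4 * half_cos x)"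
      using elim half_cos_bounds [of x] by (simp add: norm_divide ln_div norm_mult)
    then show ?case unfolding eq [OF elim(2)] using half_cos_bounds [of x] elim by (simp add: ln_mult)
  qed
  have int: "integrable unit_lebesgue (\<lambda>x. ln (cmod (q x)) - (ln 4 + ln (half_cos x)))"
    using Q(2) mean_ln_half_cos(1) by simp
  have [measurable]: "q \<in> borel_measurable borel" unfolding q_def by measurable
  show "integrable unit_lebesgue (\<lambda>x. ln (cmod (z - of_real (mu_point x))))"
    using integrable_cong_AE [THEN iffD2, OF _ _ ln int] by simp
  have "(\<integral>x. ln (cmod (z - of_real (mu_point x))) \<partial>unit_lebesgue)
      = (\<integral>x. ln (cmod (q x)) - (ln 4 + ln (half_cos x)) \<partial>unit_lebesgue)"
    using ln by (intro integral_cong_AE) auto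
  also have "\<dots> = 2 * ln (cmod (1 + 2 * s + B)) - 4 * ln 2"
    using Q mean_ln_half_cos by (simp add: unit_lebesgue.prob_space [simplified])
  finally show "(\<integral>x. ln (cmod (z - of_real (mu_point x))) \<partial>unit_lebesgue)
      = 2 * ln (cmod (1 + 2 * (csqrt z + csqrt (z + csqrt z)))) - 4 * ln 2"
    by (simp add: s_def B_def algebra_simps)
qed

text \<open>
  The expression whose modulus to the power \<open>-2\<close> is the weight.
\<close>

definition nu_function :: "complex \<Rightarrow> complex" where
  "nu_function z = csqrt (z + 1) + 2 * csqrt (z - 1) + 2 * csqrt (z - 1 + csqrt (z - 1) * csqrt (z + 1))"

text \<open>
  The denominator \<open>(1 + C)^2\<close> is common to the generic case and the case \<open>z = -1\<close> below, in which
  the numerator drops its degree.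
\<close>

lemma nu_log_mean_of_quadratic:
  assumes nz: "AE x in unit_lebesgue. q x \<noteq> (0::complex)" and [measurable]: "q \<in> borel_measurable borel"
    and int: "integrable unit_lebesgue (\<lambda>x. ln (cmod (q x)))"
    and eq: "\<And>x. 0 < x \<Longrightarrow> x < 1 \<Longrightarrow> z - of_real (nu_point x) = q x / of_real ((1 + half_cos x)\<^sup>2)"
  shows "AE x in unit_lebesgue. z - of_real (nu_point x) \<noteq> 0"
    and "integrable unit_lebesgue (\<lambda>x. ln (cmod (z - of_real (nu_point x))))"
    and "(\<integral>x. ln (cmod (z - of_real (nu_point x))) \<partial>unit_lebesgue)
      = (\<integral>x. ln (cmod (q x)) \<partial>unit_lebesgue) + 4 * ln 2 - 4 * ln (1 + sqrt 2)"
proof -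
  show "AE x in unit_lebesgue. z - of_real (nu_point x) \<noteq> 0"
    using nz AE_space
  proof eventually_elim
    case (elim x)
    then have x: "0 < x" "x < 1" by auto
    have "complex_of_real ((1 + half_cos x)\<^sup>2) \<noteq> 0"
      using half_cos_bounds [OF x] by (simp only: of_real_eq_0_iff) auto
    then show ?case using elim(1) unfolding eq [OF x] by simp
  qed
  have ln: "AE x in unit_lebesgue. ln (cmod (z - of_real (nu_point x))) = ln (cmod (q x)) - 2 * ln (1 + half_cos x)"
    using nz AE_space
  proof eventually_elim
    case (elim x)
    then have x: "0 < x" "x < 1" by auto
    have p: "1 + half_cos x > 0" using half_cos_bounds [OF x] by simp
    have "cmod (q x / of_real ((1 + half_cos x)\<^sup>2)) = cmod (q x) / (1 + half_cos x)\<^sup>2"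
      unfolding norm_divide norm_of_real by simp
    then show ?case using elim(1) p unfolding eq [OF x] by (simp add: ln_div ln_realpow)
  qed
  have int': "integrable unit_lebesgue (\<lambda>x. ln (cmod (q x)) - 2 * ln (1 + half_cos x))"
    using int mean_ln_one_plus_half_cos(1) by simp
  show "integrable unit_lebesgue (\<lambda>x. ln (cmod (z - of_real (nu_point x))))"
    using integrable_cong_AE [THEN iffD2, OF _ _ ln int'] by simp
  have "(\<integral>x. ln (cmod (z - of_real (nu_point x))) \<partial>unit_lebesgue)
      = (\<integral>x. ln (cmod (q x)) - 2 * ln (1 + half_cos x) \<partial>unit_lebesgue)"
    using ln by (intro integral_cong_AE) auto
  then show "(\<integral>x. ln (cmod (z - of_real (nu_point x))) \<partial>unit_lebesgue)
      = (\<integral>x. ln (cmod (q x)) \<partial>unit_lebesgue) + 4 * ln 2 - 4 * ln (1 + sqrt 2)"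
    using int mean_ln_one_plus_half_cos by simp
qed

text \<open>
  With \<open>w = (z - 1)/(z + 1)\<close>, \<open>z\<close> minus the random point is
  \<open>(z + 1) (C^2 + (4w - 2) C + 1) / (1 + C)^2\<close>. Dividing \<open>nu_function z\<close> by \<open>csqrt (z + 1)\<close> brings it
  into the form \<open>1 + 2s + B\<close> with \<open>s^2 = w\<close>. All principal roots that occur lie in one and the same
  closed quadrant, which settles both \<open>Re s \<ge> 0\<close> and the choice of the dominant branch, on the cuts
  as well as off them.
\<close>

lemma nu_log_mean:
  fixes z :: complex
  shows "AE x in unit_lebesgue. z - of_real (nu_point x) \<noteq> 0"
    and "integrable unit_lebesgue (\<lambda>x. ln (cmod (z - of_real (nu_point x))))"
    and "(\<integral>x. ln (cmod (z - of_real (nu_point x))) \<partial>unit_lebesgue)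
      = 2 * ln (cmod (nu_function z)) - 4 * ln (1 + sqrt 2)"
proof -
  have goal: "(AE x in unit_lebesgue. z - of_real (nu_point x) \<noteq> 0) \<and>
    integrable unit_lebesgue (\<lambda>x. ln (cmod (z - of_real (nu_point x)))) \<and>
    (\<integral>x. ln (cmod (z - of_real (nu_point x))) \<partial>unit_lebesgue)
      = 2 * ln (cmod (nu_function z)) - 4 * ln (1 + sqrt 2)"
  proof (cases "z = -1")
    case True
    define q where "q = (\<lambda>x. complex_of_real (- 8 * half_cos x))"
    have [measurable]: "q \<in> borel_measurable borel" unfolding q_def by measurable
    have qn: "q x \<noteq> 0" "ln (cmod (q x)) = ln 8 + ln (half_cos x)" if "x \<in> space unit_lebesgue" for x
      using half_cos_bounds [of x] that by (auto simp: q_def norm_mult ln_mult)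
    have nz: "AE x in unit_lebesgue. q x \<noteq> 0" by (rule AE_I2) (rule qn)
    have int: "integrable unit_lebesgue (\<lambda>x. ln (cmod (q x)))"
      using mean_ln_half_cos(1) by (subst Bochner_Integration.integrable_cong [OF refl qn(2)]) auto
    have eq: "z - of_real (nu_point x) = q x / of_real ((1 + half_cos x)\<^sup>2)" if "0 < x" "x < 1" for x
    proof -
      have "1 + half_cos x \<noteq> 0" using half_cos_bounds [OF that] by simp
      then have "(- 1 - nu_point x) * (1 + half_cos x)\<^sup>2 = 2 * (1 - half_cos x)\<^sup>2 - 2 * (1 + half_cos x)\<^sup>2"
        by (simp add: nu_point_def power_divide left_diff_distrib)
      also have "\<dots> = - 8 * half_cos x" by (simp add: power2_eq_square algebra_simps)
      finally have "- 1 - nu_point x = - 8 * half_cos x / (1 + half_cos x)\<^sup>2"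
        using \<open>1 + half_cos x \<noteq> 0\<close> by (metis nonzero_eq_divide_eq power_not_zero)
      then show ?thesis unfolding True q_def by (metis of_real_1 of_real_diff of_real_divide of_real_minus)
    qed
    have "(\<integral>x. ln (cmod (q x)) \<partial>unit_lebesgue) = (\<integral>x. ln 8 + ln (half_cos x) \<partial>unit_lebesgue)"
      by (intro Bochner_Integration.integral_cong refl qn(2))
    also have "\<dots> = ln 8 - ln 4"
      using mean_ln_half_cos by (simp add: unit_lebesgue.prob_space [simplified])
    also have "\<dots> = ln 2" using ln_realpow [of 2 3] ln_realpow [of 2 2] by simp
    finally have Iq: "(\<integral>x. ln (cmod (q x)) \<partial>unit_lebesgue) = ln 2" .
    have "cmod (nu_function z) = 4 * cmod (csqrt (-2))" unfolding True nu_function_def by (simp add: norm_mult)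
    also have "cmod (csqrt (-2)) = sqrt 2" by (simp add: norm_mult)
    finally have "2 * ln (cmod (nu_function z)) = 5 * ln 2"
      using ln_realpow [of 2 2] by (simp add: ln_mult ln_sqrt)
    then show ?thesis
      using nu_log_mean_of_quadratic [OF nz _ int eq] Iq by simp
  next
    case False
    define c where "c = csqrt (z + 1)"
    define d where "d = csqrt (z - 1)"
    define E where "E = csqrt (z - 1 + d * c)"
    have c0: "c \<noteq> 0" using False by (simp add: c_def add_eq_0_iff2)
    have c2: "c\<^sup>2 = z + 1" and d2: "d\<^sup>2 = z - 1" and E2: "E\<^sup>2 = z - 1 + d * c"
      by (simp_all add: c_def d_def E_def)
    have Re0: "Re c \<ge> 0" "Re d \<ge> 0" "Re E \<ge> 0"
      unfolding c_def d_def E_def by (rule Re_csqrt)+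
    have sign: "(Im c \<ge> 0 \<and> Im d \<ge> 0 \<and> Im E \<ge> 0) \<or> (Im c \<le> 0 \<and> Im d \<le> 0 \<and> Im E \<le> 0)"
    proof (cases "Im z \<ge> 0")
      case True
      then have "Im c \<ge> 0" "Im d \<ge> 0" unfolding c_def d_def by (auto intro!: Im_csqrt_sign(1) simp del: csqrt.sel)
      moreover from this have "Im (z - 1 + d * c) \<ge> 0"
        using True Re0 by (auto intro!: add_nonneg_nonneg)
      ultimately show ?thesis unfolding E_def by (auto intro!: Im_csqrt_sign(1) simp del: csqrt.sel)
    next
      case False
      then have "Im c \<le> 0" "Im d \<le> 0" unfolding c_def d_def by (auto intro!: Im_csqrt_sign(2) simp del: csqrt.sel)
      moreover from this have "Re d * Im c \<le> 0" "Im d * Re c \<le> 0"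
        using Re0 by (auto simp: mult_nonneg_nonpos mult_nonpos_nonneg)
      then have "Im (z - 1 + d * c) < 0" using False by simp
      ultimately show ?thesis unfolding E_def by (auto intro!: Im_csqrt_sign(2) simp del: csqrt.sel)
    qed
    define s where "s = d / c"
    define B where "B = 2 * E / c"
    define q0 where "q0 = (\<lambda>x. (complex_of_real (half_cos x))\<^sup>2 + (4 * s\<^sup>2 - 2) * of_real (half_cos x) + 1)"
    define q where "q = (\<lambda>x. (z + 1) * q0 x)"
    have s2: "s\<^sup>2 = (z - 1) / (z + 1)" by (simp add: s_def power_divide c2 d2)
    have "Im d * Im c \<ge> 0" "Im (c + 2 * d) * Im (2 * E) \<ge> 0"
      using sign by (auto intro: mult_nonneg_nonneg mult_nonpos_nonpos)
    moreover have "Re d * Re c \<ge> 0" "Re (c + 2 * d) * Re (2 * E) \<ge> 0"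
      using Re0 by (auto intro: mult_nonneg_nonneg)
    ultimately have "Re d * Re c + Im d * Im c \<ge> 0"
      and same: "Re (c + 2 * d) * Re (2 * E) + Im (c + 2 * d) * Im (2 * E) \<ge> 0"
      by (blast intro: add_nonneg_nonneg)+
    from this(1) have s0: "Re s \<ge> 0" unfolding s_def by (simp add: Re_divide)
    have B: "B\<^sup>2 = 4 * (s\<^sup>2 + s)"
    proof -
      have "B\<^sup>2 = 4 * (d\<^sup>2 + d * c) / c\<^sup>2" by (simp add: B_def power_divide power_mult_distrib E2 d2)
      also have "\<dots> = 4 * (s\<^sup>2 + s)" using c0 by (simp add: s_def power_divide field_simps power2_eq_square)
      finally show ?thesis .
    qed
    have scale: "1 + 2 * s + B = (c + 2 * d + 2 * E) / c" "1 + 2 * s - B = (c + 2 * d - 2 * E) / c"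
      using c0 by (simp_all add: s_def B_def field_simps)
    have "cmod (c + 2 * d - 2 * E) \<le> cmod (c + 2 * d + 2 * E)"
      using same by (rule cmod_diff_le_sum)
    then have dom: "cmod (1 + 2 * s - B) \<le> cmod (1 + 2 * s + B)"
      unfolding scale norm_divide by (intro divide_right_mono) auto
    have Q: "AE x in unit_lebesgue. q0 x \<noteq> 0" "integrable unit_lebesgue (\<lambda>x. ln (cmod (q0 x)))"
      "(\<integral>x. ln (cmod (q0 x)) \<partial>unit_lebesgue) = 2 * ln (cmod (1 + 2 * s + B)) - 4 * ln 2"
      unfolding q0_def by (rule mean_ln_quadratic [OF s0 B dom])+
    have [measurable]: "q0 \<in> borel_measurable borel" unfolding q0_def by measurable
    have [measurable]: "q \<in> borel_measurable borel" unfolding q_def by measurable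
    have z1: "z + 1 \<noteq> 0" using False by (simp add: add_eq_0_iff2)
    have nz: "AE x in unit_lebesgue. q x \<noteq> 0" using Q(1) by eventually_elim (use z1 in \<open>simp add: q_def\<close>)
    have lnq: "AE x in unit_lebesgue. ln (cmod (q x)) = ln (cmod (z + 1)) + ln (cmod (q0 x))"
      using Q(1) by eventually_elim (use z1 in \<open>simp add: q_def norm_mult ln_mult\<close>)
    have int': "integrable unit_lebesgue (\<lambda>x. ln (cmod (z + 1)) + ln (cmod (q0 x)))"
      using Q(2) by simp
    have int: "integrable unit_lebesgue (\<lambda>x. ln (cmod (q x)))"
      using integrable_cong_AE [THEN iffD2, OF _ _ lnq int'] by simp
    have "(\<integral>x. ln (cmod (q x)) \<partial>unit_lebesgue) = (\<integral>x. ln (cmod (z + 1)) + ln (cmod (q0 x)) \<partial>unit_lebesgue)"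
      using lnq by (intro integral_cong_AE) auto
    also have "\<dots> = ln (cmod (z + 1)) + (2 * ln (cmod (1 + 2 * s + B)) - 4 * ln 2)"
      using Q by (simp add: unit_lebesgue.prob_space [simplified])
    finally have Iq: "(\<integral>x. ln (cmod (q x)) \<partial>unit_lebesgue)
        = ln (cmod (z + 1)) + (2 * ln (cmod (1 + 2 * s + B)) - 4 * ln 2)" .
    have f: "nu_function z = c + 2 * d + 2 * E" by (simp add: nu_function_def c_def d_def E_def)
    have f0: "nu_function z \<noteq> 0"
    proof
      assume "nu_function z = 0"
      then have "1 + 2 * s + B = 0" "1 + 2 * s - B = 0"
        using dom unfolding scale f by auto
      then have "(1 + 2 * s)\<^sup>2 - B\<^sup>2 = 0" by algebra
      then show False unfolding B by (simp add: power2_eq_square algebra_simps)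
    qed
    have "ln (cmod (z + 1)) = 2 * ln (cmod c)"
      unfolding c2 [symmetric] using c0 by (simp add: norm_power ln_realpow)
    moreover have "ln (cmod (1 + 2 * s + B)) = ln (cmod (nu_function z)) - ln (cmod c)"
      unfolding scale f [symmetric] using c0 f0 by (simp add: norm_divide ln_div)
    ultimately have Iq': "(\<integral>x. ln (cmod (q x)) \<partial>unit_lebesgue) = 2 * ln (cmod (nu_function z)) - 4 * ln 2"
      using Iq by simp
    have eq: "z - of_real (nu_point x) = q x / of_real ((1 + half_cos x)\<^sup>2)" if "0 < x" "x < 1" for x
    proof -
      define C where "C = complex_of_real (half_cos x)"
      have "1 + half_cos x \<noteq> 0" using half_cos_bounds [OF that] by simp
      then have C: "1 + C \<noteq> 0" unfolding C_def by (metis of_real_1 of_real_add of_real_eq_0_iff)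
      have "q x = (z + 1) * (C\<^sup>2 + 1) + (4 * (z - 1) - 2 * (z + 1)) * C"
        unfolding q_def q0_def s2 C_def [symmetric] using z1 by (simp add: field_simps)
      moreover have "(z - (1 - 2 * ((1 - C) / (1 + C))\<^sup>2)) * (1 + C)\<^sup>2 = (z - 1) * (1 + C)\<^sup>2 + 2 * (1 - C)\<^sup>2"
        using C by (simp add: power_divide left_diff_distrib)
      moreover have "(z - 1) * (1 + C)\<^sup>2 + 2 * (1 - C)\<^sup>2 = (z + 1) * (C\<^sup>2 + 1) + (4 * (z - 1) - 2 * (z + 1)) * C"
        by algebra
      moreover have "complex_of_real (nu_point x) = 1 - 2 * ((1 - C) / (1 + C))\<^sup>2"
        by (simp add: nu_point_def C_def)
      moreover have "complex_of_real ((1 + half_cos x)\<^sup>2) = (1 + C)\<^sup>2" by (simp add: C_def)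
      ultimately show ?thesis using C by (simp add: eq_divide_eq)
    qed
    show ?thesis
      using nu_log_mean_of_quadratic [OF nz _ int eq] Iq' by simp
  qed
  then show "AE x in unit_lebesgue. z - of_real (nu_point x) \<noteq> 0"
    and "integrable unit_lebesgue (\<lambda>x. ln (cmod (z - of_real (nu_point x))))"
    and "(\<integral>x. ln (cmod (z - of_real (nu_point x))) \<partial>unit_lebesgue)
      = 2 * ln (cmod (nu_function z)) - 4 * ln (1 + sqrt 2)" by auto
qed

section \<open>Densities of push-forward measures\<close>

lemma measurable_complex_of_real_restrict:
  assumes "A \<in> sets borel"
  shows "complex_of_real \<in> measurable (restrict_space lborel A) borel"
  by (intro measurable_restrict_space1) simp

lemma nn_integral_lebesgue_on_reals:
  assumes [measurable]: "A \<in> sets borel" "f \<in> borel_measurable borel"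
  shows "(\<integral>\<^sup>+z. f z \<partial>lebesgue_on_reals A) = (\<integral>\<^sup>+x. f (complex_of_real x) * indicator A x \<partial>lborel)"
  unfolding lebesgue_on_reals_def
  by (subst nn_integral_distr [OF measurable_complex_of_real_restrict])
    (auto simp: nn_integral_restrict_space)

lemma sets_lebesgue_on_reals [simp]: "sets (lebesgue_on_reals A) = sets borel"
  and space_lebesgue_on_reals [simp]: "space (lebesgue_on_reals A) = UNIV"
  by (simp_all add: lebesgue_on_reals_def)

lemma borel_measurable_lebesgue_on_reals [measurable (raw)]:
  "f \<in> measurable borel N \<Longrightarrow> f \<in> measurable (lebesgue_on_reals A) N"
  by (simp cong: measurable_cong_sets)

lemma sigma_finite_lebesgue_on_reals:
  assumes [measurable]: "A \<in> sets borel"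
  shows "sigma_finite_measure (lebesgue_on_reals A)"
proof
  let ?F = "range (\<lambda>n::nat. cball (0::complex) (real n))"
  have "emeasure (lebesgue_on_reals A) (cball 0 (real n)) \<noteq> \<infinity>" for n :: nat
  proof -
    have "emeasure (lebesgue_on_reals A) (cball 0 (real n)) = (\<integral>\<^sup>+z. indicator (cball 0 (real n)) z \<partial>lebesgue_on_reals A)"
      by (subst nn_integral_indicator) auto
    also have "\<dots> \<le> (\<integral>\<^sup>+x. indicator {- real n..real n} x \<partial>lborel)"
    proof (subst nn_integral_lebesgue_on_reals)
      show "(\<integral>\<^sup>+x. indicator (cball 0 (real n)) (complex_of_real x) * indicator A x \<partial>lborel)
          \<le> (\<integral>\<^sup>+x. indicator {- real n..real n} x \<partial>lborel)"
        by (intro nn_integral_mono) (auto simp: indicator_def)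
    qed (auto intro!: borel_measurable_indicator)
    also have "\<dots> < \<infinity>" by simp
    finally show ?thesis by simp
  qed
  moreover have "\<Union>?F = UNIV"
    using real_arch_simple by (force simp: dist_norm)
  ultimately show "\<exists>F. countable F \<and> F \<subseteq> sets (lebesgue_on_reals A) \<and> \<Union>F = space (lebesgue_on_reals A) \<and>
      (\<forall>a\<in>F. emeasure (lebesgue_on_reals A) a \<noteq> \<infinity>)"
    by (intro exI [of _ ?F]) auto
qed

text \<open>
  The change of variables formula is applied to \<open>\<rho>\<close> times the indicator of a Borel set, whose
  pull-back is a bounded function. Working on the open interval avoids the endpoints, where the
  derivative of the map or of its inverse is infinite or zero.
\<close>

lemma pushforward_density:
  assumes g [measurable]: "g \<in> borel_measurable borel"
    and der: "\<And>x. 0 < x \<Longrightarrow> x < 1 \<Longrightarrow> (g has_real_derivative g' x) (at x)"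
    and inj: "inj_on g {0<..<1}" and im: "g ` {0<..<1} = I"
    and A [measurable]: "A \<in> sets borel" and IA: "I \<subseteq> A" "AE x in lborel. x \<in> A \<longrightarrow> x \<in> I"
    and \<rho> [measurable]: "\<rho> \<in> borel_measurable borel" and \<rho>0: "\<And>x. \<rho> x \<ge> 0"
    and jac: "\<And>x. 0 < x \<Longrightarrow> x < 1 \<Longrightarrow> \<bar>g' x\<bar> * \<rho> (g x) = 1"
  shows "distr unit_lebesgue borel (\<lambda>x. complex_of_real (g x))
    = density (lebesgue_on_reals A) (\<lambda>z. ennreal (\<rho> (Re z)))"
proof (rule measure_eqI)
  fix B assume "B \<in> sets (distr unit_lebesgue borel (\<lambda>x. complex_of_real (g x)))"
  then have B [measurable]: "B \<in> sets borel" by simp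
  define S where "S = {0<..<1::real}"
  define h where "h = (\<lambda>x. indicator B (complex_of_real (g x)) :: real)"
  define f where "f = (\<lambda>t. \<rho> t * indicator B (complex_of_real t))"
  have [measurable]: "h \<in> borel_measurable borel" unfolding h_def by measurable
  have "integrable lborel (\<lambda>x. indicator S x *\<^sub>R h x)"
  proof (rule integrableI_bounded_set [where A = S and B = 1])
    show "AE x in lborel. x \<in> S \<longrightarrow> norm (indicator S x *\<^sub>R h x) \<le> 1"
      by (auto simp: h_def indicator_def)
  qed (auto simp: S_def)
  then have "set_integrable lebesgue S h"
    unfolding set_integrable_def by (intro integrable_completion [THEN iffD2]) (auto simp: S_def)
  then have hint: "h absolutely_integrable_on S" .
  define b where "b = integral S h"
  have pull: "\<bar>g' x\<bar> * f (g x) = h x" if "x \<in> S" for x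
    using jac [of x] that by (simp add: S_def h_def f_def mult.assoc [symmetric])
  have "(\<lambda>x. \<bar>g' x\<bar> * f (g x)) absolutely_integrable_on S"
    using hint unfolding set_integrable_def
    by (rule Bochner_Integration.integrable_cong [THEN iffD1, OF refl, rotated])
      (auto simp: indicator_def pull)
  moreover have "integral S (\<lambda>x. \<bar>g' x\<bar> * f (g x)) = b"
    unfolding b_def by (intro Henstock_Kurzweil_Integration.integral_cong pull)
  ultimately have "f absolutely_integrable_on (g ` S) \<and> integral (g ` S) f = b"
    by (intro has_absolute_integral_change_of_variables_1' [THEN iffD1])
      (auto simp: S_def intro: inj has_field_derivative_at_within der)
  then have f: "(f has_integral b) I"
    using im by (auto simp: S_def has_integral_iff dest: set_lebesgue_integral_eq_integral(1))
  have h: "(h has_integral b) S"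
    using hint by (auto simp: b_def has_integral_iff dest: set_lebesgue_integral_eq_integral(1))
  have "emeasure (distr unit_lebesgue borel (\<lambda>x. complex_of_real (g x))) B
      = (\<integral>\<^sup>+z. indicator B z \<partial>distr unit_lebesgue borel (\<lambda>x. complex_of_real (g x)))"
    by (subst nn_integral_indicator) auto
  also have "\<dots> = (\<integral>\<^sup>+x. indicator B (complex_of_real (g x)) \<partial>unit_lebesgue)"
    by (subst nn_integral_distr) auto
  also have "\<dots> = (\<integral>\<^sup>+x. ennreal (h x) * indicator S x \<partial>lborel)"
    unfolding nn_integral_unit_lebesgue by (intro nn_integral_cong) (auto simp: h_def S_def indicator_def)
  also have "\<dots> = ennreal b"
    by (rule nn_integral_has_integral_lebesgue' [OF _ h]) (simp add: h_def)
  also have "\<dots> = (\<integral>\<^sup>+t. ennreal (f t) * indicator I t \<partial>lborel)"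
    by (rule nn_integral_has_integral_lebesgue' [OF _ f, symmetric]) (simp add: f_def \<rho>0)
  also have "\<dots> = (\<integral>\<^sup>+t. (ennreal (\<rho> t) * indicator B (complex_of_real t)) * indicator A t \<partial>lborel)"
    using IA(2)
    by (intro nn_integral_cong_AE) (elim eventually_mono, use IA(1) in \<open>auto simp: f_def indicator_def\<close>)
  also have "\<dots> = (\<integral>\<^sup>+z. ennreal (\<rho> (Re z)) * indicator B z \<partial>lebesgue_on_reals A)"
    by (subst nn_integral_lebesgue_on_reals) auto
  also have "\<dots> = emeasure (density (lebesgue_on_reals A) (\<lambda>z. ennreal (\<rho> (Re z)))) B"
    by (subst emeasure_density) auto
  finally show "emeasure (distr unit_lebesgue borel (\<lambda>x. complex_of_real (g x))) B
      = emeasure (density (lebesgue_on_reals A) (\<lambda>z. ennreal (\<rho> (Re z)))) B" .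
qed simp

lemma density_RN_deriv_lebesgue_on_reals:
  assumes A [measurable]: "A \<in> sets borel" and [measurable]: "\<rho> \<in> borel_measurable borel"
    and M: "M = density (lebesgue_on_reals A) (\<lambda>z. ennreal (\<rho> (Re z)))"
  shows "absolutely_continuous (lebesgue_on_reals A) M"
    and "AE x in lborel. x \<in> A \<longrightarrow> RN_deriv (lebesgue_on_reals A) M (complex_of_real x) = ennreal (\<rho> x)"
proof -
  have meas: "(\<lambda>z. ennreal (\<rho> (Re z))) \<in> borel_measurable (lebesgue_on_reals A)"
    by measurable
  show "absolutely_continuous (lebesgue_on_reals A) M"
    unfolding M by (rule absolutely_continuousI_density [OF meas])
  have "AE z in lebesgue_on_reals A. ennreal (\<rho> (Re z)) = RN_deriv (lebesgue_on_reals A) M z"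
    by (rule sigma_finite_measure.RN_deriv_unique [OF sigma_finite_lebesgue_on_reals [OF A] meas M [symmetric]])
  then have "AE x in restrict_space lborel A.
      ennreal (\<rho> (Re (complex_of_real x))) = RN_deriv (lebesgue_on_reals A) M (complex_of_real x)"
    by (subst (asm) lebesgue_on_reals_def)
      (rule AE_distrD [OF measurable_complex_of_real_restrict [OF A]])
  then show "AE x in lborel. x \<in> A \<longrightarrow> RN_deriv (lebesgue_on_reals A) M (complex_of_real x) = ennreal (\<rho> x)"
    by (subst (asm) AE_restrict_space_iff) (auto elim!: eventually_mono)
qed

section \<open>Densities of the limit measures\<close>

lemma half_cos_deriv [derivative_intros]:
  "(half_cos has_real_derivative - (pi * sin (pi * x) / 2)) (at x)"
  unfolding half_cos_def by (auto intro!: derivative_eq_intros)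

lemma sin_half_cos: "(sin (pi * x))\<^sup>2 = 4 * half_cos x * (1 - half_cos x)"
proof -
  have "4 * half_cos x * (1 - half_cos x) = 1 - (cos (pi * x))\<^sup>2"
    by (simp add: half_cos_def power2_eq_square field_simps)
  then show ?thesis using sin_cos_squared_add [of "pi * x"] by linarith
qed

lemma sin_power4_half_cos: "(sin (pi * x)) ^ 4 = 16 * (half_cos x)\<^sup>2 * (1 - half_cos x)\<^sup>2"
proof -
  have "(sin (pi * x)) ^ 4 = ((sin (pi * x))\<^sup>2)\<^sup>2" by (simp add: power_mult [symmetric])
  then show ?thesis unfolding sin_half_cos by (simp add: power_mult_distrib)
qed

lemma half_cos_inj:
  assumes "0 < x" "x < 1" "0 < y" "y < 1" "half_cos x = half_cos y"
  shows "x = y"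
proof -
  have "cos (pi * x) = cos (pi * y)" using assms(5) by (simp add: half_cos_def)
  moreover have "pi * x \<le> pi * 1" "pi * y \<le> pi * 1"
    using assms by (intro mult_left_mono; simp)+
  ultimately have "pi * x = pi * y"
    using assms cos_inj_pi [of "pi * x" "pi * y"] by simp
  then show ?thesis by simp
qed

lemma half_cos_surj:
  assumes "0 < C" "C < 1"
  obtains x where "0 < x" "x < 1" "half_cos x = C"
proof
  have "-1 < 2 * C - 1" "2 * C - 1 < 1" using assms by auto
  then have "0 < arccos (2 * C - 1)" "arccos (2 * C - 1) < pi"
    using arccos_lt_bounded by auto
  then show "0 < arccos (2 * C - 1) / pi" "arccos (2 * C - 1) / pi < 1" by auto
  show "half_cos (arccos (2 * C - 1) / pi) = C"
    using assms by (simp add: half_cos_def)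
qed

lemma nu_point_inj: "inj_on nu_point {0<..<1}"
proof (rule inj_onI)
  fix x y assume xy: "x \<in> {0<..<1}" "y \<in> {0<..<1}" "nu_point x = nu_point y"
  have C: "0 < half_cos x" "half_cos x < 1" "0 < half_cos y" "half_cos y < 1"
    using half_cos_bounds xy by auto
  have "((1 - half_cos x) / (1 + half_cos x))\<^sup>2 = ((1 - half_cos y) / (1 + half_cos y))\<^sup>2"
    using xy(3) by (simp add: nu_point_def)
  then have "(1 - half_cos x) / (1 + half_cos x) = (1 - half_cos y) / (1 + half_cos y)"
    by (rule power2_eq_imp_eq) (use C in auto)
  then have "(1 - half_cos x) * (1 + half_cos y) = (1 - half_cos y) * (1 + half_cos x)"
    using C by (simp add: frac_eq_eq)
  then have "2 * (half_cos x - half_cos y) = 0" by algebra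
  then have "half_cos x = half_cos y" by simp
  then show "x = y" using xy half_cos_inj [of x y] by simp
qed

lemma nu_point_image: "nu_point ` {0<..<1} = {-1<..<1}"
proof (intro set_eqI iffI)
  fix y assume "y \<in> nu_point ` {0<..<1}"
  then show "y \<in> {-1<..<1}" using nu_point_bounds by auto
next
  fix y :: real assume y: "y \<in> {-1<..<1}"
  \<comment> \<open>Solves \<open>y = 1 - 2 k^2\<close>; then \<open>C\<close> is chosen with \<open>(1 - C)/(1 + C) = k\<close>.\<close>
  define k where "k = sqrt ((1 - y) / 2)"
  have k: "0 < k" "k < 1" using y by (auto simp: k_def)
  define C where "C = (1 - k) / (1 + k)"
  have C: "0 < C" "C < 1" using k by (auto simp: C_def)
  obtain x where x: "0 < x" "x < 1" "half_cos x = C" using half_cos_surj [OF C] .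
  have "1 - C = 2 * k / (1 + k)" "1 + C = 2 / (1 + k)" using k by (auto simp: C_def field_simps)
  then have "(1 - C) / (1 + C) = k" using k by simp
  then have "nu_point x = 1 - 2 * k\<^sup>2" by (simp add: nu_point_def x)
  also have "k\<^sup>2 = (1 - y) / 2" using y by (simp add: k_def)
  also have "1 - 2 * ((1 - y) / 2) = y" by (simp add: field_simps)
  finally show "y \<in> nu_point ` {0<..<1}" using x by auto
qed

text \<open>
  The two random points determine each other through the Moebius map.
\<close>

lemma mu_point_inj: "inj_on mu_point {0<..<1}"
proof (rule inj_onI)
  fix x y assume xy: "x \<in> {0<..<1}" "y \<in> {0<..<1}" "mu_point x = mu_point y"
  have "nu_point z = to_unit_interval (mu_point z)" if "z \<in> {0<..<1}" for z
  proof -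
    have z: "0 < z" "z < 1" using that by auto
    have "nu_point z + 1 > 0" using nu_point_bounds [OF z] by simp
    then show ?thesis unfolding mu_point_eq [OF z] by (simp add: to_unit_interval_def field_simps)
  qed
  then have "nu_point x = nu_point y" using xy by metis
  then show "x = y" using nu_point_inj xy by (auto dest: inj_onD)
qed

lemma mu_point_image: "mu_point ` {0<..<1} = {..<0}"
proof (intro set_eqI iffI)
  fix y assume "y \<in> mu_point ` {0<..<1}"
  then show "y \<in> {..<0}" using mu_point_neg by auto
next
  fix y :: real assume "y \<in> {..<0}"
  then have y: "y < 0" by simp
  then have "to_unit_interval y \<in> nu_point ` {0<..<1}"
    unfolding nu_point_image using to_unit_interval_bounds by auto
  then obtain x where x: "0 < x" "x < 1" "nu_point x = to_unit_interval y" by auto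
  then have "mu_point x = y" using to_unit_interval_inverse [OF y] by (simp add: mu_point_eq)
  then show "y \<in> mu_point ` {0<..<1}" using x by auto
qed

lemma powr_quarters:
  fixes y :: real
  assumes "y > 0"
  shows "(y powr (3 / 4)) ^ 4 = y ^ 3" "(y powr (1 / 2)) ^ 4 = y ^ 2"
  using assms by (simp_all add: powr_power)

definition nu_density :: "real \<Rightarrow> real" where
  "nu_density x = 1 / (pi * sqrt (1 + x) * (1 - x) powr (3 / 4) * (sqrt 2 + sqrt (1 - x)) powr (1 / 2))"

definition mu_density :: "real \<Rightarrow> real" where
  "mu_density x = 1 / (sqrt 2 * pi * \<bar>x\<bar> powr (3 / 4) * (1 + \<bar>x\<bar>) powr (1 / 2)
     * (sqrt \<bar>x\<bar> + sqrt (1 + \<bar>x\<bar>)) powr (1 / 2))"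

text \<open>
  The Jacobian identity is verified after taking fourth powers, where all fractional exponents
  disappear. The absolute value makes the density nonnegative outside the interval too.
\<close>

lemma nu_measure_density:
  "nu_measure = density (lebesgue_on_reals {-1..1}) (\<lambda>z. ennreal (\<bar>nu_density (Re z)\<bar>))"
  unfolding nu_measure_def
proof (rule pushforward_density [OF _ _ nu_point_inj nu_point_image])
  show "AE x in lborel. x \<in> {-1..1::real} \<longrightarrow> x \<in> {-1<..<1}"
    using AE_lborel_singleton [of 1] AE_lborel_singleton [of "-1"] by eventually_elim auto
  show "(\<lambda>x. \<bar>nu_density x\<bar>) \<in> borel_measurable borel" unfolding nu_density_def by measurable
next
  fix x :: real assume x: "0 < x" "x < 1"
  define C where "C = half_cos x"
  define k where "k = (1 - C) / (1 + C)"
  define g' where "g' = (\<lambda>x. - (4 * pi * ((1 - half_cos x) / (1 + half_cos x)) * sin (pi * x) / (1 + half_cos x)\<^sup>2))"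
  have C: "0 < C" "C < 1" unfolding C_def using half_cos_bounds [OF x] by auto
  show "(nu_point has_real_derivative g' x) (at x)"
    unfolding nu_point_def g'_def using C
    by (auto intro!: derivative_eq_intros simp: C_def [symmetric])
      (simp add: field_simps power2_eq_square)
  have k: "0 < k" using C by (auto simp: k_def)
  have X: "1 - nu_point x = 2 * k\<^sup>2" by (simp add: nu_point_def k_def C_def)
  have X': "1 + nu_point x = 8 * C / (1 + C)\<^sup>2"
  proof -
    have "(1 + nu_point x) * (1 + C)\<^sup>2 = 2 * (1 + C)\<^sup>2 - 2 * (1 - C)\<^sup>2"
      using C by (simp add: nu_point_def C_def [symmetric] power_divide distrib_right left_diff_distrib)
    also have "\<dots> = 8 * C" by (simp add: power2_eq_square algebra_simps)
    finally show ?thesis using C by (simp add: eq_divide_eq)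
  qed
  have sq: "sqrt (1 - nu_point x) = sqrt 2 * k" unfolding X using k by (simp add: real_sqrt_mult)
  define D where "D = pi * sqrt (1 + nu_point x) * (1 - nu_point x) powr (3 / 4)
     * (sqrt 2 + sqrt (1 - nu_point x)) powr (1 / 2)"
  have pos: "1 + nu_point x > 0" "1 - nu_point x > 0" "sqrt 2 + sqrt (1 - nu_point x) > 0"
    using nu_point_bounds [OF x] by (auto intro: add_pos_nonneg)
  have D0: "D > 0" unfolding D_def using pos by (intro mult_pos_pos) auto
  have sin0: "sin (pi * x) > 0" using x by (intro sin_gt_zero) auto
  note sin4 = sin_power4_half_cos [of x, folded C_def]
  have g0: "\<bar>g' x\<bar> = 4 * pi * k * sin (pi * x) / (1 + C)\<^sup>2"
    unfolding g'_def C_def [symmetric] k_def [symmetric] using k C sin0 by (simp add: abs_mult)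
  have sqrt4: "(sqrt y) ^ 4 = y\<^sup>2" if "y \<ge> 0" for y :: real
  proof -
    have "(sqrt y) ^ 4 = ((sqrt y)\<^sup>2)\<^sup>2" by (simp add: power_mult [symmetric])
    then show ?thesis using that by simp
  qed
  have "D ^ 4 = pi ^ 4 * (1 + nu_point x)\<^sup>2 * (1 - nu_point x) ^ 3 * (sqrt 2 + sqrt (1 - nu_point x))\<^sup>2"
    unfolding D_def power_mult_distrib using pos by (simp add: powr_quarters sqrt4)
  also have "\<dots> = pi ^ 4 * (8 * C / (1 + C)\<^sup>2)\<^sup>2 * (2 * k\<^sup>2) ^ 3 * (2 * (1 + k)\<^sup>2)"
  proof -
    have "(sqrt 2 + sqrt 2 * k)\<^sup>2 = (sqrt 2 * (1 + k))\<^sup>2" by (simp add: distrib_left)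
    then show ?thesis unfolding sq unfolding X X' by (simp add: power_mult_distrib)
  qed
  also have "\<dots> = (4 * pi * k * sin (pi * x) / (1 + C)\<^sup>2) ^ 4"
  proof -
    define b where "b = 1 + C"
    have b: "b \<noteq> 0" using C by (simp add: b_def)
    have k1: "1 + k = 2 / b" using C by (simp add: k_def b_def field_simps)
    have "1 - C = k * b" using C by (simp add: k_def b_def)
    then have kk: "(1 - C)\<^sup>2 = k\<^sup>2 * b\<^sup>2" by (simp add: power_mult_distrib)
    show ?thesis
      unfolding k1 power_mult_distrib power_divide sin4 kk b_def [symmetric]
      using b by (simp add: field_simps eval_nat_numeral)
  qed
  finally have "D ^ 4 = \<bar>g' x\<bar> ^ 4" unfolding g0 .
  then have "D = \<bar>g' x\<bar>" using D0 by (intro power_eq_imp_eq_base [of D 4]) auto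
  then show "\<bar>g' x\<bar> * \<bar>nu_density (nu_point x)\<bar> = 1"
    unfolding nu_density_def D_def [symmetric] using D0 by simp
qed auto

lemma mu_measure_density:
  "mu_measure = density (lebesgue_on_reals {..0}) (\<lambda>z. ennreal (\<bar>mu_density (Re z)\<bar>))"
  unfolding mu_measure_def
proof (rule pushforward_density [OF _ _ mu_point_inj mu_point_image])
  show "AE x in lborel. x \<in> {..0::real} \<longrightarrow> x \<in> {..<0}"
    using AE_lborel_singleton [of 0] by eventually_elim auto
  show "(\<lambda>x. \<bar>mu_density x\<bar>) \<in> borel_measurable borel" unfolding mu_density_def by measurable
next
  fix x :: real assume x: "0 < x" "x < 1"
  define C where "C = half_cos x"
  define g' where "g' = (\<lambda>x. - (pi * (1 - (half_cos x)\<^sup>2) * sin (pi * x) / (8 * (half_cos x)\<^sup>2)))"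
  have C: "0 < C" "C < 1" unfolding C_def using half_cos_bounds [OF x] by auto
  show "(mu_point has_real_derivative g' x) (at x)"
    unfolding mu_point_def g'_def using C
    by (auto intro!: derivative_eq_intros simp: C_def [symmetric])
      (simp add: field_simps power2_eq_square)
  have T: "\<bar>mu_point x\<bar> = ((1 - C) / (2 * sqrt C))\<^sup>2"
    using C by (simp add: mu_point_def C_def [symmetric] power_divide power_mult_distrib abs_mult)
  have T': "1 + \<bar>mu_point x\<bar> = ((1 + C) / (2 * sqrt C))\<^sup>2"
  proof -
    have "4 * C + (1 - C)\<^sup>2 = (1 + C)\<^sup>2" by (simp add: power2_eq_square algebra_simps)
    then have "(4 * C) / (4 * C) + (1 - C)\<^sup>2 / (4 * C) = (1 + C)\<^sup>2 / (4 * C)"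
      by (metis add_divide_distrib)
    then show ?thesis unfolding T using C by (simp add: power_divide power_mult_distrib)
  qed
  have sq: "sqrt \<bar>mu_point x\<bar> + sqrt (1 + \<bar>mu_point x\<bar>) = 1 / sqrt C"
  proof -
    have "sqrt \<bar>mu_point x\<bar> = (1 - C) / (2 * sqrt C)"
      unfolding T real_sqrt_abs using C by simp
    moreover have "sqrt (1 + \<bar>mu_point x\<bar>) = (1 + C) / (2 * sqrt C)"
      unfolding T' real_sqrt_abs using C by simp
    ultimately have "sqrt \<bar>mu_point x\<bar> + sqrt (1 + \<bar>mu_point x\<bar>) = (1 - C + (1 + C)) / (2 * sqrt C)"
      by (simp only: add_divide_distrib)
    then show ?thesis by simp
  qed
  define D where "D = sqrt 2 * pi * \<bar>mu_point x\<bar> powr (3 / 4) * (1 + \<bar>mu_point x\<bar>) powr (1 / 2)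
     * (sqrt \<bar>mu_point x\<bar> + sqrt (1 + \<bar>mu_point x\<bar>)) powr (1 / 2)"
  have pos: "\<bar>mu_point x\<bar> > 0" "1 + \<bar>mu_point x\<bar> > 0" "sqrt \<bar>mu_point x\<bar> + sqrt (1 + \<bar>mu_point x\<bar>) > 0"
    using mu_point_neg [OF x] by (auto intro: add_pos_pos)
  have D0: "D > 0" unfolding D_def using pos by (intro mult_pos_pos) auto
  have sin0: "sin (pi * x) > 0" using x by (intro sin_gt_zero) auto
  note sin4 = sin_power4_half_cos [of x, folded C_def]
  have C2: "C\<^sup>2 < 1" using C by (simp add: power_less_one_iff)
  have g0: "\<bar>g' x\<bar> = pi * (1 - C\<^sup>2) * sin (pi * x) / (8 * C\<^sup>2)"
    unfolding g'_def C_def [symmetric] using C C2 sin0 by (simp add: abs_mult)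
  have sqrt24: "(sqrt 2) ^ 4 = (4::real)"
  proof -
    have "(sqrt 2) ^ 4 = ((sqrt 2)\<^sup>2)\<^sup>2" by (simp add: power_mult [symmetric] del: real_sqrt_pow2)
    then show ?thesis by simp
  qed
  have "D ^ 4 = 4 * pi ^ 4 * \<bar>mu_point x\<bar> ^ 3 * (1 + \<bar>mu_point x\<bar>)\<^sup>2 * (sqrt \<bar>mu_point x\<bar> + sqrt (1 + \<bar>mu_point x\<bar>))\<^sup>2"
    unfolding D_def power_mult_distrib using pos by (simp add: powr_quarters sqrt24)
  also have "\<dots> = 4 * pi ^ 4 * ((1 - C)\<^sup>2 / (4 * C)) ^ 3 * ((1 + C)\<^sup>2 / (4 * C))\<^sup>2 * (1 / C)"
    unfolding sq unfolding T' unfolding T using C by (simp add: power_divide power_mult_distrib)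
  also have "\<dots> = (pi * (1 - C\<^sup>2) * sin (pi * x) / (8 * C\<^sup>2)) ^ 4"
  proof -
    have f: "1 - C\<^sup>2 = (1 - C) * (1 + C)" by (simp add: power2_eq_square algebra_simps)
    define a b where "a = 1 - C" and "b = 1 + C"
    have "C \<noteq> 0" using C by simp
    then show ?thesis
      unfolding f power_mult_distrib power_divide sin4 a_def [symmetric] b_def [symmetric]
      by (simp add: field_simps eval_nat_numeral)
  qed
  finally have "D ^ 4 = \<bar>g' x\<bar> ^ 4" unfolding g0 .
  then have "D = \<bar>g' x\<bar>" using D0 by (intro power_eq_imp_eq_base [of D 4]) auto
  then show "\<bar>g' x\<bar> * \<bar>mu_density (mu_point x)\<bar> = 1"
    unfolding mu_density_def D_def [symmetric] using D0 by simp
qed auto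

section \<open>Weak-star convergence\<close>

lemma mean_on_interval_integral:
  assumes M: "prob_space M" and X: "X \<in> borel_measurable M"
    and range: "\<And>x. x \<in> space M \<Longrightarrow> X x \<in> {-1..1}"
  shows "mean_on_interval (\<lambda>f. \<integral>x. f (X x) \<partial>M)"
proof -
  interpret M: prob_space M by (rule M)
  have Y: "X \<in> measurable M (restrict_space borel {-1..1})"
    using X range by (intro measurable_restrict_space2) auto
  have meas: "(\<lambda>x. f (X x)) \<in> borel_measurable M" if "continuous_on {-1..1} f" for f :: "real \<Rightarrow> real"
    using borel_measurable_continuous_on_restrict [OF that] measurable_compose [OF Y] by blast
  have bound: "norm (f (X x)) \<le> e" if "\<forall>t\<in>{-1..1}. \<bar>f t\<bar> \<le> e" "x \<in> space M"
    for f :: "real \<Rightarrow> real" and e x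
    using that range by auto
  have int: "integrable M (\<lambda>x. f (X x))" if f: "continuous_on {-1..1} f" for f :: "real \<Rightarrow> real"
  proof -
    have "compact (f ` {-1..1})" using f by (intro compact_continuous_image) auto
    then obtain e where "\<forall>t\<in>{-1..1}. \<bar>f t\<bar> \<le> e"
      using compact_imp_bounded bounded_iff by (metis image_eqI real_norm_def)
    then show ?thesis
      using bound meas [OF f] by (intro M.integrable_const_bound [where B = e] AE_I2) auto
  qed
  show ?thesis
    unfolding mean_on_interval_def
  proof (intro conjI allI impI)
    fix f :: "real \<Rightarrow> real" and e assume f: "continuous_on {-1..1} f" "\<forall>t\<in>{-1..1}. \<bar>f t\<bar> \<le> e"
    have "norm (\<integral>x. f (X x) \<partial>M) \<le> (\<integral>x. norm (f (X x)) \<partial>M)" by (rule integral_norm_bound)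
    also have "\<dots> \<le> (\<integral>x. e \<partial>M)"
      using bound [OF f(2)] int [OF f(1)] by (intro integral_mono) auto
    finally show "\<bar>\<integral>x. f (X x) \<partial>M\<bar> \<le> e" by (simp add: M.prob_space)
  qed (use int in \<open>auto simp: M.prob_space\<close>)
qed

lemma nu_mean: "mean_on_interval (\<lambda>f. \<integral>x. f (nu_point x) \<partial>unit_lebesgue)"
proof (rule mean_on_interval_integral [OF prob_space_unit_lebesgue])
  show "nu_point \<in> borel_measurable unit_lebesgue" by (rule measurable_unit_lebesgue) measurable
qed (use nu_point_bounds in \<open>auto simp: less_imp_le\<close>)

interpretation nu_sequence: mean_sequence zero_mean "\<lambda>f. \<integral>x. f (nu_point x) \<partial>unit_lebesgue"
proof
  show "\<forall>\<^sub>F n in sequentially. mean_on_interval (zero_mean n)"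
    using eventually_gt_at_top [of 0] by eventually_elim (rule mean_on_interval_zero_mean)
qed (rule nu_mean)

text \<open>
  To the right of \<open>1\<close> all roots are real, and the modulus factors into \<open>sqrt (x + 1)\<close> and the square
  of the quantity \<open>\<rho>\<close> that governs the growth of the Apery sums.
\<close>

lemma nu_function_gt_one:
  assumes x: "x > 1"
  defines "s \<equiv> sqrt ((x - 1) / (x + 1))"
  shows "cmod (nu_function (complex_of_real x)) = sqrt (x + 1) * (sqrt s + sqrt (1 + s))\<^sup>2"
proof -
  define c d where "c = sqrt (x + 1)" and "d = sqrt (x - 1)"
  have c: "c > 0" "c\<^sup>2 = x + 1" and d: "d > 0" "d\<^sup>2 = x - 1" using x by (auto simp: c_def d_def)
  have s: "s = d / c" "s > 0" using x by (auto simp: s_def c_def d_def real_sqrt_divide)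
  define E where "E = sqrt (x - 1 + d * c)"
  have "csqrt (complex_of_real x + 1) = complex_of_real c" "csqrt (complex_of_real x - 1) = complex_of_real d"
    unfolding c_def d_def using x csqrt_of_real_nonneg [of "x + 1"] csqrt_of_real_nonneg [of "x - 1"]
    by simp_all
  moreover have "csqrt (complex_of_real x - 1 + complex_of_real d * complex_of_real c) = complex_of_real E"
  proof -
    have "x - 1 + d * c \<ge> 0" using x c d by simp
    then have "csqrt (complex_of_real (x - 1 + d * c)) = complex_of_real E" 
      unfolding E_def by (rule csqrt_of_real)
    then show ?thesis by simp
  qed
  ultimately have f: "nu_function (complex_of_real x) = complex_of_real (c + 2 * d + 2 * E)"
    unfolding nu_function_def by simp
  have "E \<ge> 0" using x c d by (simp add: E_def)
  then have "cmod (nu_function (complex_of_real x)) = c + 2 * d + 2 * E"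
    using c d unfolding f norm_of_real by simp
  also have "E = c * (sqrt s * sqrt (1 + s))"
  proof -
    have "c * (sqrt s * sqrt (1 + s)) = sqrt (c\<^sup>2 * (s * (1 + s)))"
      using c(1) by (simp add: real_sqrt_mult)
    also have "c\<^sup>2 * (s * (1 + s)) = x - 1 + d * c"
    proof -
      have "c * s = d" using c by (simp add: s)
      moreover have "c\<^sup>2 * (s * (1 + s)) = (c * s) * (c + c * s)"
        by (simp add: power2_eq_square algebra_simps)
      ultimately have "c\<^sup>2 * (s * (1 + s)) = d * (c + d)" by simp
      then show ?thesis using d(2) by (simp add: algebra_simps power2_eq_square)
    qed
    finally show ?thesis by (simp add: E_def)
  qed
  also have "d = c * s" using c by (simp add: s)
  also have "c + 2 * (c * s) + 2 * (c * (sqrt s * sqrt (1 + s))) = c * (sqrt s + sqrt (1 + s))\<^sup>2"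
    using s(2) by (simp add: power2_sum algebra_simps)
  finally show ?thesis by (simp add: c_def)
qed

text \<open>
  The logarithmic means of the explicit law coincide with the limits computed from the growth of
  the Apery sums.
\<close>

lemma nu_converges:
  assumes "continuous_on {-1..1} f"
  shows "(\<lambda>n. zero_mean n f) \<longlonglongrightarrow> (\<integral>x. f (nu_point x) \<partial>unit_lebesgue)"
proof -
  have "nu_sequence.converges (\<lambda>t. ln (x - t))" if x: "x > 1" for x
  proof -
    define s where "s = sqrt ((x - 1) / (x + 1))"
    have s: "s > 0" using x by (simp add: s_def)
    have "(\<integral>y. ln (x - nu_point y) \<partial>unit_lebesgue)
        = (\<integral>y. ln (cmod (complex_of_real x - of_real (nu_point y))) \<partial>unit_lebesgue)"
    proof (intro Bochner_Integration.integral_cong refl)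
      fix y assume "y \<in> space unit_lebesgue"
      then have "x - nu_point y > 0" using nu_point_bounds [of y] x by auto
      then show "ln (x - nu_point y) = ln (cmod (complex_of_real x - of_real (nu_point y)))"
        by (simp flip: of_real_diff)
    qed
    also have "\<dots> = 2 * ln (sqrt (x + 1) * (sqrt s + sqrt (1 + s))\<^sup>2) - 4 * ln (1 + sqrt 2)"
      unfolding nu_log_mean(3) nu_function_gt_one [OF x] s_def ..
    also have "ln (sqrt (x + 1) * (sqrt s + sqrt (1 + s))\<^sup>2) = ln (sqrt (x + 1)) + 2 * ln (sqrt s + sqrt (1 + s))"
    proof -
      have "sqrt s + sqrt (1 + s) > 0" using s by (simp add: add_pos_pos)
      then show ?thesis using x by (simp add: ln_mult ln_realpow)
    qed
    also have "2 * (ln (sqrt (x + 1)) + 2 * ln (sqrt s + sqrt (1 + s))) - 4 * ln (1 + sqrt 2)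
        = ln (x + 1) + 4 * ln (sqrt s + sqrt (1 + s)) - 4 * ln (1 + sqrt 2)"
      using x by (simp add: ln_sqrt)
    finally have "(\<lambda>n. zero_mean n (\<lambda>t. ln (x - t))) \<longlonglongrightarrow> (\<integral>y. ln (x - nu_point y) \<partial>unit_lebesgue)"
      using zero_mean_ln_limit [OF x] by (simp add: s_def)
    moreover have "continuous_on {-1..1} (\<lambda>t. ln (x - t))"
      using x by (intro continuous_intros) auto
    ultimately show ?thesis by (simp add: nu_sequence.converges_def)
  qed
  from nu_sequence.converges_of_logs [OF this assms] show ?thesis
    by (simp add: nu_sequence.converges_def)
qed

lemma integral_nu_measure:
  fixes g :: "complex \<Rightarrow> real"
  assumes "g \<in> borel_measurable borel"
  shows "(\<integral>z. g z \<partial>nu_measure) = (\<integral>x. g (complex_of_real (nu_point x)) \<partial>unit_lebesgue)"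
  unfolding nu_measure_def using assms by (subst integral_distr) auto

lemma integral_mu_measure:
  fixes g :: "complex \<Rightarrow> real"
  assumes "g \<in> borel_measurable borel"
  shows "(\<integral>z. g z \<partial>mu_measure) = (\<integral>x. g (complex_of_real (mu_point x)) \<partial>unit_lebesgue)"
  unfolding mu_measure_def using assms by (subst integral_distr) auto

lemma nu_weak_star:
  "weak_star_converges (\<lambda>n. zero_counting_measure (apery_tilde_poly n)) nu_measure"
  unfolding weak_star_converges_def
proof (intro allI impI, elim conjE)
  fix g :: "complex \<Rightarrow> real" assume g: "continuous_on UNIV g"
  then have meas: "g \<in> borel_measurable borel" by (rule borel_measurable_continuous_onI)
  have "continuous_on {-1..1} (\<lambda>t. g (complex_of_real t))"
    by (intro continuous_on_compose2 [OF g] continuous_intros) auto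
  then show "(\<lambda>n. \<integral>z. g z \<partial>zero_counting_measure (apery_tilde_poly n)) \<longlonglongrightarrow> (\<integral>z. g z \<partial>nu_measure)"
    unfolding integral_zeros_apery_tilde_poly [OF meas] integral_nu_measure [OF meas]
    by (rule nu_converges)
qed

text \<open>
  A compactly supported function composed with the Moebius map vanishes near \<open>-1\<close>, hence becomes
  continuous on \<open>[-1, 1]\<close>, and the convergence there applies.
\<close>

lemma mu_weak_star:
  "weak_star_converges (\<lambda>n. zero_counting_measure (apery_poly n)) mu_measure"
  unfolding weak_star_converges_def
proof (intro allI impI, elim conjE)
  fix g :: "complex \<Rightarrow> real" assume g: "continuous_on UNIV g" and supp: "compact (closure {z. g z \<noteq> 0})"
  then have meas: "g \<in> borel_measurable borel" by (intro borel_measurable_continuous_onI)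
  obtain R where R: "R > 0" "\<And>z. g z \<noteq> 0 \<Longrightarrow> cmod z < R"
  proof -
    obtain R0 where "\<And>z. z \<in> closure {z. g z \<noteq> 0} \<Longrightarrow> cmod z \<le> R0"
      using compact_imp_bounded [OF supp] by (auto simp: bounded_iff)
    then have R0: "cmod z \<le> R0" if "g z \<noteq> 0" for z
      using that closure_subset [of "{z. g z \<noteq> 0}"] by blast
    show thesis
    proof (rule that [of "\<bar>R0\<bar> + 1"])
      show "cmod z < \<bar>R0\<bar> + 1" if "g z \<noteq> 0" for z using R0 [OF that] by linarith
    qed simp
  qed
  \<comment> \<open>The point that the Moebius map sends to \<open>-R\<close>.\<close>
  define t0 where "t0 = (1 - R) / (1 + R)"
  have t0: "-1 < t0" "t0 < 1" using R by (auto simp: t0_def field_simps)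
  have far: "g (complex_of_real ((t - 1) / (t + 1))) = 0" if "-1 < t" "t \<le> t0" for t
  proof -
    have "t * (1 + R) \<le> 1 - R" using that R by (simp add: t0_def pos_le_divide_eq)
    then have "(t - 1) / (t + 1) \<le> - R" using that by (simp add: pos_divide_le_eq algebra_simps)
    then have "\<not> cmod (complex_of_real ((t - 1) / (t + 1))) < R" by (simp only: norm_of_real)
    then show ?thesis using R(2) by blast
  qed
  define h where "h = (\<lambda>t. if t \<le> t0 then 0 else g (complex_of_real ((t - 1) / (t + 1))))"
  have h: "h t = g (complex_of_real ((t - 1) / (t + 1)))" if "-1 < t" for t
    using far that by (auto simp: h_def)
  have "continuous_on ({-1..t0} \<union> {t0..1}) h"
    unfolding h_def
  proof (intro continuous_on_cases)
    show "continuous_on {t0..1} (\<lambda>t. g (complex_of_real ((t - 1) / (t + 1))))"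
      using t0 by (intro continuous_on_compose2 [OF g] continuous_intros) auto
    show "\<forall>t. t \<in> {-1..t0} \<and> \<not> t \<le> t0 \<or> t \<in> {t0..1} \<and> t \<le> t0 \<longrightarrow>
        0 = g (complex_of_real ((t - 1) / (t + 1)))"
      using far t0 by force
  qed auto
  moreover have "{-1..t0} \<union> {t0..1} = {-1..1}" using t0 by auto
  ultimately have "continuous_on {-1..1} h" by simp
  then have "(\<lambda>n. zero_mean n h) \<longlonglongrightarrow> (\<integral>x. h (nu_point x) \<partial>unit_lebesgue)"
    by (rule nu_converges)
  moreover have "zero_mean n h = (\<integral>z. g z \<partial>zero_counting_measure (apery_poly n))" for n
  proof -
    have "image_mset (\<lambda>r. h (to_unit_interval r)) (apery_zeros n)
      = image_mset (\<lambda>r. g (complex_of_real ((to_unit_interval r - 1) / (to_unit_interval r + 1)))) (apery_zeros n)"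
      by (intro image_mset_cong h to_unit_interval_bounds apery_zeros_negative)
    then show ?thesis unfolding integral_zeros_apery_poly [OF meas] zero_mean_def by simp
  qed
  moreover have "(\<integral>x. h (nu_point x) \<partial>unit_lebesgue) = (\<integral>z. g z \<partial>mu_measure)"
    unfolding integral_mu_measure [OF meas]
    by (intro Bochner_Integration.integral_cong refl) (use h nu_point_bounds mu_point_eq in auto)
  ultimately show "(\<lambda>n. \<integral>z. g z \<partial>zero_counting_measure (apery_poly n)) \<longlonglongrightarrow> (\<integral>z. g z \<partial>mu_measure)"
    by simp
qed

lemma distr_in_unit_measures_on:
  assumes [measurable]: "X \<in> borel_measurable borel" and K: "closed K"
    and X: "\<And>x. 0 < x \<Longrightarrow> x < 1 \<Longrightarrow> complex_of_real (X x) \<in> K"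
  shows "distr unit_lebesgue borel (\<lambda>x. complex_of_real (X x)) \<in> unit_measures_on K"
proof -
  have m: "(\<lambda>x. complex_of_real (X x)) \<in> borel_measurable unit_lebesgue" by measurable
  have "- K \<in> sets borel" using K by (intro borel_open) auto
  then have "emeasure (distr unit_lebesgue borel (\<lambda>x. complex_of_real (X x))) (- K)
      = emeasure unit_lebesgue ((\<lambda>x. complex_of_real (X x)) -` (- K) \<inter> space unit_lebesgue)"
    by (rule emeasure_distr [OF m])
  also have "(\<lambda>x. complex_of_real (X x)) -` (- K) \<inter> space unit_lebesgue = {}"
    using X by auto
  finally show ?thesis
    unfolding unit_measures_on_def using unit_lebesgue.prob_space_distr [OF m] by simp
qed

lemma nu_measure_unit: "nu_measure \<in> unit_measures_on (complex_of_real ` {-1..1})"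
  unfolding nu_measure_def
proof (rule distr_in_unit_measures_on)
  show "closed (complex_of_real ` {-1..1})"
    by (intro compact_imp_closed compact_continuous_image continuous_intros) auto
qed (use nu_point_bounds in \<open>auto simp: less_imp_le\<close>)

lemma mu_measure_unit: "mu_measure \<in> unit_measures_on (complex_of_real ` {..0})"
  unfolding mu_measure_def
proof (rule distr_in_unit_measures_on)
  have "complex_of_real ` {..0} = {z. Im z = 0} \<inter> {z. Re z \<le> 0}"
    by (auto simp: image_iff complex_eq_iff)
  then show "closed (complex_of_real ` {..0})"
    by (simp add: closed_Int closed_Collect_eq closed_Collect_le continuous_on_Re continuous_on_Im)
qed (use mu_point_neg in \<open>auto simp: less_imp_le\<close>)

lemma nu_log_potential:
  "log_potential nu_measure z = ereal (4 * ln (1 + sqrt 2) - 2 * ln (cmod (nu_function z)))"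
  unfolding nu_measure_def 
  by (subst log_potential_distr [OF _ nu_log_mean(1) nu_log_mean(2)]) (auto simp: nu_log_mean(3))

lemma mu_log_potential:
  "log_potential mu_measure z = ereal (4 * ln 2 - 2 * ln (cmod (1 + 2 * (csqrt z + csqrt (z + csqrt z)))))"
  unfolding mu_measure_def 
  by (subst log_potential_distr [OF _ mu_log_mean(1) mu_log_mean(2)]) (auto simp: mu_log_mean(3))

section \<open>Chebyshev expansion of the logarithmic kernel\<close>

text \<open>
  Agrees with the real part on the segment and takes values in \<open>[-1, 1]\<close> everywhere, so that
  functions known only on that interval can be composed with it.
\<close>

definition clamped_Re :: "complex \<Rightarrow> real" where
  "clamped_Re z = max (-1) (min 1 (Re z))"

lemma clamped_Re_measurable [measurable]: "clamped_Re \<in> borel_measurable borel"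
  unfolding clamped_Re_def by measurable

lemma clamped_Re_bounds: "clamped_Re z \<in> {-1..1}" "\<bar>clamped_Re z\<bar> \<le> 1"
  by (auto simp: clamped_Re_def)

abbreviation unit_segment :: "complex set" where
  "unit_segment \<equiv> complex_of_real ` {-1..1}"

abbreviation segment_measures :: "complex measure set" where
  "segment_measures \<equiv> unit_measures_on unit_segment"

lemma unit_segment_clamped: "z \<in> unit_segment \<Longrightarrow> z = complex_of_real (clamped_Re z)"
  by (auto simp: clamped_Re_def)

lemma closed_unit_segment: "closed unit_segment"
  by (intro compact_imp_closed compact_continuous_image continuous_intros) auto

definition chebyshev :: "nat \<Rightarrow> complex \<Rightarrow> real" where
  "chebyshev k z = cos (real k * arccos (clamped_Re z))"

lemma chebyshev_measurable [measurable]: "chebyshev k \<in> borel_measurable borel"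
proof -
  have "continuous_on UNIV clamped_Re" unfolding clamped_Re_def by (intro continuous_intros)
  then have "continuous_on UNIV (\<lambda>z. arccos (clamped_Re z))"
    using clamped_Re_bounds(1) by (intro continuous_on_arccos ballI) auto
  then have "continuous_on UNIV (chebyshev k)" 
    unfolding chebyshev_def by (intro continuous_on_cos continuous_on_mult continuous_on_const)
  then show ?thesis by (rule borel_measurable_continuous_onI)
qed

text \<open>
  For \<open>x = cos \<phi>\<close> and \<open>y = cos \<psi>\<close> this is
  \<open>(1 - 2r cos (\<phi> - \<psi>) + r^2) (1 - 2r cos (\<phi> + \<psi>) + r^2)\<close>, which becomes \<open>4 (x - y)^2\<close> at \<open>r = 1\<close>.
\<close>

definition regular_kernel :: "real \<Rightarrow> real \<Rightarrow> real \<Rightarrow> real" where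
  "regular_kernel r x y = (1 - r\<^sup>2)\<^sup>2 + 4 * r\<^sup>2 * (x - y)\<^sup>2 - 4 * r * (1 - r)\<^sup>2 * (x * y)"

text \<open>
  The kernel is \<open>4 r^2 (x - y)^2\<close> plus \<open>(1 - r)^2 ((1 + r)^2 - 4rxy)\<close>, and the second bracket is at
  least \<open>(1 - r)^2\<close>. The lower bound makes the logarithmic kernel a majorant that does not depend
  on \<open>r\<close>; the upper bound is crude.
\<close>

lemma regular_kernel_bounds:
  assumes r: "0 \<le> r" "r < 1" and xy: "\<bar>x\<bar> \<le> 1" "\<bar>y\<bar> \<le> 1"
  shows "regular_kernel r x y > 0" "regular_kernel r x y \<ge> 4 * r\<^sup>2 * (x - y)\<^sup>2" "regular_kernel r x y \<le> 32"
proof -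
  have "\<bar>x * y\<bar> \<le> 1" using xy by (simp add: abs_mult mult_le_one)
  then have p: "x * y \<le> 1" "- (x * y) \<le> 1" by auto
  have split: "regular_kernel r x y = (1 - r)\<^sup>2 * ((1 + r)\<^sup>2 - 4 * r * (x * y)) + 4 * r\<^sup>2 * (x - y)\<^sup>2"
    unfolding regular_kernel_def by algebra
  have "4 * r * (x * y) \<le> 4 * r * 1" using p r by (intro mult_left_mono) auto
  then have "(1 + r)\<^sup>2 - 4 * r * (x * y) \<ge> (1 - r)\<^sup>2" by (simp add: power2_eq_square algebra_simps)
  moreover have "(1 - r)\<^sup>2 > 0" using r by simp
  ultimately have "(1 - r)\<^sup>2 * ((1 + r)\<^sup>2 - 4 * r * (x * y)) > 0" by (intro mult_pos_pos) linarith+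
  moreover have "4 * r\<^sup>2 * (x - y)\<^sup>2 \<ge> 0" by simp
  ultimately show "regular_kernel r x y > 0" "regular_kernel r x y \<ge> 4 * r\<^sup>2 * (x - y)\<^sup>2"
    unfolding split by linarith+
  have "(x - y)\<^sup>2 \<le> 2\<^sup>2"
    using xy by (intro abs_le_square_iff [THEN iffD1]) auto
  moreover have r2: "r\<^sup>2 \<le> 1" using r by (simp add: power_le_one)
  ultimately have "r\<^sup>2 * (x - y)\<^sup>2 \<le> 1 * 4" by (intro mult_mono) auto
  moreover have "(1 - r\<^sup>2)\<^sup>2 \<le> 1" using r2 by (intro power_le_one) auto
  moreover define Q where "Q = r * (1 - r)\<^sup>2"
  have "0 \<le> Q" "Q \<le> 1"
    unfolding Q_def using r by (auto intro!: mult_le_one power_le_one)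
  then have "Q * (- (x * y)) \<le> 1 * 1"
    using p mult_left_mono [of "- (x * y)" 1 Q] by linarith
  moreover have "regular_kernel r x y = (1 - r\<^sup>2)\<^sup>2 + 4 * (r\<^sup>2 * (x - y)\<^sup>2) + 4 * (Q * (- (x * y)))"
    unfolding regular_kernel_def Q_def by simp
  ultimately show "regular_kernel r x y \<le> 32" by linarith
qed

text \<open>
  The real part of the series of \<open>Ln (1 - r cis t)\<close>. Its term for \<open>n = 0\<close> is zero because division
  by zero yields zero.
\<close>

lemma ln_cmod_one_minus_cis_sums:
  assumes "0 \<le> r" "r < 1"
  shows "(\<lambda>n. r ^ n / real n * cos (real n * t)) sums (- ln (1 - 2 * r * cos t + r\<^sup>2) / 2)"
proof -
  define w where "w = 1 - of_real r * cis t"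
  have "cmod (of_real r * cis t) = r" using assms by (simp add: norm_mult)
  then have w0: "w \<noteq> 0" using assms unfolding w_def by (metis eq_iff_diff_eq_0 norm_one order_less_irrefl)
  have "(\<lambda>n. - ((of_real r * cis t) ^ n) / of_nat n) sums ln (1 + - (of_real r * cis t))"
    using Ln_series' [of "- (of_real r * cis t)"] assms by (simp add: norm_mult)
  then have "(\<lambda>n. Re (- ((of_real r * cis t) ^ n) / of_nat n)) sums Re (ln w)"
    unfolding w_def by (intro sums_Re) simp
  moreover have "Re (- ((of_real r * cis t) ^ n) / of_nat n) = - (r ^ n / real n * cos (real n * t))" for n
  proof -
    have "(of_real r * cis t) ^ n = of_real (r ^ n) * cis (real n * t)"
      by (simp only: power_mult_distrib Complex.DeMoivre of_real_power)
    then show ?thesis by (simp add: Re_divide_of_nat)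
  qed
  moreover have "Re (ln w) = ln (cmod w)" using w0 by simp
  ultimately have "(\<lambda>n. - (r ^ n / real n * cos (real n * t))) sums ln (cmod w)" by (simp only:)
  from sums_minus [OF this] have "(\<lambda>n. r ^ n / real n * cos (real n * t)) sums - ln (cmod w)" by simp
  moreover have "(cmod w)\<^sup>2 = 1 - 2 * r * cos t + r\<^sup>2"
  proof -
    have "(cmod w)\<^sup>2 = (1 - r * cos t)\<^sup>2 + (r * sin t)\<^sup>2" unfolding w_def cmod_power2 by simp
    moreover have "(1 - r * c)\<^sup>2 + (r * s)\<^sup>2 = 1 - 2 * r * c + r\<^sup>2" if "s\<^sup>2 + c\<^sup>2 = 1" for c s :: real
      using that by algebra
    ultimately show ?thesis using sin_cos_squared_add [of t] by metis
  qed
  then have "ln (1 - 2 * r * cos t + r\<^sup>2) = 2 * ln (cmod w)"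
    using w0 by (metis ln_realpow of_nat_numeral zero_less_norm_iff)
  ultimately show ?thesis by simp
qed

lemma regular_kernel_sums:
  assumes r: "0 \<le> r" "r < 1"
  shows "(\<lambda>n. 2 * (r ^ n / real n) * (chebyshev n s * chebyshev n t)) sums
    (- ln (regular_kernel r (clamped_Re s) (clamped_Re t)) / 2)"
proof -
  define x y where "x = clamped_Re s" and "y = clamped_Re t"
  define \<phi> \<psi> where "\<phi> = arccos x" and "\<psi> = arccos y"
  have cx: "cos \<phi> = x" and cy: "cos \<psi> = y"
    using clamped_Re_bounds by (auto simp: \<phi>_def \<psi>_def x_def y_def)
  define p q where "p = 1 - 2 * r * cos (\<phi> - \<psi>) + r\<^sup>2" and "q = 1 - 2 * r * cos (\<phi> + \<psi>) + r\<^sup>2"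
  have "(\<lambda>n. r ^ n / real n * cos (real n * (\<phi> - \<psi>)) + r ^ n / real n * cos (real n * (\<phi> + \<psi>))) sums
     (- ln p / 2 + - ln q / 2)"
    unfolding p_def q_def by (intro sums_add ln_cmod_one_minus_cis_sums r)
  moreover have "r ^ n / real n * cos (real n * (\<phi> - \<psi>)) + r ^ n / real n * cos (real n * (\<phi> + \<psi>))
     = 2 * (r ^ n / real n) * (chebyshev n s * chebyshev n t)" for n
    by (simp add: chebyshev_def \<phi>_def \<psi>_def x_def y_def right_diff_distrib distrib_left cos_diff cos_add)
  moreover have "- ln p / 2 + - ln q / 2 = - ln (p * q) / 2"
  proof -
    have pos: "1 - 2 * r * c + r\<^sup>2 > 0" if "c \<le> 1" for c
    proof -
      have "r * c \<le> r * 1" using that r by (intro mult_left_mono) auto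
      then have "1 - 2 * r * c + r\<^sup>2 \<ge> (1 - r)\<^sup>2" by (simp add: power2_eq_square algebra_simps)
      moreover have "(1 - r)\<^sup>2 > 0" using r by simp
      ultimately show ?thesis by linarith
    qed
    have "p > 0" "q > 0" unfolding p_def q_def by (intro pos cos_le_one)+
    then show ?thesis by (simp add: ln_mult)
  qed
  moreover have "p * q = regular_kernel r x y"
  proof -
    have "(sin \<phi>)\<^sup>2 = 1 - x\<^sup>2" "(sin \<psi>)\<^sup>2 = 1 - y\<^sup>2"
      using sin_cos_squared_add [of \<phi>] sin_cos_squared_add [of \<psi>] by (auto simp: cx cy)
    moreover have "cos (\<phi> - \<psi>) = x * y + sin \<phi> * sin \<psi>" "cos (\<phi> + \<psi>) = x * y - sin \<phi> * sin \<psi>"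
      by (simp_all add: cos_diff cos_add cx cy)
    ultimately show ?thesis unfolding p_def q_def regular_kernel_def by algebra
  qed
  ultimately show ?thesis by (simp add: x_def y_def)
qed

section \<open>Positivity of the logarithmic energy\<close>

definition log_kernel :: "complex \<times> complex \<Rightarrow> real" where
  "log_kernel p = - ln (cmod (fst p - snd p))"

lemma log_kernel_measurable [measurable]: "log_kernel \<in> borel_measurable (borel \<Otimes>\<^sub>M borel)"
  unfolding log_kernel_def by measurable

lemma unit_measures_onD:
  assumes "\<sigma> \<in> unit_measures_on K" "closed K"
  shows "sets \<sigma> = sets borel" "prob_space \<sigma>" "AE s in \<sigma>. s \<in> K"
proof -
  show s: "sets \<sigma> = sets borel" and "prob_space \<sigma>"
    using assms by (auto simp: unit_measures_on_def)
  have "- K \<in> null_sets \<sigma>"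
    using assms s by (auto simp: unit_measures_on_def null_sets_def borel_open)
  from AE_not_in [OF this] show "AE s in \<sigma>. s \<in> K" by simp
qed

lemma measurable_pair_borel:
  assumes "sets \<sigma> = sets borel" "sets \<tau> = sets borel" "f \<in> borel_measurable (borel \<Otimes>\<^sub>M borel)"
  shows "f \<in> borel_measurable (\<sigma> \<Otimes>\<^sub>M \<tau>)"
  using assms(3) measurable_cong_sets [OF sets_pair_measure_cong [OF assms(1,2)] refl] by blast

lemma measurable_borel_sets:
  assumes "sets \<sigma> = sets borel" "f \<in> borel_measurable borel"
  shows "f \<in> borel_measurable \<sigma>"
  using assms(2) measurable_cong_sets [OF assms(1) refl] by blast

lemma AE_pair_segment:
  assumes \<sigma>: "\<sigma> \<in> segment_measures" and \<tau>: "\<tau> \<in> segment_measures"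
  shows "AE p in \<sigma> \<Otimes>\<^sub>M \<tau>. fst p \<in> unit_segment \<and> snd p \<in> unit_segment"
proof -
  note \<sigma>D = unit_measures_onD [OF \<sigma> closed_unit_segment]
  note \<tau>D = unit_measures_onD [OF \<tau> closed_unit_segment]
  interpret S: prob_space \<sigma> by (rule \<sigma>D)
  interpret T: prob_space \<tau> by (rule \<tau>D)
  interpret pair_prob_space \<sigma> \<tau> ..
  show ?thesis
  proof (rule AE_pair_measure)
    have [measurable]: "unit_segment \<in> sets borel" using closed_unit_segment by (rule borel_closed)
    have "{p \<in> space (\<sigma> \<Otimes>\<^sub>M \<tau>). fst p \<in> unit_segment \<and> snd p \<in> unit_segment} = unit_segment \<times> unit_segment"
      using \<sigma>D(1) \<tau>D(1) by (auto simp: space_pair_measure sets_eq_imp_space_eq)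
    moreover have "unit_segment \<times> unit_segment \<in> sets (\<sigma> \<Otimes>\<^sub>M \<tau>)"
      using \<sigma>D(1) \<tau>D(1) by (intro pair_measureI) auto
    ultimately show "{p \<in> space (\<sigma> \<Otimes>\<^sub>M \<tau>). fst p \<in> unit_segment \<and> snd p \<in> unit_segment} \<in> sets (\<sigma> \<Otimes>\<^sub>M \<tau>)"
      by simp
    show "AE s in \<sigma>. AE t in \<tau>. fst (s, t) \<in> unit_segment \<and> snd (s, t) \<in> unit_segment"
      using \<sigma>D(3)
    proof eventually_elim
      case (elim s)
      show ?case using \<tau>D(3) by eventually_elim (use elim in auto)
    qed
  qed
qed

definition chebyshev_moment :: "nat \<Rightarrow> complex measure \<Rightarrow> real" where
  "chebyshev_moment k \<sigma> = (\<integral>s. chebyshev k s \<partial>\<sigma>)"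

definition regular_energy :: "real \<Rightarrow> complex measure \<Rightarrow> complex measure \<Rightarrow> real" where
  "regular_energy r \<sigma> \<tau> =
     (\<integral>p. - ln (regular_kernel r (clamped_Re (fst p)) (clamped_Re (snd p))) / 2 \<partial>(\<sigma> \<Otimes>\<^sub>M \<tau>))"

lemma abs_chebyshev_le: "\<bar>chebyshev k s\<bar> \<le> 1"
  by (simp add: chebyshev_def)

lemma regular_energy_sums:
  assumes \<sigma>: "sets \<sigma> = sets borel" "prob_space \<sigma>" and \<tau>: "sets \<tau> = sets borel" "prob_space \<tau>"
    and r: "0 \<le> r" "r < 1"
  shows "(\<lambda>n. 2 * (r ^ n / real n) * (chebyshev_moment n \<sigma> * chebyshev_moment n \<tau>)) sums regular_energy r \<sigma> \<tau>"
proof -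
  interpret S: prob_space \<sigma> by (rule \<sigma>)
  interpret T: prob_space \<tau> by (rule \<tau>)
  interpret P: pair_prob_space \<sigma> \<tau> ..
  define f where "f = (\<lambda>n p. 2 * (r ^ n / real n) * (chebyshev n (fst p) * chebyshev n (snd p)))"
  have cc: "\<bar>chebyshev n s * chebyshev n t\<bar> \<le> 1" for n s t
    using abs_chebyshev_le by (simp add: abs_mult mult_le_one)
  have fb: "norm (f n p) \<le> 2 * r ^ n" for n p
  proof -
    have "norm (f n p) = 2 * (r ^ n / real n) * \<bar>chebyshev n (fst p) * chebyshev n (snd p)\<bar>"
      using r by (simp add: f_def abs_mult)
    also have "\<dots> \<le> 2 * (r ^ n / real n) * 1"
      using r cc by (intro mult_left_mono) auto
    also have "r ^ n / real n \<le> r ^ n"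
      using r by (cases "n = 0") (auto simp: divide_le_eq mult_le_cancel_left1)
    finally show ?thesis by simp
  qed
  have meas: "f n \<in> borel_measurable (\<sigma> \<Otimes>\<^sub>M \<tau>)" for n
    unfolding f_def by (rule measurable_pair_borel [OF \<sigma>(1) \<tau>(1)]) measurable
  have int: "integrable (\<sigma> \<Otimes>\<^sub>M \<tau>) (f n)" for n
    using fb meas by (intro P.integrable_const_bound [where B = "2 * r ^ n"] AE_I2) auto
  have geo: "summable (\<lambda>n. 2 * r ^ n)" using r by (intro summable_mult summable_geometric) simp
  have "(\<lambda>n. integral\<^sup>L (\<sigma> \<Otimes>\<^sub>M \<tau>) (f n)) sums (\<integral>p. (\<Sum>n. f n p) \<partial>(\<sigma> \<Otimes>\<^sub>M \<tau>))"
  proof (rule sums_integral [OF int])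
    show "AE p in \<sigma> \<Otimes>\<^sub>M \<tau>. summable (\<lambda>n. norm (f n p))"
      using fb by (intro AE_I2 summable_comparison_test' [OF geo]) auto
    show "summable (\<lambda>n. \<integral>p. norm (f n p) \<partial>(\<sigma> \<Otimes>\<^sub>M \<tau>))"
    proof (rule summable_comparison_test' [OF geo])
      fix n
      have "(\<integral>p. norm (f n p) \<partial>(\<sigma> \<Otimes>\<^sub>M \<tau>)) \<le> (\<integral>p. 2 * r ^ n \<partial>(\<sigma> \<Otimes>\<^sub>M \<tau>))"
        using fb int by (intro integral_mono) auto
      then show "norm (\<integral>p. norm (f n p) \<partial>(\<sigma> \<Otimes>\<^sub>M \<tau>)) \<le> 2 * r ^ n"
        by (simp add: P.prob_space)
    qed
  qed
  moreover have "(\<Sum>n. f n p) = - ln (regular_kernel r (clamped_Re (fst p)) (clamped_Re (snd p))) / 2" for p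
    unfolding f_def by (rule sums_unique [symmetric]) (rule regular_kernel_sums [OF r])
  moreover have "integral\<^sup>L (\<sigma> \<Otimes>\<^sub>M \<tau>) (f n) = 2 * (r ^ n / real n) * (chebyshev_moment n \<sigma> * chebyshev_moment n \<tau>)" for n
  proof -
    have "integral\<^sup>L (\<sigma> \<Otimes>\<^sub>M \<tau>) (f n) = (\<integral>s. \<integral>t. f n (s, t) \<partial>\<tau> \<partial>\<sigma>)"
      by (rule P.integral_fst' [OF int, symmetric])
    also have "\<dots> = 2 * (r ^ n / real n) * (chebyshev_moment n \<sigma> * chebyshev_moment n \<tau>)"
      by (simp add: f_def chebyshev_moment_def)
    finally show ?thesis .
  qed
  ultimately show ?thesis unfolding regular_energy_def by simp
qed

text \<open>
  Dominated convergence for \<open>r \<rightarrow> 1\<close>; the constant \<open>ln 2\<close> comes from the factor \<open>4\<close> in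
  \<open>4 (x - y)^2\<close>.
\<close>

lemma regular_energy_limit:
  assumes \<sigma>: "\<sigma> \<in> segment_measures" and \<tau>: "\<tau> \<in> segment_measures"
    and int: "integrable (\<sigma> \<Otimes>\<^sub>M \<tau>) log_kernel" and ne: "AE p in \<sigma> \<Otimes>\<^sub>M \<tau>. fst p \<noteq> snd p"
  shows "(\<lambda>n. regular_energy (1 - 1 / (real n + 2)) \<sigma> \<tau>) \<longlonglongrightarrow> (\<integral>p. log_kernel p \<partial>(\<sigma> \<Otimes>\<^sub>M \<tau>)) - ln 2"
proof -
  note \<sigma>D = unit_measures_onD [OF \<sigma> closed_unit_segment]
  note \<tau>D = unit_measures_onD [OF \<tau> closed_unit_segment]
  interpret S: prob_space \<sigma> by (rule \<sigma>D)
  interpret T: prob_space \<tau> by (rule \<tau>D)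
  interpret P: pair_prob_space \<sigma> \<tau> ..
  define \<rho> where "\<rho> = (\<lambda>n. 1 - 1 / (real n + 2))"
  have \<rho>: "0 \<le> \<rho> n" "\<rho> n < 1" "2 * \<rho> n \<ge> 1" for n by (auto simp: \<rho>_def field_simps)
  have \<rho>lim: "\<rho> \<longlonglongrightarrow> 1" unfolding \<rho>_def by real_asymp
  have "(\<lambda>n. regular_energy (\<rho> n) \<sigma> \<tau>) \<longlonglongrightarrow> (\<integral>p. log_kernel p - ln 2 \<partial>(\<sigma> \<Otimes>\<^sub>M \<tau>))"
    unfolding regular_energy_def
  proof (rule integral_dominated_convergence)
    show "(\<lambda>p. log_kernel p - ln 2) \<in> borel_measurable (\<sigma> \<Otimes>\<^sub>M \<tau>)"
      by (rule measurable_pair_borel [OF \<sigma>D(1) \<tau>D(1)]) measurable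
    show "(\<lambda>p. - ln (regular_kernel (\<rho> n) (clamped_Re (fst p)) (clamped_Re (snd p))) / 2) \<in> borel_measurable (\<sigma> \<Otimes>\<^sub>M \<tau>)" for n
      unfolding regular_kernel_def by (rule measurable_pair_borel [OF \<sigma>D(1) \<tau>D(1)]) measurable
    show "integrable (\<sigma> \<Otimes>\<^sub>M \<tau>) (\<lambda>p. \<bar>log_kernel p\<bar> + 3 * ln 2)"
      using int by (intro Bochner_Integration.integrable_add integrable_abs) auto
    show "AE p in \<sigma> \<Otimes>\<^sub>M \<tau>. (\<lambda>n. - ln (regular_kernel (\<rho> n) (clamped_Re (fst p)) (clamped_Re (snd p))) / 2)
        \<longlonglongrightarrow> log_kernel p - ln 2"
      using AE_pair_segment [OF \<sigma> \<tau>] ne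
    proof eventually_elim
      case (elim p)
      define x y where "x = clamped_Re (fst p)" and "y = clamped_Re (snd p)"
      have st: "fst p = complex_of_real x" "snd p = complex_of_real y"
        using elim unit_segment_clamped unfolding x_def y_def by blast+
      then have xy: "x \<noteq> y" using elim by auto
      have "(\<lambda>n. - ln (regular_kernel (\<rho> n) x y) / 2) \<longlonglongrightarrow> - ln (regular_kernel 1 x y) / 2"
        unfolding regular_kernel_def using xy by (intro tendsto_intros \<rho>lim) (auto simp: regular_kernel_def)
      also have "- ln (regular_kernel 1 x y) / 2 = log_kernel p - ln 2"
      proof -
        have "regular_kernel 1 x y = (2 * \<bar>x - y\<bar>)\<^sup>2" by (simp add: regular_kernel_def power_mult_distrib)
        moreover have "ln ((2 * \<bar>x - y\<bar>)\<^sup>2) = real 2 * ln (2 * \<bar>x - y\<bar>)"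
          by (rule ln_realpow)
        moreover have "ln (2 * \<bar>x - y\<bar>) = ln 2 + ln \<bar>x - y\<bar>"
          using xy by (intro ln_mult_pos) auto
        ultimately have "ln (regular_kernel 1 x y) = 2 * (ln 2 + ln \<bar>x - y\<bar>)" by simp
        moreover have "cmod (fst p - snd p) = \<bar>x - y\<bar>" unfolding st by (simp flip: of_real_diff)
        ultimately show ?thesis by (simp add: log_kernel_def)
      qed
      finally show ?case by (simp add: x_def y_def)
    qed
    show "AE p in \<sigma> \<Otimes>\<^sub>M \<tau>. norm (- ln (regular_kernel (\<rho> n) (clamped_Re (fst p)) (clamped_Re (snd p))) / 2)
        \<le> \<bar>log_kernel p\<bar> + 3 * ln 2" for n
      using AE_pair_segment [OF \<sigma> \<tau>] ne
    proof eventually_elim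
      case (elim p)
      define x y where "x = clamped_Re (fst p)" and "y = clamped_Re (snd p)"
      have st: "fst p = complex_of_real x" "snd p = complex_of_real y"
        using elim unit_segment_clamped unfolding x_def y_def by blast+
      then have xy: "x \<noteq> y" using elim by auto
      have l: "log_kernel p = - ln \<bar>x - y\<bar>" unfolding log_kernel_def st by (simp flip: of_real_diff)
      define D where "D = regular_kernel (\<rho> n) x y"
      have D: "D > 0" "D \<ge> 4 * (\<rho> n)\<^sup>2 * (x - y)\<^sup>2" "D \<le> 32"
        unfolding D_def x_def y_def using regular_kernel_bounds [OF \<rho>(1,2)] clamped_Re_bounds(2) by auto
      have "1 * (x - y)\<^sup>2 \<le> (2 * \<rho> n)\<^sup>2 * (x - y)\<^sup>2"
        using \<rho> by (intro mult_right_mono one_le_power) auto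
      then have "\<bar>x - y\<bar>\<^sup>2 \<le> D" using D(2) by (simp add: power_mult_distrib)
      then have "ln (\<bar>x - y\<bar>\<^sup>2) \<le> ln D" using xy D(1) by (subst ln_le_cancel_iff) auto
      moreover have "ln (\<bar>x - y\<bar>\<^sup>2) = real 2 * ln \<bar>x - y\<bar>" by (rule ln_realpow)
      ultimately have "2 * ln \<bar>x - y\<bar> \<le> ln D" by simp
      moreover have "ln D \<le> 5 * ln 2"
      proof -
        have "ln D \<le> ln (2 ^ 5)" using D by (subst ln_le_cancel_iff) auto
        moreover have "ln (2 ^ 5) = real 5 * ln (2 :: real)" by (rule ln_realpow)
        ultimately show ?thesis by simp
      qed
      moreover have "ln (2::real) > 0" by simp
      ultimately have "\<bar>- ln D / 2\<bar> \<le> \<bar>- ln \<bar>x - y\<bar>\<bar> + 3 * ln 2" by linarith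
      then show ?case unfolding l by (simp add: D_def x_def y_def)
    qed
  qed
  moreover have "(\<integral>p. log_kernel p - ln 2 \<partial>(\<sigma> \<Otimes>\<^sub>M \<tau>)) = (\<integral>p. log_kernel p \<partial>(\<sigma> \<Otimes>\<^sub>M \<tau>)) - ln 2"
    using int by (simp add: P.prob_space)
  ultimately show ?thesis by (simp add: \<rho>_def)
qed

text \<open>
  Both conditions are needed: the real logarithm vanishes at \<open>0\<close>, so integrability of the real
  kernel does not detect mass on the diagonal.
\<close>

definition finite_mutual_energy :: "complex measure \<Rightarrow> complex measure \<Rightarrow> bool" where
  "finite_mutual_energy \<sigma> \<tau> \<longleftrightarrow>
     integrable (\<sigma> \<Otimes>\<^sub>M \<tau>) log_kernel \<and> (AE p in \<sigma> \<Otimes>\<^sub>M \<tau>. fst p \<noteq> snd p)"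

definition mutual_energy :: "complex measure \<Rightarrow> complex measure \<Rightarrow> real" where
  "mutual_energy \<sigma> \<tau> = (\<integral>p. log_kernel p \<partial>(\<sigma> \<Otimes>\<^sub>M \<tau>))"

text \<open>
  For \<open>r < 1\<close> the energy of \<open>\<sigma> - \<tau>\<close> is a series of nonnegative terms, the \<open>k\<close>-th of which tends to
  the left-hand bound as \<open>r \<rightarrow> 1\<close>; the constants \<open>ln 2\<close> cancel because both measures have mass \<open>1\<close>.
\<close>

lemma energy_distance_ge:
  assumes \<sigma>: "\<sigma> \<in> segment_measures" and \<tau>: "\<tau> \<in> segment_measures"
    and fin: "finite_mutual_energy \<sigma> \<sigma>" "finite_mutual_energy \<sigma> \<tau>" "finite_mutual_energy \<tau> \<tau>"
  shows "mutual_energy \<sigma> \<sigma> - 2 * mutual_energy \<sigma> \<tau> + mutual_energy \<tau> \<tau>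
    \<ge> 2 / real k * (chebyshev_moment k \<sigma> - chebyshev_moment k \<tau>)\<^sup>2"
proof -
  define \<rho> where "\<rho> = (\<lambda>n. 1 - 1 / (real n + 2))"
  have \<rho>: "0 \<le> \<rho> n" "\<rho> n < 1" for n by (auto simp: \<rho>_def field_simps)
  have \<rho>lim: "\<rho> \<longlonglongrightarrow> 1" unfolding \<rho>_def by real_asymp
  note \<sigma>D = unit_measures_onD(1,2) [OF \<sigma> closed_unit_segment]
  note \<tau>D = unit_measures_onD(1,2) [OF \<tau> closed_unit_segment]
  define a b where "a = (\<lambda>n. chebyshev_moment n \<sigma>)" and "b = (\<lambda>n. chebyshev_moment n \<tau>)"
  define E where "E = (\<lambda>r. regular_energy r \<sigma> \<sigma> - 2 * regular_energy r \<sigma> \<tau> + regular_energy r \<tau> \<tau>)"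
  have square: "2 * c * (u * u) - 2 * (2 * c * (u * v)) + 2 * c * (v * v) = 2 * c * (u - v)\<^sup>2" for c u v :: real
    by algebra
  have ge: "2 * (\<rho> n ^ k / real k) * (a k - b k)\<^sup>2 \<le> E (\<rho> n)" for n
  proof -
    have "(\<lambda>m. 2 * (\<rho> n ^ m / real m) * (a m * a m) - 2 * (2 * (\<rho> n ^ m / real m) * (a m * b m))
        + 2 * (\<rho> n ^ m / real m) * (b m * b m)) sums E (\<rho> n)"
      unfolding E_def a_def b_def
      by (intro sums_add sums_diff sums_mult regular_energy_sums \<sigma>D \<tau>D \<rho>)
    moreover have "2 * (\<rho> n ^ m / real m) * (a m * a m) - 2 * (2 * (\<rho> n ^ m / real m) * (a m * b m))
        + 2 * (\<rho> n ^ m / real m) * (b m * b m) = 2 * (\<rho> n ^ m / real m) * (a m - b m)\<^sup>2" for m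
      by (rule square)
    ultimately have s: "(\<lambda>m. 2 * (\<rho> n ^ m / real m) * (a m - b m)\<^sup>2) sums E (\<rho> n)" by simp
    have "(\<Sum>m\<in>{k}. 2 * (\<rho> n ^ m / real m) * (a m - b m)\<^sup>2) \<le> (\<Sum>m. 2 * (\<rho> n ^ m / real m) * (a m - b m)\<^sup>2)"
      using \<rho> s by (intro sum_le_suminf) (auto simp: sums_iff)
    then show ?thesis using s by (simp add: sums_iff)
  qed
  have "(\<lambda>n. E (\<rho> n)) \<longlonglongrightarrow> (mutual_energy \<sigma> \<sigma> - ln 2) - 2 * (mutual_energy \<sigma> \<tau> - ln 2) + (mutual_energy \<tau> \<tau> - ln 2)"
    unfolding E_def \<rho>_def mutual_energy_def
    using fin by (intro tendsto_intros regular_energy_limit \<sigma> \<tau>) (auto simp: finite_mutual_energy_def)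
  moreover have "(\<lambda>n. 2 * (\<rho> n ^ k / real k) * (a k - b k)\<^sup>2) \<longlonglongrightarrow> 2 * (1 ^ k / real k) * (a k - b k)\<^sup>2"
    unfolding divide_inverse by (intro tendsto_mult tendsto_const tendsto_power \<rho>lim)
  ultimately have "2 * (1 ^ k / real k) * (a k - b k)\<^sup>2
      \<le> (mutual_energy \<sigma> \<sigma> - ln 2) - 2 * (mutual_energy \<sigma> \<tau> - ln 2) + (mutual_energy \<tau> \<tau> - ln 2)"
    using ge by (intro LIMSEQ_le) auto
  then show ?thesis by (simp add: a_def b_def)
qed

text \<open>
  The product formula for cosines gives by induction equality for all \<open>t^m cos (k arccos t)\<close>, in
  particular for all powers. Hence all continuous functions have the same means, and so the
  characteristic functions of the real parts agree.
\<close>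

lemma moments_determine_measure:
  assumes \<sigma>: "\<sigma> \<in> segment_measures" and \<tau>: "\<tau> \<in> segment_measures"
    and eq: "\<And>k. k > 0 \<Longrightarrow> chebyshev_moment k \<sigma> = chebyshev_moment k \<tau>"
  shows "\<sigma> = \<tau>"
proof -
  define L where "L = (\<lambda>\<sigma> f. \<integral>s. f (clamped_Re s) \<partial>\<sigma> :: real)"
  have mean: "mean_on_interval (L \<sigma>)" if "\<sigma> \<in> segment_measures" for \<sigma>
    unfolding L_def
  proof (rule mean_on_interval_integral)
    show "prob_space \<sigma>" by (rule unit_measures_onD [OF that closed_unit_segment])
    show "clamped_Re \<in> borel_measurable \<sigma>"
      by (rule measurable_borel_sets [OF unit_measures_onD(1) [OF that closed_unit_segment] clamped_Re_measurable])
  qed (rule clamped_Re_bounds)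
  interpret mean_sequence "\<lambda>n. L \<sigma>" "L \<tau>"
    by unfold_locales (auto intro: mean \<sigma> \<tau>)
  have conv: "L \<sigma> f = L \<tau> f" if "converges f" for f
    using that by (simp add: converges_def LIMSEQ_const_iff)
  have conv': "converges f" if "continuous_on {-1..1} f" "L \<sigma> f = L \<tau> f" for f
    using that by (simp add: converges_def)
  have cont: "continuous_on {-1..1} (\<lambda>t. t ^ m * cos (real k * arccos t))" for m k
    by (intro continuous_on_mult continuous_on_cos continuous_on_power continuous_on_const
        continuous_on_id continuous_on_arccos')
  have cong: "L \<sigma> f = L \<sigma> g" if "\<And>t. t \<in> {-1..1} \<Longrightarrow> f t = g t" for f g \<sigma>
    unfolding L_def by (intro Bochner_Integration.integral_cong refl that clamped_Re_bounds(1))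
  have moments: "converges (\<lambda>t. t ^ m * cos (real k * arccos t))" for m k
  proof (induction m arbitrary: k)
    case 0
    show ?case
    proof (cases "k = 0")
      case True
      then show ?thesis by (simp add: converges_const)
    next
      case False
      then show ?thesis
        using eq [of k] cont [of 0 k]
        by (intro conv') (auto simp: L_def chebyshev_moment_def chebyshev_def)
    qed
  next
    case (Suc m)
    define g where "g = (\<lambda>t. 1 / 2 * (t ^ m * cos (real (k + 1) * arccos t) +
       t ^ m * cos (real (if k = 0 then 1 else k - 1) * arccos t)))"
    have g: "converges g" unfolding g_def by (intro converges_cmult converges_add Suc)
    have eq: "t ^ Suc m * cos (real k * arccos t) = g t" if "t \<in> {-1..1}" for t
    proof -
      define \<theta> where "\<theta> = arccos t"
      define a b where "a = cos (real (k + 1) * \<theta>)" and "b = cos (real (if k = 0 then 1 else k - 1) * \<theta>)"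
      have "cos \<theta> = t" using that by (simp add: \<theta>_def)
      moreover have "cos \<theta> * cos (real k * \<theta>) = (a + b) / 2"
      proof (cases "k = 0")
        case False
        then have "real (k - 1) = real k - 1" by simp
        then show ?thesis unfolding a_def b_def using False
          by (simp add: left_diff_distrib distrib_right cos_add cos_diff)
      qed (simp add: a_def b_def)
      ultimately have key: "t * cos (real k * \<theta>) = (a + b) / 2" by simp
      show ?thesis
        unfolding g_def \<theta>_def [symmetric] a_def [symmetric] b_def [symmetric]
        by (simp only: power_Suc2 mult.assoc key) (simp add: distrib_left)
    qed
    have "L \<sigma> (\<lambda>t. t ^ Suc m * cos (real k * arccos t)) = L \<sigma> g" for \<sigma>
      by (rule cong) (rule eq)
    then show ?case using cont [of "Suc m" k] conv [OF g] by (intro conv') auto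
  qed
  have "converges f" if "continuous_on {-1..1} f" for f
  proof (rule converges_of_moments [OF _ that])
    show "converges (\<lambda>t. t ^ m)" for m using moments [of m 0] by simp
  qed
  then have L: "L \<sigma> f = L \<tau> f" if "continuous_on {-1..1} f" for f
    using conv that by blast
  define R where "R = (\<lambda>\<sigma>. distr \<sigma> borel clamped_Re)"
  have D: "sets \<sigma> = sets borel" "prob_space \<sigma>" "clamped_Re \<in> borel_measurable \<sigma>"
    if "\<sigma> \<in> segment_measures" for \<sigma>
    using unit_measures_onD [OF that closed_unit_segment]
    by (auto intro: measurable_borel_sets clamped_Re_measurable)
  have char: "char (R \<sigma>) t = of_real (L \<sigma> (\<lambda>x. cos (t * x))) + \<i> * of_real (L \<sigma> (\<lambda>x. sin (t * x)))"
    if \<sigma>: "\<sigma> \<in> segment_measures" for \<sigma> t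
  proof -
    interpret S: prob_space \<sigma> by (rule D [OF \<sigma>])
    note [measurable] = D(3) [OF \<sigma>]
    have int: "integrable \<sigma> (\<lambda>s. cos (t * clamped_Re s))" "integrable \<sigma> (\<lambda>s. sin (t * clamped_Re s))"
      by (auto intro!: S.integrable_const_bound [where B = 1])
    have "char (R \<sigma>) t = (\<integral>s. iexp (t * clamped_Re s) \<partial>\<sigma>)"
      unfolding char_def R_def by (subst integral_distr) auto
    also have "\<dots> = (\<integral>s. of_real (cos (t * clamped_Re s)) + \<i> * of_real (sin (t * clamped_Re s)) \<partial>\<sigma>)"
      by (intro Bochner_Integration.integral_cong refl) (simp only: exp_Euler cos_of_real sin_of_real)
    also have "\<dots> = of_real (\<integral>s. cos (t * clamped_Re s) \<partial>\<sigma>) + \<i> * of_real (\<integral>s. sin (t * clamped_Re s) \<partial>\<sigma>)"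
      using int by (simp add: integral_complex_of_real)
    finally show ?thesis unfolding L_def .
  qed
  have "R \<sigma> = R \<tau>"
  proof (rule Levy_uniqueness)
    have "L \<sigma> (\<lambda>x. cos (t * x)) = L \<tau> (\<lambda>x. cos (t * x))" "L \<sigma> (\<lambda>x. sin (t * x)) = L \<tau> (\<lambda>x. sin (t * x))" for t
      by (intro L continuous_intros)+
    then show "char (R \<sigma>) = char (R \<tau>)"
      by (intro ext) (simp only: char [OF \<sigma>] char [OF \<tau>])
    show "real_distribution (R \<sigma>)" "real_distribution (R \<tau>)"
      unfolding R_def using D [OF \<sigma>] D [OF \<tau>] by (auto intro: prob_space.real_distribution_distr)
  qed
  moreover have "\<sigma> = distr (R \<sigma>) borel complex_of_real" if \<sigma>: "\<sigma> \<in> segment_measures" for \<sigma>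
  proof (rule measure_eqI)
    note [measurable] = D(3) [OF \<sigma>]
    show "sets \<sigma> = sets (distr (R \<sigma>) borel complex_of_real)" using D(1) [OF \<sigma>] by simp
    fix A assume A: "A \<in> sets \<sigma>"
    then have [measurable]: "A \<in> sets borel" using D(1) [OF \<sigma>] by simp
    have m: "(\<lambda>s. complex_of_real (clamped_Re s)) \<in> borel_measurable \<sigma>" by measurable
    have "distr (R \<sigma>) borel complex_of_real = distr \<sigma> borel (\<lambda>s. complex_of_real (clamped_Re s))"
      unfolding R_def by (subst distr_distr) (auto simp: comp_def)
    then have "emeasure (distr (R \<sigma>) borel complex_of_real) A
        = emeasure \<sigma> ((\<lambda>s. complex_of_real (clamped_Re s)) -` A \<inter> space \<sigma>)"
      using emeasure_distr [OF m] by simp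
    also have "\<dots> = emeasure \<sigma> A"
    proof (rule emeasure_eq_AE)
      show "AE s in \<sigma>. s \<in> (\<lambda>s. complex_of_real (clamped_Re s)) -` A \<inter> space \<sigma> \<longleftrightarrow> s \<in> A"
        using unit_measures_onD(3) [OF \<sigma> closed_unit_segment] AE_space
      proof eventually_elim
        case (elim s)
        then show ?case using unit_segment_clamped [OF elim(1)] by simp
      qed
    qed (use A m in auto)
    finally show "emeasure \<sigma> A = emeasure (distr (R \<sigma>) borel complex_of_real) A" by simp
  qed
  ultimately show ?thesis using \<sigma> \<tau> by metis
qed

section \<open>The weighted equilibrium problem\<close>

lemma csqrt_measurable [measurable]: "csqrt \<in> borel_measurable borel"
proof -
  have "csqrt = (\<lambda>z. of_real (sqrt ((cmod z + Re z) / 2)) +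
      \<i> * of_real ((if Im z = 0 then 1 else sgn (Im z)) * sqrt ((cmod z - Re z) / 2)))"
    by (rule ext) (simp add: complex_eq_iff)
  moreover have "(\<lambda>z. of_real (sqrt ((cmod z + Re z) / 2)) +
      \<i> * of_real ((if Im z = 0 then 1 else sgn (Im z)) * sqrt ((cmod z - Re z) / 2)))
      \<in> borel_measurable borel"
    by measurable
  ultimately show ?thesis by simp
qed

lemma nu_function_measurable [measurable]: "nu_function \<in> borel_measurable borel"
  unfolding nu_function_def by measurable

text \<open>
  On the segment all the roots lie in the closed first quadrant, so real and imaginary parts
  only add up.
\<close>

lemma cmod_nu_function_ge_1:
  assumes "z \<in> unit_segment"
  shows "cmod (nu_function z) \<ge> 1"
proof -
  obtain t where z: "z = complex_of_real t" and t: "-1 \<le> t" "t \<le> 1" using assms by auto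
  define E where "E = csqrt (z - 1 + csqrt (z - 1) * csqrt (z + 1))"
  have "csqrt (z + 1) = complex_of_real (sqrt (1 + t))"
    using csqrt_of_real [of "1 + t"] t by (simp add: z add.commute)
  moreover have "csqrt (z - 1) = \<i> * complex_of_real (sqrt (1 - t))"
  proof (cases "t = 1")
    case False
    then show ?thesis using csqrt_of_real' [of "t - 1"] t by (simp add: z)
  qed (simp add: z)
  ultimately have f: "nu_function z = of_real (sqrt (1 + t)) + 2 * (\<i> * of_real (sqrt (1 - t))) + 2 * E"
    and E: "E = csqrt (of_real (t - 1) + \<i> * of_real (sqrt (1 - t) * sqrt (1 + t)))"
    by (simp_all add: nu_function_def E_def z mult.assoc)
  have E0: "Re E \<ge> 0" "Im E \<ge> 0"
    using Re_csqrt Im_csqrt_sign(1) t by (auto simp: E simp del: csqrt.sel)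
  show ?thesis
  proof (cases "t \<ge> 0")
    case True
    have "1 \<le> Re (nu_function z)" using True E0 by (simp add: f add_increasing2)
    then show ?thesis using complex_Re_le_cmod [of "nu_function z"] by linarith
  next
    case False
    have "1 \<le> Im (nu_function z)"
    proof -
      have "1 \<le> sqrt (1 - t)" using False by simp
      moreover have "Im (nu_function z) = 2 * sqrt (1 - t) + 2 * Im E" by (simp add: f)
      ultimately show ?thesis using E0 by linarith
    qed
    then show ?thesis using abs_Im_le_cmod [of "nu_function z"] by linarith
  qed
qed

text \<open>
  This is \<open>- ln w\<close> for the weight \<open>w\<close>.
\<close>

definition external_field :: "complex \<Rightarrow> real" where
  "external_field s = 2 * ln (cmod (nu_function s))"

lemma external_field_measurable [measurable]: "external_field \<in> borel_measurable borel"
  unfolding external_field_def by measurable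

lemma external_field_nonneg: "s \<in> unit_segment \<Longrightarrow> external_field s \<ge> 0"
  using cmod_nu_function_ge_1 by (simp add: external_field_def)

lemma apery_weight_eq:
  assumes "s \<in> unit_segment"
  shows "apery_weight s > 0" "ln (apery_weight s) = - external_field s"
proof -
  have p: "cmod (nu_function s) > 0" using cmod_nu_function_ge_1 [OF assms] by linarith
  have w: "apery_weight s = cmod (nu_function s) powi (-2)"
    by (simp add: apery_weight_def nu_function_def)
  have w': "apery_weight s = 1 / (cmod (nu_function s))\<^sup>2"
    unfolding w by (simp add: power_int_minus divide_inverse)
  show "apery_weight s > 0" unfolding w' using p by simp
  show "ln (apery_weight s) = - external_field s"
    unfolding w' external_field_def using p by (simp add: ln_div ln_realpow)
qed

lemma apery_weight_measurable [measurable]: "apery_weight \<in> borel_measurable borel"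
proof -
  have "apery_weight = (\<lambda>z. inverse ((cmod (nu_function z))\<^sup>2))"
    by (rule ext) (simp add: apery_weight_def nu_function_def power_int_minus)
  moreover have "(\<lambda>z. inverse ((cmod (nu_function z))\<^sup>2)) \<in> borel_measurable borel" by measurable
  ultimately show ?thesis by simp
qed

lemma log_kernel_ge:
  assumes "s \<in> unit_segment" "t \<in> unit_segment"
  shows "log_kernel (s, t) \<ge> - ln 2" "\<bar>log_kernel (s, t)\<bar> \<le> log_kernel (s, t) + 2 * ln 2"
proof -
  have "cmod (s - t) \<le> cmod s + cmod t" by (rule norm_triangle_ineq4)
  also have "\<dots> \<le> 2" using assms by auto
  finally have c: "cmod (s - t) \<le> 2" .
  show ge: "log_kernel (s, t) \<ge> - ln 2"
  proof (cases "s = t")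
    case False
    then have "ln (cmod (s - t)) \<le> ln 2" using c by (subst ln_le_cancel_iff) auto
    then show ?thesis by (simp add: log_kernel_def)
  qed (simp add: log_kernel_def)
  then show "\<bar>log_kernel (s, t)\<bar> \<le> log_kernel (s, t) + 2 * ln 2"
    using ln_gt_zero [of 2] by (simp add: abs_le_iff) 
qed

lemma nu_kernel:
  shows "integrable nu_measure (\<lambda>t. log_kernel (s, t))"
    and "(\<integral>t. log_kernel (s, t) \<partial>nu_measure) = 4 * ln (1 + sqrt 2) - external_field s"
    and "AE t in nu_measure. s \<noteq> t"
proof -
  have m: "(\<lambda>x. complex_of_real (nu_point x)) \<in> borel_measurable unit_lebesgue" by measurable
  have k: "(\<lambda>t. log_kernel (s, t)) \<in> borel_measurable borel"
    unfolding log_kernel_def fst_conv snd_conv by measurable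
  show "integrable nu_measure (\<lambda>t. log_kernel (s, t))"
    unfolding nu_measure_def
    using nu_log_mean(2) by (subst integrable_distr_eq [OF m k]) (simp add: log_kernel_def)
  show "(\<integral>t. log_kernel (s, t) \<partial>nu_measure) = 4 * ln (1 + sqrt 2) - external_field s"
    unfolding nu_measure_def integral_distr [OF m k]
    using nu_log_mean(3) by (simp add: log_kernel_def external_field_def)
  show "AE t in nu_measure. s \<noteq> t"
    unfolding nu_measure_def
    by (subst AE_distr_iff [OF m]) (use nu_log_mean(1) in \<open>auto elim!: eventually_mono\<close>)
qed

text \<open>
  The potential of the limit measure is bounded on the segment, so Tonelli and Fubini apply for
  every unit measure \<open>\<sigma>\<close> there, of finite energy or not.
\<close>

lemma nu_mutual_energy:
  assumes \<sigma>: "\<sigma> \<in> segment_measures"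
  shows "finite_mutual_energy \<sigma> nu_measure" "integrable \<sigma> external_field"
    and "mutual_energy \<sigma> nu_measure = 4 * ln (1 + sqrt 2) - (\<integral>s. external_field s \<partial>\<sigma>)"
proof -
  define F where "F = 4 * ln (1 + sqrt 2)"
  note \<sigma>D = unit_measures_onD [OF \<sigma> closed_unit_segment]
  note \<nu>D = unit_measures_onD [OF nu_measure_unit closed_unit_segment]
  interpret S: prob_space \<sigma> by (rule \<sigma>D)
  interpret N: prob_space nu_measure by (rule \<nu>D)
  interpret P: pair_prob_space \<sigma> nu_measure ..
  have meas: "log_kernel \<in> borel_measurable (\<sigma> \<Otimes>\<^sub>M nu_measure)"
    by (rule measurable_pair_borel [OF \<sigma>D(1) \<nu>D(1)]) measurable
  have int: "integrable (\<sigma> \<Otimes>\<^sub>M nu_measure) log_kernel"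
  proof (rule P.Fubini_integrable [OF meas])
    show "AE s in \<sigma>. integrable nu_measure (\<lambda>t. log_kernel (s, t))"
      by (rule AE_I2) (rule nu_kernel)
    show "integrable \<sigma> (\<lambda>s. \<integral>t. norm (log_kernel (s, t)) \<partial>nu_measure)"
    proof (rule S.integrable_const_bound [where B = "F + 2 * ln 2"])
      have "(\<lambda>p. norm (log_kernel p)) \<in> borel_measurable (\<sigma> \<Otimes>\<^sub>M nu_measure)"
        using meas by measurable
      then have "case_prod (\<lambda>s t. norm (log_kernel (s, t))) \<in> borel_measurable (\<sigma> \<Otimes>\<^sub>M nu_measure)"
        by (simp add: case_prod_beta')
      then show "(\<lambda>s. \<integral>t. norm (log_kernel (s, t)) \<partial>nu_measure) \<in> borel_measurable \<sigma>"
        by (rule N.borel_measurable_lebesgue_integral)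
      show "AE s in \<sigma>. norm (\<integral>t. norm (log_kernel (s, t)) \<partial>nu_measure) \<le> F + 2 * ln 2"
        using \<sigma>D(3)
      proof eventually_elim
        case (elim s)
        note s = elim
        have "(\<integral>t. norm (log_kernel (s, t)) \<partial>nu_measure) \<le> (\<integral>t. log_kernel (s, t) + 2 * ln 2 \<partial>nu_measure)"
        proof (rule integral_mono_AE)
          show "integrable nu_measure (\<lambda>t. norm (log_kernel (s, t)))"
            using nu_kernel(1) by (rule integrable_norm)
          show "integrable nu_measure (\<lambda>t. log_kernel (s, t) + 2 * ln 2)"
            using nu_kernel(1) by simp
          show "AE t in nu_measure. norm (log_kernel (s, t)) \<le> log_kernel (s, t) + 2 * ln 2"
            using \<nu>D(3)
          proof eventually_elim
            case (elim t)
            show ?case unfolding real_norm_def by (rule log_kernel_ge(2) [OF s elim])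
          qed
        qed
        also have "\<dots> = F - external_field s + 2 * ln 2"
          using nu_kernel by (simp add: N.prob_space F_def)
        also have "\<dots> \<le> F + 2 * ln 2" using external_field_nonneg [OF elim] by simp
        finally show ?case by simp
      qed
    qed
  qed
  have ne: "AE p in \<sigma> \<Otimes>\<^sub>M nu_measure. fst p \<noteq> snd p"
  proof (rule P.AE_pair_measure)
    have "(\<lambda>p. fst p - snd p :: complex) \<in> borel_measurable (\<sigma> \<Otimes>\<^sub>M nu_measure)"
      by (rule measurable_pair_borel [OF \<sigma>D(1) \<nu>D(1)]) measurable
    then have "(\<lambda>p. fst p - snd p :: complex) -` (- {0}) \<inter> space (\<sigma> \<Otimes>\<^sub>M nu_measure) \<in> sets (\<sigma> \<Otimes>\<^sub>M nu_measure)"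
      by (rule measurable_sets) auto
    also have "(\<lambda>p. fst p - snd p :: complex) -` (- {0}) \<inter> space (\<sigma> \<Otimes>\<^sub>M nu_measure)
        = {p \<in> space (\<sigma> \<Otimes>\<^sub>M nu_measure). fst p \<noteq> snd p}" by auto
    finally show "{p \<in> space (\<sigma> \<Otimes>\<^sub>M nu_measure). fst p \<noteq> snd p} \<in> sets (\<sigma> \<Otimes>\<^sub>M nu_measure)" .
    show "AE s in \<sigma>. AE t in nu_measure. fst (s, t) \<noteq> snd (s, t)"
      by (rule AE_I2) (use nu_kernel(3) in simp)
  qed
  show "finite_mutual_energy \<sigma> nu_measure"
    using int ne by (simp add: finite_mutual_energy_def)
  have "integrable \<sigma> (\<lambda>s. \<integral>t. log_kernel (s, t) \<partial>nu_measure)" by (rule P.integrable_fst' [OF int])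
  then have iF: "integrable \<sigma> (\<lambda>s. F - external_field s)" by (simp add: nu_kernel(2) F_def)
  then have "integrable \<sigma> (\<lambda>s. F - (F - external_field s))" 
    by (intro Bochner_Integration.integrable_diff [OF _ iF]) simp
  moreover have "(\<lambda>s. F - (F - external_field s)) = external_field" by (rule ext) simp
  ultimately show ie: "integrable \<sigma> external_field" by (simp only:)
  have "mutual_energy \<sigma> nu_measure = (\<integral>s. \<integral>t. log_kernel (s, t) \<partial>nu_measure \<partial>\<sigma>)"
    unfolding mutual_energy_def by (rule P.integral_fst' [OF int, symmetric])
  also have "\<dots> = F - (\<integral>s. external_field s \<partial>\<sigma>)"
    using ie by (simp add: nu_kernel(2) F_def S.prob_space)
  finally show "mutual_energy \<sigma> nu_measure = 4 * ln (1 + sqrt 2) - (\<integral>s. external_field s \<partial>\<sigma>)"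
    by (simp add: F_def)
qed

lemma weighted_kernel:
  assumes "s \<in> unit_segment" "t \<in> unit_segment"
  shows "log_recip (cmod (s - t) * apery_weight s * apery_weight t) =
    (if s = t then \<infinity> else ereal (log_kernel (s, t) + external_field s + external_field t))"
proof (cases "s = t")
  case False
  define u where "u = cmod (s - t)"
  have u: "u > 0" using False by (simp add: u_def)
  note ws = apery_weight_eq [OF assms(1)] and wt = apery_weight_eq [OF assms(2)]
  have "ln (u * apery_weight s * apery_weight t) = ln u - external_field s - external_field t"
    using u ws wt by (simp add: ln_mult)
  then have "ln (1 / (u * apery_weight s * apery_weight t)) = - ln u + external_field s + external_field t"
    using u ws(1) wt(1) by (subst ln_div) auto
  then show ?thesis using False u ws(1) wt(1) by (simp add: log_recip_def log_kernel_def u_def)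
qed (simp add: log_recip_def)

lemma weighted_integrand_measurable:
  "(\<lambda>(s, t). log_recip (cmod (s - t) * apery_weight s * apery_weight t)) \<in> borel_measurable (borel \<Otimes>\<^sub>M borel)"
  unfolding case_prod_beta' by measurable

lemma weighted_energy_eq:
  assumes \<tau>: "\<tau> \<in> segment_measures" and fin: "finite_mutual_energy \<tau> \<tau>"
  shows "weighted_energy apery_weight \<tau> = ereal (mutual_energy \<tau> \<tau> + 2 * (\<integral>s. external_field s \<partial>\<tau>))"
proof -
  note D = unit_measures_onD [OF \<tau> closed_unit_segment]
  interpret T: prob_space \<tau> by (rule D)
  interpret P: pair_prob_space \<tau> \<tau> ..
  note ie = nu_mutual_energy(2) [OF \<tau>]
  have if1: "integrable (\<tau> \<Otimes>\<^sub>M \<tau>) (\<lambda>p. external_field (fst p))"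
    and if2: "integrable (\<tau> \<Otimes>\<^sub>M \<tau>) (\<lambda>p. external_field (snd p))"
  proof -
    have m1: "(\<lambda>p. external_field (fst p)) \<in> borel_measurable (\<tau> \<Otimes>\<^sub>M \<tau>)"
      by (rule measurable_pair_borel [OF D(1) D(1)]) measurable
    have m2: "(\<lambda>p. external_field (snd p)) \<in> borel_measurable (\<tau> \<Otimes>\<^sub>M \<tau>)"
      by (rule measurable_pair_borel [OF D(1) D(1)]) measurable
    show "integrable (\<tau> \<Otimes>\<^sub>M \<tau>) (\<lambda>p. external_field (fst p))"
      by (rule P.Fubini_integrable [OF m1]) (use ie in \<open>auto simp: T.prob_space integrable_abs\<close>)
    show "integrable (\<tau> \<Otimes>\<^sub>M \<tau>) (\<lambda>p. external_field (snd p))"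
      by (rule P.Fubini_integrable [OF m2]) (use ie in auto)
  qed
  have v1: "(\<integral>p. external_field (fst p) \<partial>(\<tau> \<Otimes>\<^sub>M \<tau>)) = (\<integral>s. external_field s \<partial>\<tau>)"
    using P.integral_fst' [OF if1] by (simp add: T.prob_space)
  have v2: "(\<integral>p. external_field (snd p) \<partial>(\<tau> \<Otimes>\<^sub>M \<tau>)) = (\<integral>s. external_field s \<partial>\<tau>)"
    using P.integral_fst' [OF if2] by (simp add: T.prob_space)
  have il: "integrable (\<tau> \<Otimes>\<^sub>M \<tau>) log_kernel" and ne: "AE p in \<tau> \<Otimes>\<^sub>M \<tau>. fst p \<noteq> snd p"
    using fin by (auto simp: finite_mutual_energy_def)
  have "weighted_energy apery_weight \<tau>
      = ereal (\<integral>p. log_kernel p + external_field (fst p) + external_field (snd p) \<partial>(\<tau> \<Otimes>\<^sub>M \<tau>))"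
    unfolding weighted_energy_def
  proof (rule ereal_integral_eq_integral)
    show "integrable (\<tau> \<Otimes>\<^sub>M \<tau>) (\<lambda>p. log_kernel p + external_field (fst p) + external_field (snd p))"
      using il if1 if2 by (intro Bochner_Integration.integrable_add)
    show "(\<lambda>(s, t). log_recip (cmod (s - t) * apery_weight s * apery_weight t)) \<in> borel_measurable (\<tau> \<Otimes>\<^sub>M \<tau>)"
      by (rule measurable_pair_borel [OF D(1) D(1) weighted_integrand_measurable])
    show "AE p in \<tau> \<Otimes>\<^sub>M \<tau>. (case p of (s, t) \<Rightarrow> log_recip (cmod (s - t) * apery_weight s * apery_weight t))
        = ereal (log_kernel p + external_field (fst p) + external_field (snd p))"
      using AE_pair_segment [OF \<tau> \<tau>] ne
      by eventually_elim (auto simp: weighted_kernel split: prod.splits)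
  qed
  also have "(\<integral>p. log_kernel p + external_field (fst p) + external_field (snd p) \<partial>(\<tau> \<Otimes>\<^sub>M \<tau>))
      = mutual_energy \<tau> \<tau> + 2 * (\<integral>s. external_field s \<partial>\<tau>)"
    using il if1 if2 v1 v2 by (simp add: mutual_energy_def)
  finally show ?thesis .
qed

text \<open>
  On the segment the extended integrand is bounded below, hence a weighted energy different from
  \<open>\<infinity>\<close> is finite. An infinite integrand on the diagonal then forces the diagonal to be null.
\<close>

lemma finite_weighted_energy:
  assumes \<tau>: "\<tau> \<in> segment_measures" and fin: "weighted_energy apery_weight \<tau> \<noteq> \<infinity>"
  shows "finite_mutual_energy \<tau> \<tau>"
proof -
  note D = unit_measures_onD [OF \<tau> closed_unit_segment]
  interpret T: prob_space \<tau> by (rule D)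
  interpret P: pair_prob_space \<tau> \<tau> ..
  define f where "f = (\<lambda>(s, t). log_recip (cmod (s - t) * apery_weight s * apery_weight t))"
  have fm: "f \<in> borel_measurable (\<tau> \<Otimes>\<^sub>M \<tau>)"
    unfolding f_def by (rule measurable_pair_borel [OF D(1) D(1) weighted_integrand_measurable])
  have f: "AE p in \<tau> \<Otimes>\<^sub>M \<tau>. f p = (if fst p = snd p then \<infinity> else
      ereal (log_kernel p + external_field (fst p) + external_field (snd p)))
      \<and> - ln 2 \<le> log_kernel p \<and> \<bar>log_kernel p\<bar> \<le> log_kernel p + 2 * ln 2
      \<and> 0 \<le> external_field (fst p) \<and> 0 \<le> external_field (snd p)"
    using AE_pair_segment [OF \<tau> \<tau>]
  proof eventually_elim
    case (elim p)
    obtain s t where p: "p = (s, t)" by (cases p)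
    have st: "s \<in> unit_segment" "t \<in> unit_segment" using elim by (auto simp: p)
    show ?case
      unfolding p f_def using weighted_kernel [OF st] log_kernel_ge [OF st] external_field_nonneg st by simp
  qed
  have "(\<integral>\<^sup>+p. e2ennreal (- f p) \<partial>(\<tau> \<Otimes>\<^sub>M \<tau>)) \<le> (\<integral>\<^sup>+p. ennreal (ln 2) \<partial>(\<tau> \<Otimes>\<^sub>M \<tau>))"
  proof (rule nn_integral_mono_AE)
    show "AE p in \<tau> \<Otimes>\<^sub>M \<tau>. e2ennreal (- f p) \<le> ennreal (ln 2)"
      using f
    proof eventually_elim
      case (elim p)
      have "- f p \<le> ereal (ln 2)"
      proof (cases "fst p = snd p")
        case True
        then have "f p = \<infinity>" using elim by metis
        then show ?thesis by simp
      next
        case False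
        then have "f p = ereal (log_kernel p + external_field (fst p) + external_field (snd p))"
          using elim by metis
        then have "- f p = ereal (- (log_kernel p + external_field (fst p) + external_field (snd p)))"
          by simp
        moreover have "- (log_kernel p + external_field (fst p) + external_field (snd p)) \<le> ln 2"
          using elim by linarith
        ultimately show ?thesis by (simp only: ereal_less_eq)
      qed
      then have "e2ennreal (- f p) \<le> e2ennreal (ereal (ln 2))" by (rule e2ennreal_mono)
      then show ?case by (simp only: e2ennreal_ereal)
    qed
  qed
  also have "\<dots> = ennreal (ln 2)" by (simp add: P.emeasure_space_1)
  finally have B: "(\<integral>\<^sup>+p. e2ennreal (- f p) \<partial>(\<tau> \<Otimes>\<^sub>M \<tau>)) \<noteq> \<infinity>" by (auto simp: top_unique)
  have A: "(\<integral>\<^sup>+p. e2ennreal (f p) \<partial>(\<tau> \<Otimes>\<^sub>M \<tau>)) \<noteq> \<infinity>"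
  proof
    assume "(\<integral>\<^sup>+p. e2ennreal (f p) \<partial>(\<tau> \<Otimes>\<^sub>M \<tau>)) = \<infinity>"
    then have "weighted_energy apery_weight \<tau> = \<infinity>"
      unfolding weighted_energy_def ereal_integral_def f_def by simp
    then show False using fin by simp
  qed
  have em: "(\<lambda>p. e2ennreal (f p)) \<in> borel_measurable (\<tau> \<Otimes>\<^sub>M \<tau>)"
    using fm by measurable
  have "AE p in \<tau> \<Otimes>\<^sub>M \<tau>. e2ennreal (f p) \<noteq> \<infinity>"
    by (rule nn_integral_PInf_AE [OF em A])
  then have ne: "AE p in \<tau> \<Otimes>\<^sub>M \<tau>. fst p \<noteq> snd p"
    using f by eventually_elim (auto split: if_splits)
  have "(\<integral>\<^sup>+p. ennreal (norm (log_kernel p)) \<partial>(\<tau> \<Otimes>\<^sub>M \<tau>))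
      \<le> (\<integral>\<^sup>+p. e2ennreal (f p) + ennreal (2 * ln 2) \<partial>(\<tau> \<Otimes>\<^sub>M \<tau>))"
  proof (rule nn_integral_mono_AE)
    show "AE p in \<tau> \<Otimes>\<^sub>M \<tau>. ennreal (norm (log_kernel p)) \<le> e2ennreal (f p) + ennreal (2 * ln 2)"
      using f ne
    proof eventually_elim
      case (elim p)
      define g where "g = log_kernel p + external_field (fst p) + external_field (snd p)"
      have "ennreal (norm (log_kernel p)) \<le> ennreal (max 0 g + 2 * ln 2)"
        using elim by (intro ennreal_leI) (auto simp: g_def)
      also have "\<dots> = ennreal (max 0 g) + ennreal (2 * ln 2)"
        by (rule ennreal_plus) auto
      also have "ennreal (max 0 g) = ennreal g" by (simp add: max_def ennreal_neg)
      also have "ennreal g = e2ennreal (f p)" using elim by (simp add: g_def)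
      finally show ?case .
    qed
  qed
  also have "\<dots> = (\<integral>\<^sup>+p. e2ennreal (f p) \<partial>(\<tau> \<Otimes>\<^sub>M \<tau>)) + ennreal (2 * ln 2)"
    using em by (subst nn_integral_add) (auto simp: P.emeasure_space_1)
  also have "\<dots> < \<infinity>" using A by (simp add: less_top)
  finally have "integrable (\<tau> \<Otimes>\<^sub>M \<tau>) log_kernel"
    by (intro integrableI_bounded measurable_pair_borel [OF D(1) D(1)]) measurable
  then show ?thesis using ne by (simp add: finite_mutual_energy_def)
qed

text \<open>
  Let \<open>F\<close> be the constant value of potential plus external field. The integral of the external field
  against \<open>\<tau>\<close> is \<open>F\<close> minus the mutual energy of \<open>\<tau>\<close> and \<open>\<nu>\<close>, so the difference of the weighted
  energies of \<open>\<tau>\<close> and \<open>\<nu>\<close> is exactly the energy of \<open>\<tau> - \<nu>\<close>.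
\<close>

lemma nu_solves_equilibrium:
  "solves_weighted_equilibrium unit_segment apery_weight \<sigma> \<longleftrightarrow> \<sigma> = nu_measure"
proof -
  define F where "F = 4 * ln (1 + sqrt 2)"
  note nu = nu_measure_unit
  have "mutual_energy nu_measure nu_measure = F - (\<integral>s. external_field s \<partial>nu_measure)"
    unfolding F_def by (rule nu_mutual_energy(3) [OF nu])
  then have Wnu: "weighted_energy apery_weight nu_measure = ereal (2 * F - mutual_energy nu_measure nu_measure)"
    unfolding weighted_energy_eq [OF nu nu_mutual_energy(1) [OF nu]] by simp
  have gap: "weighted_energy apery_weight \<tau> \<ge> weighted_energy apery_weight nu_measure
      + ereal (2 / real k * (chebyshev_moment k \<tau> - chebyshev_moment k nu_measure)\<^sup>2)"
    if \<tau>: "\<tau> \<in> segment_measures" for \<tau> k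
  proof (cases "weighted_energy apery_weight \<tau> = \<infinity>")
    case False
    have fin: "finite_mutual_energy \<tau> \<tau>" by (rule finite_weighted_energy [OF \<tau> False])
    have W: "weighted_energy apery_weight \<tau> = ereal (mutual_energy \<tau> \<tau> + 2 * (\<integral>s. external_field s \<partial>\<tau>))"
      by (rule weighted_energy_eq [OF \<tau> fin])
    have "mutual_energy \<tau> nu_measure = F - (\<integral>s. external_field s \<partial>\<tau>)"
      unfolding F_def by (rule nu_mutual_energy(3) [OF \<tau>])
    then show ?thesis
      using energy_distance_ge [OF \<tau> nu fin nu_mutual_energy(1) [OF \<tau>] nu_mutual_energy(1) [OF nu], of k]
      unfolding W Wnu by simp
  qed simp
  show ?thesis
  proof
    assume "\<sigma> = nu_measure"
    moreover have "weighted_energy apery_weight nu_measure \<le> weighted_energy apery_weight \<tau>"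
      if "\<tau> \<in> segment_measures" for \<tau>
      \<comment> \<open>For \<open>k = 0\<close> the gap is \<open>2 / 0 = 0\<close>.\<close>
      using gap [OF that, of 0] by simp
    ultimately show "solves_weighted_equilibrium unit_segment apery_weight \<sigma>"
      using nu by (simp add: solves_weighted_equilibrium_def)
  next
    assume "solves_weighted_equilibrium unit_segment apery_weight \<sigma>"
    then have \<sigma>: "\<sigma> \<in> segment_measures"
      and le: "weighted_energy apery_weight \<sigma> \<le> weighted_energy apery_weight nu_measure"
      using nu by (auto simp: solves_weighted_equilibrium_def)
    show "\<sigma> = nu_measure"
    proof (rule moments_determine_measure [OF \<sigma> nu])
      fix k :: nat assume k: "k > 0"
      have "2 / real k * (chebyshev_moment k \<sigma> - chebyshev_moment k nu_measure)\<^sup>2 \<le> 0"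
        using order_trans [OF gap [OF \<sigma>, of k] le] unfolding Wnu by simp
      then have "(chebyshev_moment k \<sigma> - chebyshev_moment k nu_measure)\<^sup>2 \<le> 0"
        using k by (simp add: divide_le_0_iff mult_le_0_iff)
      then show "chebyshev_moment k \<sigma> = chebyshev_moment k nu_measure" by simp
    qed
  qed
qed

section \<open>The asymptotic zero distributions\<close>

theorem theorem4p3:
  shows
    "(\<exists>\<nu> \<in> unit_measures_on (complex_of_real ` {-1..1}).
        weak_star_converges (\<lambda>n. zero_counting_measure (apery_tilde_poly n)) \<nu> \<and>
        (\<forall>\<sigma>. solves_weighted_equilibrium (complex_of_real ` {-1..1}) apery_weight \<sigma>
              \<longleftrightarrow> \<sigma> = \<nu>) \<and>
        (\<forall>z. log_potential \<nu> z = ereal (ln ((1 + sqrt 2) ^ 4)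
              - 2 * ln (cmod (csqrt (z + 1) + 2 * csqrt (z - 1)
                  + 2 * csqrt (z - 1 + csqrt (z - 1) * csqrt (z + 1)))))) \<and>
        absolutely_continuous (lebesgue_on_reals {-1..1}) \<nu> \<and>
        (AE x in lborel. x \<in> {-1..1} \<longrightarrow>
           RN_deriv (lebesgue_on_reals {-1..1}) \<nu> (complex_of_real x) =
             ennreal (1 / (pi * sqrt (1 + x) * (1 - x) powr (3 / 4)
                           * (sqrt 2 + sqrt (1 - x)) powr (1 / 2)))))
     \<and>
     (\<exists>\<mu> \<in> unit_measures_on (complex_of_real ` {..0}).
        weak_star_converges (\<lambda>n. zero_counting_measure (apery_poly n)) \<mu> \<and>
        (\<forall>z. log_potential \<mu> z = ereal (4 * ln 2
              - 2 * ln (cmod (1 + 2 * (csqrt z + csqrt (z + csqrt z)))))) \<and>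
        absolutely_continuous (lebesgue_on_reals {..0}) \<mu> \<and>
        (AE x in lborel. x \<in> {..0} \<longrightarrow>
           RN_deriv (lebesgue_on_reals {..0}) \<mu> (complex_of_real x) =
             ennreal (1 / (sqrt 2 * pi * \<bar>x\<bar> powr (3 / 4) * (1 + \<bar>x\<bar>) powr (1 / 2)
                           * (sqrt \<bar>x\<bar> + sqrt (1 + \<bar>x\<bar>)) powr (1 / 2)))))"
proof (rule conjI; rule bexI)
  have ln4: "ln ((1 + sqrt 2) ^ 4) = 4 * ln (1 + sqrt 2)"
    using ln_realpow [of "1 + sqrt 2" 4] by simp
  have dens: "absolutely_continuous (lebesgue_on_reals {-1..1}) nu_measure"
    "AE x in lborel. x \<in> {-1..1} \<longrightarrow>
      RN_deriv (lebesgue_on_reals {-1..1}) nu_measure (complex_of_real x) = ennreal \<bar>nu_density x\<bar>"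
    by (rule density_RN_deriv_lebesgue_on_reals [OF _ _ nu_measure_density];
        simp add: nu_density_def [abs_def])+
  have "\<bar>nu_density x\<bar> = nu_density x" if "x \<in> {-1..1}" for x
    using that by (auto simp: nu_density_def)
  then have rn: "AE x in lborel. x \<in> {-1..1} \<longrightarrow>
      RN_deriv (lebesgue_on_reals {-1..1}) nu_measure (complex_of_real x) = ennreal (nu_density x)"
    using dens(2) by (auto elim!: eventually_mono)
  show "weak_star_converges (\<lambda>n. zero_counting_measure (apery_tilde_poly n)) nu_measure \<and>
        (\<forall>\<sigma>. solves_weighted_equilibrium (complex_of_real ` {-1..1}) apery_weight \<sigma>
              \<longleftrightarrow> \<sigma> = nu_measure) \<and>
        (\<forall>z. log_potential nu_measure z = ereal (ln ((1 + sqrt 2) ^ 4)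
              - 2 * ln (cmod (csqrt (z + 1) + 2 * csqrt (z - 1)
                  + 2 * csqrt (z - 1 + csqrt (z - 1) * csqrt (z + 1)))))) \<and>
        absolutely_continuous (lebesgue_on_reals {-1..1}) nu_measure \<and>
        (AE x in lborel. x \<in> {-1..1} \<longrightarrow>
           RN_deriv (lebesgue_on_reals {-1..1}) nu_measure (complex_of_real x) =
             ennreal (1 / (pi * sqrt (1 + x) * (1 - x) powr (3 / 4)
                           * (sqrt 2 + sqrt (1 - x)) powr (1 / 2))))"
    unfolding ln4 nu_function_def [symmetric] nu_density_def [symmetric]
    by (intro conjI allI nu_weak_star nu_solves_equilibrium nu_log_potential dens(1) rn)
  show "nu_measure \<in> unit_measures_on (complex_of_real ` {-1..1})" by (rule nu_measure_unit)
  have dens': "absolutely_continuous (lebesgue_on_reals {..0}) mu_measure"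
    "AE x in lborel. x \<in> {..0} \<longrightarrow>
      RN_deriv (lebesgue_on_reals {..0}) mu_measure (complex_of_real x) = ennreal \<bar>mu_density x\<bar>"
    by (rule density_RN_deriv_lebesgue_on_reals [OF _ _ mu_measure_density];
        simp add: mu_density_def [abs_def])+
  have "\<bar>mu_density x\<bar> = mu_density x" for x
    by (simp add: mu_density_def)
  then have rn': "AE x in lborel. x \<in> {..0} \<longrightarrow>
      RN_deriv (lebesgue_on_reals {..0}) mu_measure (complex_of_real x) = ennreal (mu_density x)"
    using dens'(2) by simp
  show "weak_star_converges (\<lambda>n. zero_counting_measure (apery_poly n)) mu_measure \<and>
        (\<forall>z. log_potential mu_measure z = ereal (4 * ln 2
              - 2 * ln (cmod (1 + 2 * (csqrt z + csqrt (z + csqrt z)))))) \<and>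
        absolutely_continuous (lebesgue_on_reals {..0}) mu_measure \<and>
        (AE x in lborel. x \<in> {..0} \<longrightarrow>
           RN_deriv (lebesgue_on_reals {..0}) mu_measure (complex_of_real x) =
             ennreal (1 / (sqrt 2 * pi * \<bar>x\<bar> powr (3 / 4) * (1 + \<bar>x\<bar>) powr (1 / 2)
                           * (sqrt \<bar>x\<bar> + sqrt (1 + \<bar>x\<bar>)) powr (1 / 2))))"
    unfolding mu_density_def [symmetric]
    by (intro conjI allI mu_weak_star mu_log_potential dens'(1) rn')
  show "mu_measure \<in> unit_measures_on (complex_of_real ` {..0})" by (rule mu_measure_unit)
qed

end
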